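(* Consider a graphon game $\mathcal G(\mathcal A_{ad}^\infty,U,\theta,W)$ in which the players have homogeneous action sets, i.e. $\mathcal A^x=\mathcal A^0$ for all $x\in[0,1]$. Suppose that: (A1) For all $\tilde z,\tilde\theta\in\mathcal A$, $\tilde a\mapsto U(\tilde a,\tilde z,\tilde\theta)$ is continuously Gâteaux differentiable and $U(\tilde a,\tilde z,\tilde\theta)+\frac{\alpha_U}{2}\|\tilde a\|_{\mathcal A}^2$ is concave in $\tilde a$, with $\alpha_U>0$; and $\nabla_{\tilde a}U(\cdot,\tilde z,\tilde\theta)$ is Lipschitz in $\tilde z,\tilde\theta$ with constants $\ell_U,\ell_\theta$, i.e. $\|\nabla_{\tilde a}U(\tilde a,\tilde z_1,\tilde\theta_1)-\nabla_{\tilde a}U(\tilde a,\tilde z_2,\tilde\theta_2)\|_{\mathcal A}\le \ell_U\|\tilde z_1-\tilde z_2\|_{\mathcal A}+\ell_\theta\|\tilde\theta_1-\tilde\theta_2\|_{\mathcal A}$. (A2) $\mathcal A^0$ is nonempty, convex and closed, and there exist $\tilde z_0,\tilde\theta_0\in\mathcal A$ such that $(\arg\max_{\tilde a\in\mathcal A^x}U(\tilde a,\tilde z_0,\tilde\theta_0))_{x\in[0,1]}\in\mathcal A^\infty$. (A3) There is a constant $M$ such that $\|\tilde a\|_{\mathcal A}\le M$ for all $\tilde a\in\mathcal A^0$. (A4) $\ell_U\lambda_1(\boldsymbol W)<\alpha_U$. (A5) $U(\tilde a,\tilde z,\tilde\theta)$ is jointly Lipschitz in $(\tilde a,\tilde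 z,\tilde\theta)$. (A6) There exists a solution $\bar\theta$ to the graphon intervention problem such that $\|\bar\theta^x\|_{\mathcal A}\le\bar\theta_{\max}$ for all $x\in[0,1]$ and a constant $\bar\theta_{\max}$, and there exist a constant $L_{\bar\theta}$ and a finite partition $\{I_1,\dots,I_{K_{\bar\theta}+1}\}$ of $[0,1]$ such that for any $1\le k\le K_{\bar\theta}+1$ and $x,x'\in I_k$, $\|\bar\theta^x-\bar\theta^{x'}\|_{\mathcal A}\le L_{\bar\theta}|x-x'|$. Let $(G^N)_{N\in\mathbb N}$, $G^N\in[0,1]^{N\times N}$ symmetric, satisfy $\|W-W_{G^N}\|_\Box\to0$, and let $\theta^N\in\mathcal A^N$ satisfy $\|\theta-\theta^N_{\mathrm{step}}\|_{\mathcal A^\infty}\to0$ as $N\to\infty$. Then: (i) There is $N_0\in\mathbb N$ such that the network game $\mathcal G((\mathcal A^0)^N,U,\theta^N+\hat\theta^N,G^N)$ admits a unique Nash equilibrium for all $\hat\theta^N\in\mathcal A^N$ and all $N\ge N_0$. (ii) Let $T^N_{\mathrm{opt}}$ be the optimal value of the network intervention problem and $\bar\theta^N_W$ the approximate network intervention built from $\bar\theta$. For all $N\ge N_0$, $$T^N_{\mathrm{opt}}-T^N(\bar\theta^N_W)=\mathcal O\left(\|W-W_{G^N}\|_\Box^{1/2}\vee\|\theta-\theta^N_{\mathrm{step}}\|_{\mathcal A^\infty}\vee\frac1{\sqrt N}\right).$$ In particular, $T^N(\bar\theta^N_W)\to T^N_{\mathrm{opt}}$ as $N\to\infty$, i.e.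 $T^N_{\mathrm{opt}}-T^N(\bar\theta^N_W)\to0$.
   Context: Probabilistic setting. Fix a time horizon (also denoted $T>0$, not to be confused with the welfare functionals $T(\cdot),T^N(\cdot)$), a probability space $(\Omega,\mathcal F,\mathbb P)$, a probability space $([0,1],\mathcal I,\nu)$ extending the Lebesgue space on $[0,1]$, and a rich Fubini extension $([0,1]\times\Omega,\mathcal I\boxtimes\mathcal F,\nu\boxtimes\mathbb P)$ of the product space (an extension on which Fubini's theorem holds for all integrable functions and which supports essentially pairwise independent families of processes). Write $dx$ for $\nu(dx)$. $\mathbb F=(\mathcal F_t)_{0\le t\le T}$ is the augmentation of the filtration generated by $(\theta^x)_{x\in[0,1]}$; the augmented filtrations generated by the finite-player heterogeneity processes are assumed to be contained in $\mathbb F$. $\mathcal A$ is the Hilbert space of $\mathbb F$-progressively measurable $\tilde a:\Omega\times[0,T]\to\mathbb R$ with $\|\tilde a\|_{\mathcal A}^2=\int_0^T\mathbb E[\tilde a_t^2]dt<\infty$; $\mathcal A^N$ carries $\|a^N\|_{\mathcal A^N}^2=\sum_{i=1}^N\|a^{i,N}\|_{\mathcal A}^2$. An action profile is a family $a=(a^x)_{x\in[0,1]}$, $a^x\in\mathcal A$, with $(x,t,\omega)\mapsto a^x_t(\omega)$ being $\mathcal I\otimes\mathcal B([0,T])\otimes\mathcal F$-measurable; $\mathcal A^\infty$ is the Hilbert space of action profiles with $\|a\|_{\mathcal A^\infty}^2=\int_0^1\int_0^T\mathbb E[(a_t^x)^2]dtdx<\infty$. $U:\mathcal A^3\to\mathbb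 R$ is a given utility functional. Graphon game $\mathcal G(\mathcal A_{ad}^\infty,U,\theta,W)$: $\theta\in\mathcal A^\infty$; $W$ is a graphon (symmetric measurable $[0,1]^2\to[0,1]$); $(\boldsymbol Wf)(x)=\int_0^1W(x,y)f(y)dy$ on $L^2([0,1],\mathbb R)$ (also applied to $\mathcal A^\infty$); $\lambda_1(\boldsymbol W)$ is its largest eigenvalue; $\mathcal A_{ad}^\infty=\{a\in\mathcal A^\infty:a^x\in\mathcal A^x\ \forall x\}$. A Nash equilibrium is $\bar a\in\mathcal A_{ad}^\infty$ with $\bar a^x=\arg\max_{\tilde a\in\mathcal A^x}U(\tilde a,(\boldsymbol W\bar a)(x),\theta^x)$ for every $x\in[0,1]$. Network game $\mathcal G((\mathcal A^0)^N,U,\theta^N,G^N)$: a Nash equilibrium is $\bar a^N\in(\mathcal A^0)^N$ with $\bar a^{i,N}=\arg\max_{\tilde a\in\mathcal A^0}U(\tilde a,\frac1N\sum_jG^N_{ij}\bar a^{j,N},\theta^{i,N})$ for all $i$. Step objects. $\mathcal P_i^N=[\frac{i-1}N,\frac iN)$ for $i<N$, $\mathcal P_N^N=[\frac{N-1}N,1]$. For $a^N\in\mathcal A^N$, $a^{x,N}_{\mathrm{step}}=a^{i,N}$ for $x\in\mathcal P_i^N$. $W_{G^N}(x,y)=G^N_{ij}$ for $(x,y)\in\mathcal P_i^N\times\mathcal P_j^N$. Cut norm: $\|W\|_\Box=\sup_{S_1,S_2\subset[0,1]\text{ Borel}}|\int_{S_1}\int_{S_2}W(x,y)dxdy|$.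 Intervention problems with budget $C_B>0$. Graphon problem: maximize over $\hat\theta\in\mathcal A^\infty$ with $\|\hat\theta\|_{\mathcal A^\infty}^2\le C_B$ the value $T(\hat\theta)=\int_0^1U(\bar a^x_{\hat\theta},\bar z^x_{\hat\theta},\theta^x+\hat\theta^x)dx$, where $\bar a_{\hat\theta}$ is the Nash equilibrium of $\mathcal G(\mathcal A_{ad}^\infty,U,\theta+\hat\theta,W)$ and $\bar z_{\hat\theta}=\boldsymbol W\bar a_{\hat\theta}$. Network problem: maximize over $\hat\theta^N\in\mathcal A^N$ with $\frac1N\|\hat\theta^N\|_{\mathcal A^N}^2\le C_B$ the value $T^N(\hat\theta^N)=\frac1N\sum_{i=1}^NU(\bar a^{i,N},\bar z^{i,N},\theta^{i,N}+\hat\theta^{i,N})$, where $\bar a^N$ is the Nash equilibrium of $\mathcal G((\mathcal A^0)^N,U,\theta^N+\hat\theta^N,G^N)$ and $\bar z^N=\frac1NG^N\bar a^N$; $T^N_{\mathrm{opt}}$ is the supremum of $T^N$ over this set. Approximate intervention: $(\bar\theta^N_W)_i=\bar\theta(\frac iN)/\gamma^N$, $i=1,\dots,N$, where $\bar\theta(\frac iN)$ denotes $\bar\theta^x$ at $x=\frac iN$ and $\gamma^N$ is the normalizing constant ensuring $\frac1N\|\bar\theta^N_W\|_{\mathcal A^N}^2=\|\bar\theta\|_{\mathcal A^\infty}^2$ (with $\bar\theta^N_W=0$ if all $\bar\theta(\frac iN)=0$). The implied constant in $\mathcal O$ does not depend on $N$.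
   Formalization: In (A6) the pieces I_k of the partition are taken to be intervals (with arbitrary sets the claim fails: alter the solution on the rationals), and (A5) is required only for actions in A^0, since on all of A it contradicts the strong concavity in (A1). *)

theory Defs
  imports "HOL-Probability.Probability" "HOL-Library.Function_Algebras"
begin

text \<open>
  Sums and differences of processes, and of families of processes, are pointwise
  (\<^theory>\<open>HOL-Library.Function_Algebras\<close>).
\<close>

type_synonym 'w process = "'w \<Rightarrow> real \<Rightarrow> real"
type_synonym 'w profile = "real \<Rightarrow> 'w process"
type_synonym 'w utility = "'w process \<Rightarrow> 'w process \<Rightarrow> 'w process \<Rightarrow> real"


section \<open>The probabilistic setting\<close>

definition extends_lebesgue_01 :: "real measure \<Rightarrow> bool" where
  "extends_lebesgue_01 \<nu> \<longleftrightarrow>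
     prob_space \<nu> \<and> space \<nu> = {0..1} \<and>
     sets (lebesgue_on {0..1}) \<subseteq> sets \<nu> \<and>
     (\<forall>S\<in>sets (lebesgue_on {0..1}). emeasure \<nu> S = emeasure (lebesgue_on {0..1}) S)"

text \<open>
  The inner integral of an integrable function is only defined almost everywhere, hence the
  versions \<open>g\<close> and \<open>h\<close>.
\<close>

definition fubini_extension :: "'a measure \<Rightarrow> 'b measure \<Rightarrow> ('a \<times> 'b) measure \<Rightarrow> bool" where
  "fubini_extension M N E \<longleftrightarrow>
     prob_space E \<and> space E = space M \<times> space N \<and>
     sets (M \<Otimes>\<^sub>M N) \<subseteq> sets E \<and>
     (\<forall>S\<in>sets (M \<Otimes>\<^sub>M N). emeasure E S = emeasure (M \<Otimes>\<^sub>M N) S) \<and>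
     (\<forall>f :: 'a \<times> 'b \<Rightarrow> real. integrable E f \<longrightarrow>
        (\<exists>g. integrable M g \<and> integral\<^sup>L M g = integral\<^sup>L E f \<and>
             (AE x in M. integrable N (\<lambda>y. f (x, y)) \<and> g x = (LINT y|N. f (x, y)))) \<and>
        (\<exists>h. integrable N h \<and> integral\<^sup>L N h = integral\<^sup>L E f \<and>
             (AE y in N. integrable M (\<lambda>x. f (x, y)) \<and> h y = (LINT x|M. f (x, y)))))"

text \<open>
  Richness: some measurable process is essentially pairwise independent with uniformly
  distributed marginals on \<open>[0,1]\<close>.
\<close>

definition rich_fubini_extension :: "'a measure \<Rightarrow> 'b measure \<Rightarrow> ('a \<times> 'b) measure \<Rightarrow> bool" where
  "rich_fubini_extension M N E \<longleftrightarrow>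
     fubini_extension M N E \<and>
     (\<exists>f :: 'a \<times> 'b \<Rightarrow> real. f \<in> borel_measurable E \<and>
        (AE x in M. AE x' in M.
           prob_space.indep_var N borel (\<lambda>\<omega>. f (x, \<omega>)) borel (\<lambda>\<omega>. f (x', \<omega>))) \<and>
        (AE x in M. distr N borel (\<lambda>\<omega>. f (x, \<omega>)) = uniform_measure lborel {0..1}))"

text \<open>Generated filtration, augmented by the null sets of \<open>P\<close>.\<close>

definition aug_filtration :: "'w measure \<Rightarrow> 'i set \<Rightarrow> ('i \<Rightarrow> 'w process) \<Rightarrow> real \<Rightarrow> 'w measure" where
  "aug_filtration P J X t =
     sigma (space P)
       ({(\<lambda>\<omega>. X i \<omega> s) -` B \<inter> space P | i s B. i \<in> J \<and> s \<in> {0..t} \<and> B \<in> sets borel}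
        \<union> null_sets P)"

definition progressively_measurable :: "(real \<Rightarrow> 'w measure) \<Rightarrow> real \<Rightarrow> 'w process \<Rightarrow> bool" where
  "progressively_measurable \<FF> Tm a \<longleftrightarrow>
     (\<forall>t\<in>{0..Tm}. (\<lambda>(\<omega>, s). a \<omega> s)
        \<in> borel_measurable (\<FF> t \<Otimes>\<^sub>M restrict_space borel {0..t}))"


section \<open>The spaces of processes and of profiles\<close>

text \<open>
  The Hilbert spaces are represented by genuine functions; two functions stand for the same
  element iff the norm of their difference is \<open>0\<close>.  Values at times outside \<open>[0,Tm]\<close> and at
  player labels outside \<open>[0,1]\<close> are irrelevant.
\<close>

definition proc_space :: "'w measure \<Rightarrow> (real \<Rightarrow> 'w measure) \<Rightarrow> real \<Rightarrow> 'w process set" where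
  "proc_space P \<FF> Tm =
     {a. progressively_measurable \<FF> Tm a \<and>
         (\<integral>\<^sup>+t\<in>{0..Tm}. (\<integral>\<^sup>+\<omega>. ennreal ((a \<omega> t)\<^sup>2) \<partial>P) \<partial>lborel) < \<infinity>}"

definition proc_inner :: "'w measure \<Rightarrow> real \<Rightarrow> 'w process \<Rightarrow> 'w process \<Rightarrow> real" where
  "proc_inner P Tm a b = (LINT t:{0..Tm}|lborel. (LINT \<omega>|P. a \<omega> t * b \<omega> t))"

definition proc_norm :: "'w measure \<Rightarrow> real \<Rightarrow> 'w process \<Rightarrow> real" where
  "proc_norm P Tm a = sqrt (LINT t:{0..Tm}|lborel. (LINT \<omega>|P. (a \<omega> t)\<^sup>2))"

definition prof_space ::
    "'w measure \<Rightarrow> (real \<Rightarrow> 'w measure) \<Rightarrow> real \<Rightarrow> real measure \<Rightarrow> 'w profile set" where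
  "prof_space P \<FF> Tm \<nu> =
     {a. (\<forall>x\<in>{0..1}. a x \<in> proc_space P \<FF> Tm) \<and>
         (\<lambda>(x, t, \<omega>). a x \<omega> t)
           \<in> borel_measurable (\<nu> \<Otimes>\<^sub>M (restrict_space borel {0..Tm} \<Otimes>\<^sub>M P)) \<and>
         (\<integral>\<^sup>+x. (\<integral>\<^sup>+t\<in>{0..Tm}. (\<integral>\<^sup>+\<omega>. ennreal ((a x \<omega> t)\<^sup>2) \<partial>P) \<partial>lborel) \<partial>\<nu>) < \<infinity>}"

definition prof_norm :: "'w measure \<Rightarrow> real \<Rightarrow> real measure \<Rightarrow> 'w profile \<Rightarrow> real" where
  "prof_norm P Tm \<nu> a = sqrt (LINT x|\<nu>. (LINT t:{0..Tm}|lborel. (LINT \<omega>|P. (a x \<omega> t)\<^sup>2)))"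

text \<open>Finite-player profiles carry the player labels \<open>1, \<dots>, N\<close>.\<close>

definition fin_prof_space ::
    "'w measure \<Rightarrow> (real \<Rightarrow> 'w measure) \<Rightarrow> real \<Rightarrow> nat \<Rightarrow> (nat \<Rightarrow> 'w process) set" where
  "fin_prof_space P \<FF> Tm N = {a. \<forall>i\<in>{1..N}. a i \<in> proc_space P \<FF> Tm}"

definition fin_prof_norm :: "'w measure \<Rightarrow> real \<Rightarrow> nat \<Rightarrow> (nat \<Rightarrow> 'w process) \<Rightarrow> real" where
  "fin_prof_norm P Tm N a = sqrt (\<Sum>i\<in>{1..N}. (proc_norm P Tm (a i))\<^sup>2)"

definition proc_closed :: "'w measure \<Rightarrow> (real \<Rightarrow> 'w measure) \<Rightarrow> real \<Rightarrow> 'w process set \<Rightarrow> bool" where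
  "proc_closed P \<FF> Tm S \<longleftrightarrow>
     (\<forall>b a. (\<forall>n :: nat. b n \<in> S) \<longrightarrow> a \<in> proc_space P \<FF> Tm \<longrightarrow>
        (\<lambda>n. proc_norm P Tm (b n - a)) \<longlonglongrightarrow> 0 \<longrightarrow> a \<in> S)"

definition proc_convex :: "'w process set \<Rightarrow> bool" where
  "proc_convex S \<longleftrightarrow>
     (\<forall>a\<in>S. \<forall>b\<in>S. \<forall>s\<in>{0..1}. (\<lambda>\<omega> t. (1 - s) * a \<omega> t + s * b \<omega> t) \<in> S)"


section \<open>Utility functionals\<close>

text \<open>Since processes are representatives, a functional on the Hilbert space must not
  distinguish representatives of the same element.\<close>

definition utility_functional ::
    "'w measure \<Rightarrow> (real \<Rightarrow> 'w measure) \<Rightarrow> real \<Rightarrow> 'w utility \<Rightarrow> bool" where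
  "utility_functional P \<FF> Tm U \<longleftrightarrow>
     (\<forall>a\<in>proc_space P \<FF> Tm. \<forall>a'\<in>proc_space P \<FF> Tm.
      \<forall>z\<in>proc_space P \<FF> Tm. \<forall>z'\<in>proc_space P \<FF> Tm.
      \<forall>\<eta>\<in>proc_space P \<FF> Tm. \<forall>\<eta>'\<in>proc_space P \<FF> Tm.
        proc_norm P Tm (a - a') = 0 \<longrightarrow> proc_norm P Tm (z - z') = 0 \<longrightarrow>
        proc_norm P Tm (\<eta> - \<eta>') = 0 \<longrightarrow> U a z \<eta> = U a' z' \<eta>')"

definition gateaux_gradient ::
    "'w measure \<Rightarrow> (real \<Rightarrow> 'w measure) \<Rightarrow> real \<Rightarrow> ('w process \<Rightarrow> real) \<Rightarrow> 'w process \<Rightarrow> 'w process \<Rightarrow> bool"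
  where
  "gateaux_gradient P \<FF> Tm f a g \<longleftrightarrow>
     g \<in> proc_space P \<FF> Tm \<and>
     (\<forall>h\<in>proc_space P \<FF> Tm.
        ((\<lambda>\<epsilon>. f (\<lambda>\<omega> t. a \<omega> t + \<epsilon> * h \<omega> t)) has_real_derivative proc_inner P Tm g h) (at 0))"

definition cont_gateaux_with_gradient ::
    "'w measure \<Rightarrow> (real \<Rightarrow> 'w measure) \<Rightarrow> real \<Rightarrow> ('w process \<Rightarrow> real) \<Rightarrow> ('w process \<Rightarrow> 'w process) \<Rightarrow> bool"
  where
  "cont_gateaux_with_gradient P \<FF> Tm f D \<longleftrightarrow>
     (\<forall>a\<in>proc_space P \<FF> Tm. gateaux_gradient P \<FF> Tm f a (D a)) \<and>
     (\<forall>b. \<forall>a\<in>proc_space P \<FF> Tm. (\<forall>n :: nat. b n \<in> proc_space P \<FF> Tm) \<longrightarrow>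
        (\<lambda>n. proc_norm P Tm (b n - a)) \<longlonglongrightarrow> 0 \<longrightarrow>
        (\<lambda>n. proc_norm P Tm (D (b n) - D a)) \<longlonglongrightarrow> 0)"

definition proc_concave ::
    "'w measure \<Rightarrow> (real \<Rightarrow> 'w measure) \<Rightarrow> real \<Rightarrow> ('w process \<Rightarrow> real) \<Rightarrow> bool" where
  "proc_concave P \<FF> Tm f \<longleftrightarrow>
     (\<forall>a\<in>proc_space P \<FF> Tm. \<forall>b\<in>proc_space P \<FF> Tm. \<forall>s\<in>{0..1}.
        (1 - s) * f a + s * f b \<le> f (\<lambda>\<omega> t. (1 - s) * a \<omega> t + s * b \<omega> t))"

definition regular_utility ::
    "'w measure \<Rightarrow> (real \<Rightarrow> 'w measure) \<Rightarrow> real \<Rightarrow> 'w utility \<Rightarrow> real \<Rightarrow> real \<Rightarrow> real \<Rightarrow> bool" where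
  "regular_utility P \<FF> Tm U \<alpha>\<^sub>U l\<^sub>U l\<^sub>\<theta> \<longleftrightarrow>
     (\<exists>D. (\<forall>z\<in>proc_space P \<FF> Tm. \<forall>\<eta>\<in>proc_space P \<FF> Tm.
             cont_gateaux_with_gradient P \<FF> Tm (\<lambda>a. U a z \<eta>) (\<lambda>a. D a z \<eta>)) \<and>
          (\<forall>a\<in>proc_space P \<FF> Tm.
           \<forall>z\<in>proc_space P \<FF> Tm. \<forall>\<eta>\<in>proc_space P \<FF> Tm.
           \<forall>z'\<in>proc_space P \<FF> Tm. \<forall>\<eta>'\<in>proc_space P \<FF> Tm.
             proc_norm P Tm (D a z \<eta> - D a z' \<eta>')
               \<le> l\<^sub>U * proc_norm P Tm (z - z') + l\<^sub>\<theta> * proc_norm P Tm (\<eta> - \<eta>'))) \<and>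
     \<alpha>\<^sub>U > 0 \<and>
     (\<forall>z\<in>proc_space P \<FF> Tm. \<forall>\<eta>\<in>proc_space P \<FF> Tm.
        proc_concave P \<FF> Tm (\<lambda>a. U a z \<eta> + \<alpha>\<^sub>U / 2 * (proc_norm P Tm a)\<^sup>2))"

text \<open>
  The first argument is confined to the set \<open>S\<close> of admissible actions: a functional that is
  strongly concave in its first argument is never Lipschitz in it on the whole Hilbert space.
\<close>

definition jointly_lipschitz ::
    "'w measure \<Rightarrow> (real \<Rightarrow> 'w measure) \<Rightarrow> real \<Rightarrow> 'w process set \<Rightarrow> 'w utility \<Rightarrow> bool" where
  "jointly_lipschitz P \<FF> Tm S U \<longleftrightarrow>
     (\<exists>L. \<forall>a\<in>S. \<forall>a'\<in>S.
        \<forall>z\<in>proc_space P \<FF> Tm. \<forall>z'\<in>proc_space P \<FF> Tm.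
        \<forall>\<eta>\<in>proc_space P \<FF> Tm. \<forall>\<eta>'\<in>proc_space P \<FF> Tm.
          \<bar>U a z \<eta> - U a' z' \<eta>'\<bar>
            \<le> L * (proc_norm P Tm (a - a') + proc_norm P Tm (z - z') + proc_norm P Tm (\<eta> - \<eta>')))"


section \<open>Graphons\<close>

text \<open>Measurability refers to the product of the Lebesgue sigma-algebras, so that every section
  \<open>W x\<close> is Lebesgue measurable.\<close>

definition graphon :: "(real \<Rightarrow> real \<Rightarrow> real) \<Rightarrow> bool" where
  "graphon W \<longleftrightarrow>
     (\<lambda>(x, y). W x y) \<in> borel_measurable (lebesgue_on {0..1} \<Otimes>\<^sub>M lebesgue_on {0..1}) \<and>
     (\<forall>x\<in>{0..1}. \<forall>y\<in>{0..1}. W x y = W y x \<and> 0 \<le> W x y \<and> W x y \<le> 1)"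

definition graphon_op :: "real measure \<Rightarrow> (real \<Rightarrow> real \<Rightarrow> real) \<Rightarrow> (real \<Rightarrow> real) \<Rightarrow> real \<Rightarrow> real" where
  "graphon_op \<mu> W f x = (LINT y|\<mu>. W x y * f y)"

definition graphon_eigenvalue :: "(real \<Rightarrow> real \<Rightarrow> real) \<Rightarrow> real \<Rightarrow> bool" where
  "graphon_eigenvalue W l \<longleftrightarrow>
     (\<exists>f \<in> borel_measurable (lebesgue_on {0..1}).
        integrable (lebesgue_on {0..1}) (\<lambda>x. (f x)\<^sup>2) \<and>
        \<not> (AE x in lebesgue_on {0..1}. f x = 0) \<and>
        (AE x in lebesgue_on {0..1}. graphon_op (lebesgue_on {0..1}) W f x = l * f x))"

definition largest_eigenvalue :: "(real \<Rightarrow> real \<Rightarrow> real) \<Rightarrow> real" where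
  "largest_eigenvalue W = (GREATEST l. graphon_eigenvalue W l)"

definition cut_norm :: "(real \<Rightarrow> real \<Rightarrow> real) \<Rightarrow> real" where
  "cut_norm W =
     Sup {\<bar>LINT x:S\<^sub>1|lebesgue. (LINT y:S\<^sub>2|lebesgue. W x y)\<bar> | S\<^sub>1 S\<^sub>2.
            S\<^sub>1 \<in> sets borel \<and> S\<^sub>2 \<in> sets borel \<and> S\<^sub>1 \<subseteq> {0..1} \<and> S\<^sub>2 \<subseteq> {0..1}}"

text \<open>
  The integral defining the image of a profile at \<open>x\<close> is an element of the Hilbert space of
  processes; as a function of \<open>(\<omega>, t)\<close> it need only agree almost everywhere with a
  progressively measurable one, so a representative is selected.
\<close>

definition graphon_aggregate ::
    "'w measure \<Rightarrow> (real \<Rightarrow> 'w measure) \<Rightarrow> real \<Rightarrow> real measure \<Rightarrow> (real \<Rightarrow> real \<Rightarrow> real)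
     \<Rightarrow> 'w profile \<Rightarrow> 'w profile" where
  "graphon_aggregate P \<FF> Tm \<nu> W a x =
     (SOME z. z \<in> proc_space P \<FF> Tm \<and>
        (AE (\<omega>, t) in P \<Otimes>\<^sub>M restrict_space lborel {0..Tm}.
           z \<omega> t = graphon_op \<nu> W (\<lambda>y. a y \<omega> t) x))"


section \<open>Step objects\<close>

definition cell :: "nat \<Rightarrow> nat \<Rightarrow> real set" where
  "cell N i =
     (if i < N then {(real i - 1) / real N ..< real i / real N} else {(real N - 1) / real N .. 1})"

definition cell_index :: "nat \<Rightarrow> real \<Rightarrow> nat" where
  "cell_index N x = (THE i. i \<in> {1..N} \<and> x \<in> cell N i)"

definition step_profile :: "nat \<Rightarrow> (nat \<Rightarrow> 'w process) \<Rightarrow> 'w profile" where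
  "step_profile N a x = a (cell_index N x)"

definition step_graphon :: "nat \<Rightarrow> (nat \<Rightarrow> nat \<Rightarrow> real) \<Rightarrow> real \<Rightarrow> real \<Rightarrow> real" where
  "step_graphon N G x y = G (cell_index N x) (cell_index N y)"


section \<open>Games and Nash equilibria\<close>

text \<open>The argument \<open>Ad x\<close> is the action set of player \<open>x\<close>.\<close>

definition graphon_nash ::
    "'w measure \<Rightarrow> (real \<Rightarrow> 'w measure) \<Rightarrow> real \<Rightarrow> real measure \<Rightarrow> (real \<Rightarrow> 'w process set)
     \<Rightarrow> 'w utility \<Rightarrow> 'w profile \<Rightarrow> (real \<Rightarrow> real \<Rightarrow> real) \<Rightarrow> 'w profile \<Rightarrow> bool" where
  "graphon_nash P \<FF> Tm \<nu> Ad U \<theta> W a \<longleftrightarrow>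
     a \<in> prof_space P \<FF> Tm \<nu> \<and>
     (\<forall>x\<in>{0..1}. is_arg_max (\<lambda>b. U b (graphon_aggregate P \<FF> Tm \<nu> W a x) (\<theta> x))
                           (\<lambda>b. b \<in> Ad x) (a x))"

definition network_aggregate ::
    "nat \<Rightarrow> (nat \<Rightarrow> nat \<Rightarrow> real) \<Rightarrow> (nat \<Rightarrow> 'w process) \<Rightarrow> nat \<Rightarrow> 'w process" where
  "network_aggregate N G a i = (\<lambda>\<omega> t. (1 / real N) * (\<Sum>j\<in>{1..N}. G i j * a j \<omega> t))"

definition network_nash ::
    "'w process set \<Rightarrow> 'w utility \<Rightarrow> nat \<Rightarrow> (nat \<Rightarrow> 'w process) \<Rightarrow> (nat \<Rightarrow> nat \<Rightarrow> real)
     \<Rightarrow> (nat \<Rightarrow> 'w process) \<Rightarrow> bool" where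
  "network_nash A\<^sub>0 U N \<theta> G a \<longleftrightarrow>
     (\<forall>i\<in>{1..N}. is_arg_max (\<lambda>b. U b (network_aggregate N G a i) (\<theta> i)) (\<lambda>b. b \<in> A\<^sub>0) (a i))"

text \<open>Uniqueness is equality in the Hilbert space, for every player.\<close>

definition unique_network_nash ::
    "'w measure \<Rightarrow> real \<Rightarrow> 'w process set \<Rightarrow> 'w utility \<Rightarrow> nat \<Rightarrow> (nat \<Rightarrow> 'w process)
     \<Rightarrow> (nat \<Rightarrow> nat \<Rightarrow> real) \<Rightarrow> bool" where
  "unique_network_nash P Tm A\<^sub>0 U N \<theta> G \<longleftrightarrow>
     (\<exists>a. network_nash A\<^sub>0 U N \<theta> G a \<and>
        (\<forall>b. network_nash A\<^sub>0 U N \<theta> G b \<longrightarrow> (\<forall>i\<in>{1..N}. proc_norm P Tm (b i - a i) = 0)))"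


section \<open>Intervention problems\<close>

text \<open>
  Equilibria are unique as elements of the Hilbert space, and utilities do not distinguish
  representatives; the choice of equilibrium below therefore only selects a representative.
\<close>

definition graphon_welfare ::
    "'w measure \<Rightarrow> (real \<Rightarrow> 'w measure) \<Rightarrow> real \<Rightarrow> real measure \<Rightarrow> (real \<Rightarrow> 'w process set)
     \<Rightarrow> 'w utility \<Rightarrow> 'w profile \<Rightarrow> (real \<Rightarrow> real \<Rightarrow> real) \<Rightarrow> 'w profile \<Rightarrow> real" where
  "graphon_welfare P \<FF> Tm \<nu> Ad U \<theta> W \<eta> =
     (let a = (SOME a. graphon_nash P \<FF> Tm \<nu> Ad U (\<theta> + \<eta>) W a)
      in LINT x|\<nu>. U (a x) (graphon_aggregate P \<FF> Tm \<nu> W a x) (\<theta> x + \<eta> x))"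

definition graphon_feasible ::
    "'w measure \<Rightarrow> (real \<Rightarrow> 'w measure) \<Rightarrow> real \<Rightarrow> real measure \<Rightarrow> real \<Rightarrow> 'w profile set" where
  "graphon_feasible P \<FF> Tm \<nu> C\<^sub>B =
     {\<eta> \<in> prof_space P \<FF> Tm \<nu>. (prof_norm P Tm \<nu> \<eta>)\<^sup>2 \<le> C\<^sub>B}"

definition network_welfare ::
    "'w process set \<Rightarrow> 'w utility \<Rightarrow> nat \<Rightarrow> (nat \<Rightarrow> 'w process) \<Rightarrow> (nat \<Rightarrow> nat \<Rightarrow> real)
     \<Rightarrow> (nat \<Rightarrow> 'w process) \<Rightarrow> real" where
  "network_welfare A\<^sub>0 U N \<theta> G \<eta> =
     (let a = (SOME a. network_nash A\<^sub>0 U N (\<theta> + \<eta>) G a)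
      in (1 / real N) * (\<Sum>i\<in>{1..N}. U (a i) (network_aggregate N G a i) (\<theta> i + \<eta> i)))"

definition network_feasible ::
    "'w measure \<Rightarrow> (real \<Rightarrow> 'w measure) \<Rightarrow> real \<Rightarrow> real \<Rightarrow> nat \<Rightarrow> (nat \<Rightarrow> 'w process) set" where
  "network_feasible P \<FF> Tm C\<^sub>B N =
     {\<eta> \<in> fin_prof_space P \<FF> Tm N. (1 / real N) * (fin_prof_norm P Tm N \<eta>)\<^sup>2 \<le> C\<^sub>B}"

definition network_opt ::
    "'w measure \<Rightarrow> (real \<Rightarrow> 'w measure) \<Rightarrow> real \<Rightarrow> real \<Rightarrow> 'w process set \<Rightarrow> 'w utility \<Rightarrow> nat
     \<Rightarrow> (nat \<Rightarrow> 'w process) \<Rightarrow> (nat \<Rightarrow> nat \<Rightarrow> real) \<Rightarrow> real" where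
  "network_opt P \<FF> Tm C\<^sub>B A\<^sub>0 U N \<theta> G =
     (SUP \<eta>\<in>network_feasible P \<FF> Tm C\<^sub>B N. network_welfare A\<^sub>0 U N \<theta> G \<eta>)"

text \<open>
  The constant by which the samples \<open>\<eta> (i / N)\<close> must be divided in order that their mean square
  norm becomes that of \<open>\<eta>\<close>.  It is \<open>0\<close> if all samples vanish or if \<open>\<eta>\<close> vanishes almost
  everywhere; as \<open>c / 0 = 0\<close>, the approximate intervention is then \<open>0\<close>.
\<close>

definition normalizing_const :: "'w measure \<Rightarrow> real \<Rightarrow> real measure \<Rightarrow> 'w profile \<Rightarrow> nat \<Rightarrow> real" where
  "normalizing_const P Tm \<nu> \<eta> N =
     sqrt ((1 / real N) * (fin_prof_norm P Tm N (\<lambda>i. \<eta> (real i / real N)))\<^sup>2) / prof_norm P Tm \<nu> \<eta>"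

definition approx_intervention ::
    "'w measure \<Rightarrow> real \<Rightarrow> real measure \<Rightarrow> 'w profile \<Rightarrow> nat \<Rightarrow> nat \<Rightarrow> 'w process" where
  "approx_intervention P Tm \<nu> \<eta> N i =
     (\<lambda>\<omega> t. \<eta> (real i / real N) \<omega> t / normalizing_const P Tm \<nu> \<eta> N)"

end

theory Submission
  imports Defs
begin

text \<open>
  A network game is the graphon game of its step kernel with step data, so everything reduces to
  comparing two graphon games.  Strong concavity makes best responses Lipschitz in the aggregate and
  in the heterogeneity, with constants \<open>l\<^sub>U / \<alpha>\<^sub>U\<close> and \<open>l\<^sub>\<theta> / \<alpha>\<^sub>U\<close>.  The \<open>L\<^sup>2\<close> operator norm of a
  graphon is its largest eigenvalue, and that of \<open>W - W\<^sub>G\<close> is at most twice the square root of the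
  cut norm; so for large \<open>N\<close> the equilibrium maps are contractions, and equilibria and welfare are
  stable with error of the order of the square root of the cut norm plus the distance of the
  heterogeneities.  Step interventions are feasible in the graphon problem, whence no network
  intervention beats \<open>\<theta>bar\<close> by more than this error.  Sampling \<open>\<theta>bar\<close> costs \<open>O(1 / \<surd>N)\<close> in \<open>L\<^sup>2\<close>,
  because only boundedly many cells meet the end of a piece of the partition.
\<close>


section \<open>Square-integrable functions\<close>

text \<open>Two obstacles shape the proof. Every single player has to be optimal, not almost every
  one, while aggregates and best responses are mere choices of representatives; so the estimates
  hold player by player, and measurability in the player is recovered from countably-valued
  approximations. Moreover \<open>\<nu>\<close> only extends Lebesgue measure: a profile need not be
  Lebesgue measurable in the player, whereas eigenvalues and cut norm speak of Lebesgue and Borel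
  sets. The bridge is that a Lebesgue measurable kernel maps every \<open>\<nu>\<close>-measurable
  function to a Lebesgue measurable one.

  The hypothesis on the largest eigenvalue concerns a greatest element, so it gives information only
  once a greatest eigenvalue is known to exist. Nonnegativity of the kernel enters here: it makes
  the operator norm itself, and not only its negative, an eigenvalue. The factor 2 before the square
  root of the cut norm is the root of 4: two sign decompositions reduce the bilinear form on bounded
  functions to four rectangles.\<close>

definition sqint :: "'a measure \<Rightarrow> ('a \<Rightarrow> real) set" where
  "sqint M = {f \<in> borel_measurable M. integrable M (\<lambda>x. (f x)\<^sup>2)}"

definition l2inner :: "'a measure \<Rightarrow> ('a \<Rightarrow> real) \<Rightarrow> ('a \<Rightarrow> real) \<Rightarrow> real" where
  "l2inner M f g = (LINT x|M. f x * g x)"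

definition l2norm :: "'a measure \<Rightarrow> ('a \<Rightarrow> real) \<Rightarrow> real" where
  "l2norm M f = sqrt (LINT x|M. (f x)\<^sup>2)"

lemma sqint_measurable: "f \<in> sqint M \<Longrightarrow> f \<in> borel_measurable M"
  by (simp add: sqint_def)

lemma sqint_integrable_sq: "f \<in> sqint M \<Longrightarrow> integrable M (\<lambda>x. (f x)\<^sup>2)"
  by (simp add: sqint_def)

lemma l2norm_nonneg [simp]: "0 \<le> l2norm M f"
  by (simp add: l2norm_def)

lemma l2norm_sq: "(l2norm M f)\<^sup>2 = (LINT x|M. (f x)\<^sup>2)"
  by (simp add: l2norm_def)

lemma l2inner_self: "l2inner M f f = (l2norm M f)\<^sup>2"
  unfolding l2norm_sq l2inner_def by (simp add: power2_eq_square)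

lemma sqint_mult_integrable:
  assumes "f \<in> sqint M" "g \<in> sqint M"
  shows "integrable M (\<lambda>x. f x * g x)"
proof (rule Bochner_Integration.integrable_bound)
  show "integrable M (\<lambda>x. (f x)\<^sup>2 + (g x)\<^sup>2)"
    using assms by (simp add: sqint_def)
  show "(\<lambda>x. f x * g x) \<in> borel_measurable M"
    using assms by (auto simp: sqint_def)
  have "\<bar>a * b\<bar> \<le> a\<^sup>2 + b\<^sup>2" for a b :: real
  proof -
    have "2 * (\<bar>a\<bar> * \<bar>b\<bar>) \<le> \<bar>a\<bar>\<^sup>2 + \<bar>b\<bar>\<^sup>2"
      using sum_squares_bound[of "\<bar>a\<bar>" "\<bar>b\<bar>"] by simp
    moreover have "0 \<le> \<bar>a\<bar> * \<bar>b\<bar>" by simp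
    ultimately show ?thesis unfolding abs_mult power2_abs by linarith
  qed
  then show "AE x in M. norm (f x * g x) \<le> norm ((f x)\<^sup>2 + (g x)\<^sup>2)"
    by (intro AE_I2) (auto simp: abs_of_nonneg)
qed

lemma sqint_lincomb:
  assumes "f \<in> sqint M" "g \<in> sqint M"
  shows "(\<lambda>x. a * f x + b * g x) \<in> sqint M"
    and l2norm_lincomb_sq: "(l2norm M (\<lambda>x. a * f x + b * g x))\<^sup>2
      = a\<^sup>2 * (l2norm M f)\<^sup>2 + 2 * a * b * l2inner M f g + b\<^sup>2 * (l2norm M g)\<^sup>2"
proof -
  have eq: "(a * f x + b * g x)\<^sup>2 = a\<^sup>2 * (f x)\<^sup>2 + 2 * a * b * (f x * g x) + b\<^sup>2 * (g x)\<^sup>2" for x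
    by (simp add: power2_eq_square algebra_simps)
  note [simp] = sqint_integrable_sq[OF assms(1)] sqint_integrable_sq[OF assms(2)]
    sqint_mult_integrable[OF assms]
  show "(\<lambda>x. a * f x + b * g x) \<in> sqint M"
    using assms unfolding sqint_def by (auto simp: eq)
  show "(l2norm M (\<lambda>x. a * f x + b * g x))\<^sup>2
      = a\<^sup>2 * (l2norm M f)\<^sup>2 + 2 * a * b * l2inner M f g + b\<^sup>2 * (l2norm M g)\<^sup>2"
    unfolding l2norm_sq l2inner_def eq by simp
qed

lemma sqint_add: "f \<in> sqint M \<Longrightarrow> g \<in> sqint M \<Longrightarrow> (\<lambda>x. f x + g x) \<in> sqint M"
  using sqint_lincomb[of f M g 1 1] by simp

lemma sqint_diff: "f \<in> sqint M \<Longrightarrow> g \<in> sqint M \<Longrightarrow> (\<lambda>x. f x - g x) \<in> sqint M"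
  using sqint_lincomb[of f M g 1 "-1"] by simp

lemma sqint_scale: "f \<in> sqint M \<Longrightarrow> (\<lambda>x. a * f x) \<in> sqint M"
  using sqint_lincomb[of f M f a 0] by simp

lemma sqint_zero [simp]: "(\<lambda>x. 0) \<in> sqint M"
  by (simp add: sqint_def)

lemma l2norm_zero [simp]: "l2norm M (\<lambda>x. 0) = 0"
  by (simp add: l2norm_def)

lemma l2norm_scale: "l2norm M (\<lambda>x. a * f x) = \<bar>a\<bar> * l2norm M f"
  by (simp add: l2norm_def power_mult_distrib real_sqrt_mult)

lemma l2norm_minus_commute: "l2norm M (\<lambda>x. f x - g x) = l2norm M (\<lambda>x. g x - f x)"
  by (simp add: l2norm_def power2_commute)

lemma l2_Cauchy_Schwarz:
  assumes "f \<in> sqint M" "g \<in> sqint M"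
  shows "\<bar>l2inner M f g\<bar> \<le> l2norm M f * l2norm M g"
proof -
  let ?a = "l2norm M f" and ?b = "l2norm M g" and ?i = "l2inner M f g"
  have "?i\<^sup>2 \<le> ?a\<^sup>2 * ?b\<^sup>2"
  proof (cases "?b = 0")
    case False
    have "0 \<le> (l2norm M (\<lambda>x. ?b\<^sup>2 * f x + (- ?i) * g x))\<^sup>2" by simp
    also have "\<dots> = ?b\<^sup>2 * (?a\<^sup>2 * ?b\<^sup>2 - ?i\<^sup>2)"
      unfolding l2norm_lincomb_sq[OF assms] by (simp add: power2_eq_square algebra_simps)
    finally show ?thesis
      using False by (simp add: zero_le_mult_iff)
  next
    \<comment> \<open>With \<open>?b\<close> zero the squared norm of \<open>f + t g\<close> is
      affine in \<open>t\<close> and stays nonnegative, so its slope vanishes; the \<open>t\<close>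
      inserted below would make it -1.\<close>
    case True
    have *: "0 \<le> ?a\<^sup>2 + 2 * t * ?i" for t
      using l2norm_lincomb_sq[OF assms, of 1 t] True
        zero_le_power2[of "l2norm M (\<lambda>x. 1 * f x + t * g x)"]
      by simp
    have "?i = 0"
    proof (rule ccontr)
      assume "?i \<noteq> 0"
      then show False
        using *[of "- (?a\<^sup>2 + 1) / (2 * ?i)"] by (simp add: field_simps)
    qed
    then show ?thesis by simp
  qed
  then have "\<bar>?i\<bar>\<^sup>2 \<le> (?a * ?b)\<^sup>2"
    by (simp add: power_mult_distrib)
  then show ?thesis
    by (rule power2_le_imp_le) simp
qed

lemma l2norm_triangle:
  assumes "f \<in> sqint M" "g \<in> sqint M"
  shows "l2norm M (\<lambda>x. f x + g x) \<le> l2norm M f + l2norm M g"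
proof (rule power2_le_imp_le)
  have "(l2norm M (\<lambda>x. f x + g x))\<^sup>2 = (l2norm M f)\<^sup>2 + 2 * l2inner M f g + (l2norm M g)\<^sup>2"
    using l2norm_lincomb_sq[OF assms, of 1 1] by simp
  also have "\<dots> \<le> (l2norm M f + l2norm M g)\<^sup>2"
    using l2_Cauchy_Schwarz[OF assms] by (simp add: power2_sum)
  finally show "(l2norm M (\<lambda>x. f x + g x))\<^sup>2 \<le> (l2norm M f + l2norm M g)\<^sup>2" .
qed simp

lemma l2norm_triangle_diff:
  assumes "f \<in> sqint M" "g \<in> sqint M" "h \<in> sqint M"
  shows "l2norm M (\<lambda>x. f x - h x) \<le> l2norm M (\<lambda>x. f x - g x) + l2norm M (\<lambda>x. g x - h x)"
  using l2norm_triangle[OF sqint_diff[OF assms(1,2)] sqint_diff[OF assms(2,3)]] by simp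

lemma l2norm_le_add_diff:
  assumes "f \<in> sqint M" "g \<in> sqint M"
  shows "l2norm M f \<le> l2norm M g + l2norm M (\<lambda>x. f x - g x)"
  using l2norm_triangle[OF assms(2) sqint_diff[OF assms(1,2)]] by simp

lemma l2norm_eq_0_iff:
  assumes "f \<in> sqint M"
  shows "l2norm M f = 0 \<longleftrightarrow> (AE x in M. f x = 0)"
  using integral_nonneg_eq_0_iff_AE[OF sqint_integrable_sq[OF assms]]
  by (simp add: l2norm_def)

lemma l2norm_mono:
  assumes "f \<in> sqint M" "g \<in> borel_measurable M" "AE x in M. \<bar>g x\<bar> \<le> \<bar>f x\<bar>"
  shows "g \<in> sqint M" and "l2norm M g \<le> l2norm M f"
proof -
  have le: "AE x in M. (g x)\<^sup>2 \<le> (f x)\<^sup>2"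
    using assms(3) by eventually_elim (simp add: abs_le_square_iff)
  have "integrable M (\<lambda>x. (g x)\<^sup>2)"
    by (rule Bochner_Integration.integrable_bound[OF sqint_integrable_sq[OF assms(1)]])
      (use assms le in auto)
  then show "g \<in> sqint M" using assms(2) by (simp add: sqint_def)
  then show "l2norm M g \<le> l2norm M f"
    unfolding l2norm_def
    by (intro real_sqrt_le_mono integral_mono_AE sqint_integrable_sq assms(1) le)
qed

lemma l2norm_cong_AE:
  assumes "f \<in> borel_measurable M" "g \<in> borel_measurable M" "AE x in M. f x = g x"
  shows "l2norm M f = l2norm M g"
  unfolding l2norm_def using assms by (intro arg_cong[where f = sqrt] integral_cong_AE) auto

lemma (in finite_measure) sqint_const: "(\<lambda>x. c) \<in> sqint M"
  by (simp add: sqint_def)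

lemma (in finite_measure) sqint_bounded:
  assumes "f \<in> borel_measurable M" "AE x in M. \<bar>f x\<bar> \<le> B"
  shows "f \<in> sqint M"
  by (rule l2norm_mono(1)[OF sqint_const[of B] assms(1)]) (use assms(2) in auto)

lemma (in finite_measure) sqint_integrable:
  assumes "f \<in> sqint M"
  shows "integrable M f"
  using sqint_mult_integrable[OF assms sqint_const[of 1]] by simp

lemma (in finite_measure) integral_abs_le_l2norm:
  assumes "f \<in> sqint M"
  shows "(LINT x|M. \<bar>f x\<bar>) \<le> l2norm M f * sqrt (measure M (space M))"
proof -
  have "(\<lambda>x. \<bar>f x\<bar>) \<in> sqint M"
    using assms by (auto simp: sqint_def)
  from l2_Cauchy_Schwarz[OF this sqint_const[of 1]]
  show ?thesis by (simp add: l2inner_def l2norm_def)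
qed

section \<open>Limits and completeness in L2\<close>

lemma sqint_nn_integral:
  "f \<in> sqint M \<longleftrightarrow> f \<in> borel_measurable M \<and> (\<integral>\<^sup>+x. ennreal ((f x)\<^sup>2) \<partial>M) < \<infinity>"
  by (auto simp: sqint_def integrable_iff_bounded)

lemma nn_integral_eq_l2norm_sq:
  "f \<in> sqint M \<Longrightarrow> (\<integral>\<^sup>+x. ennreal ((f x)\<^sup>2) \<partial>M) = ennreal ((l2norm M f)\<^sup>2)"
  by (simp add: l2norm_sq nn_integral_eq_integral sqint_integrable_sq)

lemma l2norm_le_nn_integral:
  assumes "f \<in> borel_measurable M" "(\<integral>\<^sup>+x. ennreal ((f x)\<^sup>2) \<partial>M) \<le> ennreal (B\<^sup>2)" "0 \<le> B"
  shows "f \<in> sqint M" and "l2norm M f \<le> B"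
proof -
  show *: "f \<in> sqint M"
    using assms(1) le_less_trans[OF assms(2) ennreal_less_top] unfolding sqint_nn_integral by simp
  show "l2norm M f \<le> B"
  proof (rule power2_le_imp_le)
    show "(l2norm M f)\<^sup>2 \<le> B\<^sup>2"
      using assms(2) nn_integral_eq_l2norm_sq[OF *] by simp
  qed (rule assms(3))
qed

text \<open>Fatou's lemma for the squares of \<open>f n - f m\<close> as \<open>m\<close> grows. The
  bound is required only for late \<open>m\<close>, so it can be the tail bound of a Cauchy
  sequence.\<close>

lemma l2norm_AE_limit:
  assumes f: "\<And>n::nat. f n \<in> sqint M" and g: "g \<in> borel_measurable M"
    and lim: "AE x in M. (\<lambda>n. f n x) \<longlonglongrightarrow> g x"
    and B: "eventually (\<lambda>m. l2norm M (\<lambda>x. f n x - f m x) \<le> B) sequentially"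
  shows "g \<in> sqint M" and "l2norm M (\<lambda>x. f n x - g x) \<le> B"
proof -
  have B0: "0 \<le> B"
    using eventually_happens'[OF sequentially_bot B] order_trans[OF l2norm_nonneg] by blast
  have meas[measurable]: "\<And>n. f n \<in> borel_measurable M"
    using f by (simp add: sqint_measurable)
  note g[measurable]
  have "(\<integral>\<^sup>+x. ennreal ((f n x - g x)\<^sup>2) \<partial>M)
      = (\<integral>\<^sup>+x. liminf (\<lambda>m. ennreal ((f n x - f m x)\<^sup>2)) \<partial>M)"
    using lim
  proof (intro nn_integral_cong_AE, eventually_elim)
    case (elim x)
    then have "(\<lambda>m. ennreal ((f n x - f m x)\<^sup>2)) \<longlonglongrightarrow> ennreal ((f n x - g x)\<^sup>2)"
      by (intro tendsto_ennrealI tendsto_intros)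
    then show ?case
      by (rule lim_imp_Liminf[OF sequentially_bot, symmetric])
  qed
  also have "\<dots> \<le> liminf (\<lambda>m. \<integral>\<^sup>+x. ennreal ((f n x - f m x)\<^sup>2) \<partial>M)"
    by (intro nn_integral_liminf) simp
  also have "\<dots> \<le> ennreal (B\<^sup>2)"
  proof (rule Liminf_le)
    show "\<forall>\<^sub>F m in sequentially. (\<integral>\<^sup>+x. ennreal ((f n x - f m x)\<^sup>2) \<partial>M) \<le> ennreal (B\<^sup>2)"
      using B
    proof eventually_elim
      case (elim m)
      show ?case
        unfolding nn_integral_eq_l2norm_sq[OF sqint_diff[OF f f]]
        by (intro ennreal_leI power_mono elim) simp
    qed
  qed simp
  finally have *: "(\<integral>\<^sup>+x. ennreal ((f n x - g x)\<^sup>2) \<partial>M) \<le> ennreal (B\<^sup>2)" .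
  have "(\<lambda>x. f n x - g x) \<in> sqint M"
    by (rule l2norm_le_nn_integral(1)[OF _ * B0]) simp
  from sqint_diff[OF f[of n] this] show "g \<in> sqint M" by simp
  show "l2norm M (\<lambda>x. f n x - g x) \<le> B"
    by (rule l2norm_le_nn_integral(2)[OF _ * B0]) simp
qed

lemma l2norm_diff_le_sum:
  assumes f: "\<And>n::nat. f n \<in> sqint M"
    and step: "\<And>n. l2norm M (\<lambda>x. f (Suc n) x - f n x) \<le> c n"
  shows "l2norm M (\<lambda>x. f n x - f (n + k) x) \<le> (\<Sum>i<k. c (i + n))"
proof (induction k)
  case (Suc k)
  have "l2norm M (\<lambda>x. f n x - f (n + Suc k) x)
      \<le> l2norm M (\<lambda>x. f n x - f (n + k) x) + l2norm M (\<lambda>x. f (n + k) x - f (Suc (n + k)) x)"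
    using l2norm_triangle_diff[OF f f f] by simp
  also have "l2norm M (\<lambda>x. f (n + k) x - f (Suc (n + k)) x) \<le> c (k + n)"
    using step[of "n + k"] by (subst l2norm_minus_commute) (simp add: add.commute)
  finally show ?case using Suc by simp
qed simp

text \<open>On a finite measure space, steps summable in L2 are summable in L1, so the increments
  are absolutely summable almost everywhere. Writing the limit with \<open>lim\<close> defines it at
  every point, so its measurability needs no exceptional null set.\<close>

lemma (in finite_measure) l2_fast_limit:
  assumes f: "\<And>n::nat. f n \<in> sqint M"
    and step: "\<And>n. l2norm M (\<lambda>x. f (Suc n) x - f n x) \<le> c n" and c: "summable c"
  shows "AE x in M. (\<lambda>n. f n x) \<longlonglongrightarrow> lim (\<lambda>n. f n x)"
    and "(\<lambda>x. lim (\<lambda>n. f n x)) \<in> sqint M"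
    and "l2norm M (\<lambda>x. f n x - lim (\<lambda>n. f n x)) \<le> (\<Sum>i. c (i + n))"
proof -
  have meas[measurable]: "\<And>n. f n \<in> borel_measurable M"
    using f by (simp add: sqint_measurable)
  have c0: "0 \<le> c n" for n
    by (rule order_trans[OF l2norm_nonneg step])
  define d where "d n x = f (Suc n) x - f n x" for n x
  have d: "d n \<in> sqint M" for n
    unfolding d_def by (rule sqint_diff[OF f f])
  have [measurable]: "d n \<in> borel_measurable M" for n
    using d by (rule sqint_measurable)
  have dstep: "l2norm M (d n) \<le> c n" for n
    using step[of n] by (simp add: d_def[abs_def])
  let ?m = "sqrt (measure M (space M))"
  have "(\<integral>\<^sup>+x. (\<Sum>n. ennreal \<bar>d n x\<bar>) \<partial>M) = (\<Sum>n. \<integral>\<^sup>+x. ennreal \<bar>d n x\<bar> \<partial>M)"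
    by (intro nn_integral_suminf) simp
  also have "\<dots> \<le> (\<Sum>n. ennreal (c n * ?m))"
  proof (intro suminf_le summableI)
    fix n
    have "(\<integral>\<^sup>+x. ennreal \<bar>d n x\<bar> \<partial>M) = ennreal (LINT x|M. \<bar>d n x\<bar>)"
      using sqint_integrable[OF d[of n]] by (intro nn_integral_eq_integral) auto
    also have "\<dots> \<le> ennreal (c n * ?m)"
      using order_trans[OF integral_abs_le_l2norm[OF d[of n]] mult_right_mono[OF dstep[of n]]]
      by (intro ennreal_leI) simp
    finally show "(\<integral>\<^sup>+x. ennreal \<bar>d n x\<bar> \<partial>M) \<le> ennreal (c n * ?m)" .
  qed
  also have "\<dots> = ennreal (\<Sum>n. c n * ?m)"
    using c c0 by (intro suminf_ennreal2 summable_mult2) auto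
  also have "\<dots> < \<infinity>" by simp
  finally have "(\<integral>\<^sup>+x. (\<Sum>n. ennreal \<bar>d n x\<bar>) \<partial>M) \<noteq> \<infinity>" by simp
  then have "AE x in M. (\<Sum>n. ennreal \<bar>d n x\<bar>) \<noteq> \<infinity>"
    by (intro nn_integral_noteq_infinite) simp_all
  then show lim: "AE x in M. (\<lambda>n. f n x) \<longlonglongrightarrow> lim (\<lambda>n. f n x)"
  proof eventually_elim
    case (elim x)
    then have "summable (\<lambda>n. \<bar>d n x\<bar>)"
      by (intro summable_suminf_not_top) (auto simp: top_ennreal_def infinity_ennreal_def)
    then have "summable (\<lambda>n. d n x)"
      by (rule summable_rabs_cancel)
    then have "convergent (\<lambda>n. \<Sum>i<n. d i x)"
      by (simp add: summable_iff_convergent)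
    then have "convergent (\<lambda>n. f n x - f 0 x)"
      unfolding d_def by (simp only: sum_lessThan_telescope[of "\<lambda>n. f n x"])
    then have "convergent (\<lambda>n. (f n x - f 0 x) + f 0 x)"
      by (intro convergent_add convergent_const)
    then show ?case
      by (simp add: convergent_LIMSEQ_iff)
  qed
  have B: "\<forall>\<^sub>F m in sequentially. l2norm M (\<lambda>x. f n x - f m x) \<le> (\<Sum>i. c (i + n))" for n
    using eventually_ge_at_top[of n]
  proof eventually_elim
    case (elim m)
    have "l2norm M (\<lambda>x. f n x - f m x) \<le> (\<Sum>i<m - n. c (i + n))"
      using l2norm_diff_le_sum[of f M c n "m - n"] f step elim by simp
    also have "\<dots> \<le> (\<Sum>i. c (i + n))"
      using c c0 by (intro sum_le_suminf) (auto simp: summable_iff_shift)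
    finally show ?case .
  qed
  have [measurable]: "(\<lambda>x. lim (\<lambda>n. f n x)) \<in> borel_measurable M"
    by measurable
  show "(\<lambda>x. lim (\<lambda>n. f n x)) \<in> sqint M"
    by (rule l2norm_AE_limit(1)[OF f _ lim B]) simp
  show "l2norm M (\<lambda>x. f n x - lim (\<lambda>n. f n x)) \<le> (\<Sum>i. c (i + n))"
    by (rule l2norm_AE_limit(2)[OF f _ lim B]) simp
qed

lemma tendsto_tail_suminf:
  fixes c :: "nat \<Rightarrow> real"
  assumes "summable c"
  shows "(\<lambda>n. \<Sum>i. c (i + n)) \<longlonglongrightarrow> 0"
  using suminf_exist_split2[OF assms] by simp

text \<open>Riesz-Fischer: a subsequence with steps below \<open>(1/2)^k\<close> converges by
  \<open>l2_fast_limit\<close>, and the Cauchy property carries the convergence over to the whole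
  sequence.\<close>

lemma (in finite_measure) l2_complete:
  assumes f: "\<And>n::nat. f n \<in> sqint M"
    and cauchy: "\<And>e. 0 < e \<Longrightarrow> \<exists>n. \<forall>m\<ge>n. l2norm M (\<lambda>x. f m x - f n x) < e"
  shows "\<exists>g\<in>sqint M. (\<lambda>n. l2norm M (\<lambda>x. f n x - g x)) \<longlonglongrightarrow> 0"
proof -
  \<comment> \<open>The hypothesis compares with one fixed index. Halving \<open>e\<close> moves
    this index beyond any \<open>k\<close>, as the choice of a strictly increasing subsequence
    demands.\<close>
  have cauchy': "\<exists>n\<ge>k. \<forall>m\<ge>n. l2norm M (\<lambda>x. f m x - f n x) < e" if "0 < e" for e k
  proof -
    obtain n where n: "\<forall>m\<ge>n. l2norm M (\<lambda>x. f m x - f n x) < e / 2"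
      using cauchy[of "e / 2"] \<open>0 < e\<close> by (metis half_gt_zero)
    have "l2norm M (\<lambda>x. f m x - f (max n k) x) < e" if "m \<ge> max n k" for m
    proof -
      have "l2norm M (\<lambda>x. f m x - f (max n k) x)
          \<le> l2norm M (\<lambda>x. f m x - f n x) + l2norm M (\<lambda>x. f n x - f (max n k) x)"
        by (rule l2norm_triangle_diff[OF f f f])
      also have "l2norm M (\<lambda>x. f n x - f (max n k) x) = l2norm M (\<lambda>x. f (max n k) x - f n x)"
        by (rule l2norm_minus_commute)
      finally show ?thesis
        using n[rule_format, of m] n[rule_format, of "max n k"] that by simp
    qed
    then show ?thesis by (intro exI[of _ "max n k"]) auto
  qed
  define P where "P k n \<longleftrightarrow> (\<forall>m\<ge>n. l2norm M (\<lambda>x. f m x - f n x) < (1/2)^k)" for k n :: nat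
  have "\<exists>r. \<forall>k. P k (r k) \<and> r k < r (Suc k)"
  proof (rule dependent_nat_choice)
    show "\<exists>x. P 0 x"
      using cauchy'[of 1 0] unfolding P_def by simp
    show "\<exists>y. P (Suc n) y \<and> x < y" for x n
      using cauchy'[of "(1/2)^Suc n" "Suc x"] unfolding P_def Suc_le_eq by auto
  qed
  then obtain r where r: "\<And>k. P k (r k)" "\<And>k. r k < r (Suc k)" by blast
  define g where "g x = lim (\<lambda>k. f (r k) x)" for x
  have step: "l2norm M (\<lambda>x. f (r (Suc k)) x - f (r k) x) \<le> (1/2)^k" for k
    using r(1)[of k] r(2)[of k] by (auto simp: P_def intro: less_imp_le)
  have s: "summable (\<lambda>k. (1/2)^k :: real)" by (simp add: summable_geometric)
  note lim = l2_fast_limit[where f = "\<lambda>k. f (r k)" and c = "\<lambda>k. (1/2)^k", OF f step s]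
  have g: "g \<in> sqint M" unfolding g_def by (rule lim(2))
  have "(\<lambda>n. l2norm M (\<lambda>x. f n x - g x)) \<longlonglongrightarrow> 0"
  proof (rule LIMSEQ_I)
    fix e :: real assume "0 < e"
    have "(\<lambda>k. (1/2)^k + (\<Sum>i. (1/2)^(i + k)) :: real) \<longlonglongrightarrow> 0 + 0"
      by (intro tendsto_add tendsto_tail_suminf s LIMSEQ_power_zero) simp
    then have "\<forall>\<^sub>F k in sequentially. (1/2)^k + (\<Sum>i. (1/2)^(i + k)) < e"
      using \<open>0 < e\<close> by (intro order_tendstoD(2)) auto
    then obtain k where k: "(1/2)^k + (\<Sum>i. (1/2)^(i + k)) < e"
      using eventually_happens'[OF sequentially_bot] by blast
    show "\<exists>no. \<forall>n\<ge>no. norm (l2norm M (\<lambda>x. f n x - g x) - 0) < e"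
    proof (intro exI[of _ "r k"] allI impI)
      fix n assume "r k \<le> n"
      have "l2norm M (\<lambda>x. f n x - g x)
          \<le> l2norm M (\<lambda>x. f n x - f (r k) x) + l2norm M (\<lambda>x. f (r k) x - g x)"
        by (rule l2norm_triangle_diff[OF f f g])
      also have "\<dots> \<le> (1/2)^k + (\<Sum>i. (1/2)^(i + k))"
        using r(1)[of k] \<open>r k \<le> n\<close> lim(3)[of k] unfolding P_def g_def
        by (intro add_mono) (auto intro: less_imp_le)
      finally show "norm (l2norm M (\<lambda>x. f n x - g x) - 0) < e" using k by simp
    qed
  qed
  then show ?thesis using g by blast
qed


section \<open>Integral operators with bounded symmetric kernels\<close>

text \<open>The bound is on the absolute value and no sign is imposed, so that the difference of two
  graphons is again such a kernel.\<close>

locale sym_kernel = prob_space M for M :: "'a measure" +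
  fixes K :: "'a \<Rightarrow> 'a \<Rightarrow> real"
  assumes K_measurable [measurable]: "(\<lambda>(x, y). K x y) \<in> borel_measurable (M \<Otimes>\<^sub>M M)"
    and K_sym: "\<And>x y. x \<in> space M \<Longrightarrow> y \<in> space M \<Longrightarrow> K x y = K y x"
    and K_abs_le: "\<And>x y. x \<in> space M \<Longrightarrow> y \<in> space M \<Longrightarrow> \<bar>K x y\<bar> \<le> 1"

context sym_kernel
begin

abbreviation op :: "('a \<Rightarrow> real) \<Rightarrow> 'a \<Rightarrow> real" where
  "op f \<equiv> (\<lambda>x. LINT y|M. K x y * f y)"

lemma section_measurable [measurable]: "x \<in> space M \<Longrightarrow> K x \<in> borel_measurable M"
  using measurable_Pair2[OF K_measurable] by simp

lemma section_sqint: "x \<in> space M \<Longrightarrow> K x \<in> sqint M"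
  using K_abs_le by (intro sqint_bounded[where B = 1]) auto

lemma section_l2norm: "x \<in> space M \<Longrightarrow> l2norm M (K x) \<le> 1"
  using l2norm_mono(2)[OF sqint_const[of 1] section_measurable[of x]] K_abs_le
  by (auto simp: l2norm_def prob_space)

lemma op_integrable: "f \<in> sqint M \<Longrightarrow> x \<in> space M \<Longrightarrow> integrable M (\<lambda>y. K x y * f y)"
  by (intro sqint_mult_integrable section_sqint)

lemma op_measurable [measurable]:
  assumes [measurable]: "f \<in> borel_measurable M"
  shows "op f \<in> borel_measurable M"
  by measurable

lemma op_abs_le_integral:
  assumes "f \<in> sqint M" "x \<in> space M"
  shows "\<bar>op f x\<bar> \<le> (LINT y|M. \<bar>f y\<bar>)"
proof -
  have "\<bar>op f x\<bar> \<le> (LINT y|M. \<bar>K x y * f y\<bar>)"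
    by (rule integral_abs_bound)
  also have "\<dots> \<le> (LINT y|M. \<bar>f y\<bar>)"
  proof (rule integral_mono)
    show "integrable M (\<lambda>y. \<bar>K x y * f y\<bar>)"
      using op_integrable[OF assms] by (rule integrable_abs)
    show "integrable M (\<lambda>y. \<bar>f y\<bar>)"
      using sqint_integrable[OF assms(1)] by (rule integrable_abs)
    show "\<bar>K x y * f y\<bar> \<le> \<bar>f y\<bar>" if "y \<in> space M" for y
      using K_abs_le[OF assms(2) that] by (simp add: abs_mult mult_left_le_one_le)
  qed
  finally show ?thesis .
qed

lemma op_abs_le: "f \<in> sqint M \<Longrightarrow> x \<in> space M \<Longrightarrow> \<bar>op f x\<bar> \<le> l2norm M f"
  using op_abs_le_integral[of f x] integral_abs_le_l2norm[of f] by (simp add: prob_space)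

lemma op_sqint:
  assumes "f \<in> sqint M"
  shows "op f \<in> sqint M"
proof (rule sqint_bounded)
  show "AE x in M. \<bar>op f x\<bar> \<le> l2norm M f" using op_abs_le[OF assms] by auto
  show "op f \<in> borel_measurable M"
    using sqint_measurable[OF assms] by (rule op_measurable)
qed

lemma op_l2norm_le:
  assumes "f \<in> sqint M"
  shows "l2norm M (op f) \<le> l2norm M f"
proof -
  have "l2norm M (op f) \<le> l2norm M (\<lambda>x. l2norm M f)"
    using op_abs_le[OF assms] op_sqint[OF assms]
    by (intro l2norm_mono(2) sqint_const) (auto simp: sqint_measurable)
  then show ?thesis by (simp add: l2norm_def[of M "\<lambda>x. l2norm M f"] prob_space)
qed

lemma op_lincomb:
  assumes "f \<in> sqint M" "g \<in> sqint M" "x \<in> space M"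
  shows "op (\<lambda>y. a * f y + b * g y) x = a * op f x + b * op g x"
  using op_integrable[OF assms(1,3)] op_integrable[OF assms(2,3)]
  by (simp add: distrib_left mult.left_commute)

lemma op_diff:
  assumes "f \<in> sqint M" "g \<in> sqint M" "x \<in> space M"
  shows "op (\<lambda>y. f y - g y) x = op f x - op g x"
  using op_lincomb[OF assms, of 1 "-1"] by simp

lemma op_diff_l2norm:
  assumes "f \<in> sqint M" "g \<in> sqint M"
  shows "l2norm M (\<lambda>x. op f x - op g x) = l2norm M (op (\<lambda>y. f y - g y))"
  unfolding l2norm_def using op_diff[OF assms]
  by (intro arg_cong[where f = sqrt] Bochner_Integration.integral_cong) auto

lemma op_cong_AE:
  assumes "f \<in> sqint M" "g \<in> sqint M" "AE y in M. f y = g y" "x \<in> space M"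
  shows "op f x = op g x"
  using assms(3) assms(1,2)[THEN sqint_measurable] assms(4)
  by (intro integral_cong_AE) auto

lemma op_selfadjoint:
  assumes "f \<in> sqint M" "g \<in> sqint M"
  shows "l2inner M (op f) g = l2inner M f (op g)"
proof -
  interpret MM: pair_prob_space M M ..
  have [measurable]: "f \<in> borel_measurable M" "g \<in> borel_measurable M"
    using assms by (auto intro: sqint_measurable)
  have fi: "integrable M f" "integrable M g"
    using assms by (auto intro: sqint_integrable)
  have "integrable (M \<Otimes>\<^sub>M M) (\<lambda>(x, y). g x * f y)"
  proof (rule MM.Fubini_integrable)
    show "integrable M (\<lambda>x. LINT y|M. norm (case (x, y) of (x, y) \<Rightarrow> g x * f y))"
      using fi by (simp add: abs_mult)
  qed (use fi in \<open>auto\<close>)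
  then have int: "integrable (M \<Otimes>\<^sub>M M) (\<lambda>(x, y). g x * (K x y * f y))"
  proof (rule Bochner_Integration.integrable_bound)
    show "AE p in M \<Otimes>\<^sub>M M. norm (case p of (x, y) \<Rightarrow> g x * (K x y * f y))
        \<le> norm (case p of (x, y) \<Rightarrow> g x * f y)"
      using K_abs_le
      by (intro AE_I2) (auto simp: space_pair_measure abs_mult intro!: mult_left_mono mult_left_le_one_le)
  qed simp
  have "l2inner M (op f) g = (LINT x|M. LINT y|M. g x * (K x y * f y))"
    unfolding l2inner_def by (simp add: mult.commute)
  also have "\<dots> = (LINT y|M. LINT x|M. g x * (K x y * f y))"
    using MM.Fubini_integral[OF int] by simp
  also have "\<dots> = (LINT y|M. f y * op g y)"
  proof (rule Bochner_Integration.integral_cong)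
    fix y assume y: "y \<in> space M"
    have "(LINT x|M. g x * (K x y * f y)) = (LINT x|M. f y * (K y x * g x))"
      using K_sym y by (intro Bochner_Integration.integral_cong) auto
    then show "(LINT x|M. g x * (K x y * f y)) = f y * op g y" by simp
  qed simp
  finally show ?thesis by (simp add: l2inner_def)
qed

section \<open>Powers of the operator\<close>

lemma funpow_op_sqint: "f \<in> sqint M \<Longrightarrow> (op ^^ n) f \<in> sqint M"
  by (induction n) (auto intro: op_sqint)

lemma funpow_op_inner:
  assumes "f \<in> sqint M" "g \<in> sqint M"
  shows "l2inner M ((op ^^ m) f) g = l2inner M f ((op ^^ m) g)"
  using assms
proof (induction m arbitrary: g)
  case (Suc m)
  have "l2inner M ((op ^^ Suc m) f) g = l2inner M ((op ^^ m) f) (op g)"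
    using op_selfadjoint[OF funpow_op_sqint[OF Suc.prems(1)] Suc.prems(2)] by simp
  also have "\<dots> = l2inner M f ((op ^^ m) (op g))"
    by (rule Suc.IH[OF Suc.prems(1) op_sqint[OF Suc.prems(2)]])
  finally show ?case by (simp only: funpow_Suc_right o_apply)
qed simp

text \<open>For a self-adjoint operator \<open>T\<close> the squared norm of \<open>T^k f\<close> is
  the inner product of \<open>f\<close> with \<open>T^(2k) f\<close>, hence at most the product of
  their norms. Iterated doubling bounds one application of \<open>T\<close> by a high power, for
  which cruder estimates suffice.\<close>

lemma op_power_bound:
  assumes f: "f \<in> sqint M"
  shows "l2norm M (op f) ^ 2 ^ m \<le> l2norm M f ^ (2 ^ m - 1) * l2norm M ((op ^^ 2 ^ m) f)"
proof (induction m)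
  case (Suc m)
  let ?k = "2 ^ m :: nat" and ?a = "l2norm M f"
  have "(l2norm M ((op ^^ ?k) f))\<^sup>2 = l2inner M f ((op ^^ (?k + ?k)) f)"
    unfolding l2inner_self[symmetric]
    using funpow_op_inner[OF f funpow_op_sqint[OF f], of ?k ?k] by (simp add: funpow_add)
  also have "\<dots> \<le> ?a * l2norm M ((op ^^ (?k + ?k)) f)"
    using l2_Cauchy_Schwarz[OF f funpow_op_sqint[OF f, of "?k + ?k"]] by simp
  finally have *: "(l2norm M ((op ^^ ?k) f))\<^sup>2 \<le> ?a * l2norm M ((op ^^ (?k + ?k)) f)" .
  have "l2norm M (op f) ^ 2 ^ Suc m = (l2norm M (op f) ^ ?k)\<^sup>2"
    by (simp add: power_mult[symmetric] mult.commute)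
  also have "\<dots> \<le> (?a ^ (?k - 1) * l2norm M ((op ^^ ?k) f))\<^sup>2"
    by (intro power_mono Suc.IH) simp
  also have "\<dots> \<le> ?a ^ (2 * (?k - 1)) * (?a * l2norm M ((op ^^ (?k + ?k)) f))"
    unfolding power_mult_distrib
    by (intro mult_mono *) (auto simp: power_mult[symmetric] mult.commute)
  also have "\<dots> = ?a ^ Suc (2 * (?k - 1)) * l2norm M ((op ^^ (2 * ?k)) f)"
    by (simp add: mult_2)
  also have "Suc (2 * (?k - 1)) = 2 ^ Suc m - 1"
  proof -
    have "Suc (2 * (k - 1)) = 2 * k - 1" if "1 \<le> k" for k :: nat using that by linarith
    from this[of ?k] show ?thesis by simp
  qed
  finally show ?case by simp
qed simp

end

text \<open>The constant \<open>c\<close> does not depend on the exponent, so the unbounded powers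
  of a ratio \<open>a / b\<close> above 1 would exceed it.\<close>

lemma le_if_power_le_const_mult_power:
  fixes a b c :: real
  assumes "0 \<le> a" "0 \<le> b" and le: "\<And>m::nat. a ^ 2 ^ m \<le> c * b ^ 2 ^ m"
  shows "a \<le> b"
proof (rule ccontr)
  assume "\<not> a \<le> b"
  show False
  proof (cases "b = 0")
    case True
    with le[of 0] \<open>\<not> a \<le> b\<close> show False by simp
  next
    case False
    with assms have b: "0 < b" by simp
    with \<open>\<not> a \<le> b\<close> have r: "1 < a / b" by simp
    obtain n where n: "c < (a / b) ^ n"
      using real_arch_pow[OF r] by blast
    also have "(a / b) ^ n \<le> (a / b) ^ 2 ^ n"
      using r by (intro power_increasing) (auto intro: less_imp_le)
    also have "\<dots> \<le> c"
      using le[of n] b by (simp add: power_divide pos_divide_le_eq)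
    finally show False by simp
  qed
qed

context sym_kernel
begin

text \<open>
  On bounded functions the square of the operator contracts the supremum norm by the factor
  \<open>d\<close>; by self-adjointness the \<open>L\<^sup>2\<close> norm of the operator is at most its spectral radius
  on bounded functions.
\<close>

lemma l2_bound_of_L1_bound:
  assumes d: "\<And>f B. f \<in> borel_measurable M \<Longrightarrow> (\<And>x. x \<in> space M \<Longrightarrow> \<bar>f x\<bar> \<le> B)
      \<Longrightarrow> (LINT x|M. \<bar>op f x\<bar>) \<le> d * B"
    and d0: "0 \<le> d" and f: "f \<in> sqint M"
  shows "l2norm M (op f) \<le> sqrt d * l2norm M f"
proof -
  have bdd: "l2norm M (op f) \<le> sqrt d * l2norm M f"
    if f: "f \<in> borel_measurable M" and B: "\<And>x. x \<in> space M \<Longrightarrow> \<bar>f x\<bar> \<le> B" for f B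
  proof (cases "l2norm M f = 0")
    case True
    have "f \<in> sqint M" using f B by (intro sqint_bounded[where B = B]) auto
    then have "l2norm M (op f) \<le> l2norm M f" by (rule op_l2norm_le)
    with True d0 show ?thesis by simp
  next
    case False
    then have pos: "0 < l2norm M f" using l2norm_nonneg[of M f] by linarith
    have fs: "f \<in> sqint M" using f B by (intro sqint_bounded[where B = B]) auto
    \<comment> \<open>Each pair of applications gains a factor \<open>d\<close>: the first brings
      the L1 norm below \<open>d\<close> times the supremum, the second turns an L1 bound into a
      supremum bound since the kernel is at most 1 in absolute value.\<close>
    have pw: "x \<in> space M \<Longrightarrow> \<bar>(op ^^ (2 * k)) f x\<bar> \<le> d ^ k * B" for k x
    proof (induction k arbitrary: x)
      case (Suc k)
      let ?g = "(op ^^ (2 * k)) f"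
      have g: "?g \<in> sqint M" using fs by (rule funpow_op_sqint)
      have "\<bar>(op ^^ (2 * Suc k)) f x\<bar> = \<bar>op (op ?g) x\<bar>" by simp
      also have "\<dots> \<le> (LINT x|M. \<bar>op ?g x\<bar>)"
        using g Suc.prems by (intro op_abs_le_integral op_sqint)
      also have "\<dots> \<le> d * (d ^ k * B)"
        using g Suc.IH by (intro d) (auto intro: sqint_measurable)
      finally show ?case by (simp add: mult.assoc)
    qed (use B in auto)
    have "((l2norm M (op f))\<^sup>2) ^ 2 ^ m \<le> (B / l2norm M f) * (d * (l2norm M f)\<^sup>2) ^ 2 ^ m" for m :: nat
    proof -
      let ?k = "2 ^ m :: nat" and ?a = "l2norm M f"
      have "B \<ge> 0" using B not_empty by fastforce
      have "l2norm M ((op ^^ (2 * ?k)) f) \<le> l2norm M (\<lambda>x. d ^ ?k * B)"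
        using pw[of _ ?k] funpow_op_sqint[OF fs, of "2 * ?k"]
        by (intro l2norm_mono(2) sqint_const AE_I2) (auto intro: order_trans abs_ge_self simp: sqint_measurable)
      also have "\<dots> = d ^ ?k * B"
        using d0 \<open>B \<ge> 0\<close> by (simp add: l2norm_def prob_space)
      finally have le: "l2norm M ((op ^^ (2 * ?k)) f) \<le> d ^ ?k * B" .
      have "((l2norm M (op f))\<^sup>2) ^ ?k = l2norm M (op f) ^ 2 ^ Suc m"
        by (simp add: power_mult)
      also have "\<dots> \<le> ?a ^ (2 ^ Suc m - 1) * l2norm M ((op ^^ 2 ^ Suc m) f)"
        by (rule op_power_bound[OF fs])
      also have "\<dots> \<le> ?a ^ (2 * ?k - 1) * (d ^ ?k * B)"
        using le by (intro mult_mono) auto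
      also have "?a ^ (2 * ?k - 1) = ?a ^ (2 * ?k) / ?a"
        using pos by (simp add: power_diff)
      also have "?a ^ (2 * ?k) / ?a * (d ^ ?k * B) = (B / ?a) * (d * ?a\<^sup>2) ^ ?k"
        by (simp add: power_mult_distrib power_mult)
      finally show ?thesis .
    qed
    from le_if_power_le_const_mult_power[OF _ _ this]
    have "(l2norm M (op f))\<^sup>2 \<le> d * (l2norm M f)\<^sup>2"
      using d0 by simp
    then have "sqrt ((l2norm M (op f))\<^sup>2) \<le> sqrt (d * (l2norm M f)\<^sup>2)"
      by (rule real_sqrt_le_mono)
    then show ?thesis by (simp add: real_sqrt_mult)
  qed
  \<comment> \<open>Truncation at height \<open>n\<close> passes from bounded functions to all of
    L2; the error is controlled because the operator does not increase the norm.\<close>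
  define t where "t n x = max (- real n) (min (real n) (f x))" for n :: nat and x
  have [measurable]: "f \<in> borel_measurable M" using f by (rule sqint_measurable)
  have tm[measurable]: "t n \<in> borel_measurable M" for n unfolding t_def by measurable
  have tb: "\<bar>t n x\<bar> \<le> real n" for n x unfolding t_def by auto
  have tf: "\<bar>t n x\<bar> \<le> \<bar>f x\<bar>" "\<bar>f x - t n x\<bar> \<le> \<bar>f x\<bar>" for n x unfolding t_def by auto
  have ts: "t n \<in> sqint M" and tn: "l2norm M (t n) \<le> l2norm M f" for n
    using l2norm_mono[OF f tm[of n]] tf by auto
  have "(\<lambda>n. LINT x|M. (f x - t n x)\<^sup>2) \<longlonglongrightarrow> (LINT x|M. 0)"
  proof (rule integral_dominated_convergence)
    show "AE x in M. (\<lambda>n. (f x - t n x)\<^sup>2) \<longlonglongrightarrow> 0"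
    proof (rule AE_I2)
      fix x
      obtain N :: nat where N: "\<bar>f x\<bar> \<le> real N" using real_arch_simple by blast
      have "\<forall>\<^sub>F n in sequentially. (f x - t n x)\<^sup>2 = 0"
        using eventually_ge_at_top[of N]
      proof eventually_elim
        case (elim n)
        then have "\<bar>f x\<bar> \<le> real n" using N by linarith
        then show ?case by (auto simp: t_def)
      qed
      then show "(\<lambda>n. (f x - t n x)\<^sup>2) \<longlonglongrightarrow> 0" by (rule tendsto_eventually)
    qed
    show "AE x in M. norm ((f x - t n x)\<^sup>2) \<le> (f x)\<^sup>2" for n
      using tf(2) by (auto simp: abs_le_square_iff)
  qed (use f in \<open>auto simp: sqint_def\<close>)
  then have "(\<lambda>n. l2norm M (\<lambda>x. f x - t n x)) \<longlonglongrightarrow> 0"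
    unfolding l2norm_def using tendsto_real_sqrt by fastforce
  then have lim: "(\<lambda>n. sqrt d * l2norm M f + l2norm M (\<lambda>x. f x - t n x)) \<longlonglongrightarrow> sqrt d * l2norm M f + 0"
    by (intro tendsto_intros)
  have "l2norm M (op f) \<le> sqrt d * l2norm M f + l2norm M (\<lambda>x. f x - t n x)" for n
  proof -
    have "l2norm M (op f) \<le> l2norm M (op (t n)) + l2norm M (\<lambda>x. op f x - op (t n) x)"
      by (intro l2norm_le_add_diff op_sqint f ts)
    also have "l2norm M (\<lambda>x. op f x - op (t n) x) \<le> l2norm M (\<lambda>x. f x - t n x)"
      unfolding op_diff_l2norm[OF f ts] by (intro op_l2norm_le sqint_diff f ts)
    also have "l2norm M (op (t n)) \<le> sqrt d * l2norm M (t n)"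
      using tb by (intro bdd) auto
    also have "\<dots> \<le> sqrt d * l2norm M f"
      using d0 tn by (intro mult_left_mono) auto
    finally show ?thesis by simp
  qed
  then show ?thesis
    using LIMSEQ_le_const[OF lim] by auto
qed

section \<open>The operator norm\<close>

definition opnorm :: real where
  "opnorm = Sup {l2norm M (op f) | f. f \<in> sqint M \<and> l2norm M f \<le> 1}"

lemma opnorm_bdd: "bdd_above {l2norm M (op f) | f. f \<in> sqint M \<and> l2norm M f \<le> 1}"
  by (rule bdd_aboveI[of _ 1]) (use op_l2norm_le in force)

lemma opnorm_nonneg: "0 \<le> opnorm"
  unfolding opnorm_def
  by (rule cSup_upper2[OF _ l2norm_nonneg opnorm_bdd]) (auto intro!: exI[of _ "\<lambda>x. 0"])

lemma op_le_opnorm: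
  assumes f: "f \<in> sqint M"
  shows "l2norm M (op f) \<le> opnorm * l2norm M f"
proof (cases "l2norm M f = 0")
  case True
  then show ?thesis using op_l2norm_le[OF f] by simp
next
  case False
  let ?a = "l2norm M f"
  have pos: "0 < ?a" using False l2norm_nonneg[of M f] by linarith
  let ?g = "\<lambda>x. (1 / ?a) * f x"
  have "op ?g = (\<lambda>x. (1 / ?a) * op f x)"
    by (simp add: fun_eq_iff mult.left_commute)
  then have "l2norm M (op ?g) = l2norm M (op f) / ?a"
    using l2norm_scale[of M "1 / ?a" "op f"] pos by simp
  moreover have "l2norm M ?g \<le> 1"
    using l2norm_scale[of M "1 / ?a" f] pos by simp
  moreover have "?g \<in> sqint M" using f by (rule sqint_scale)
  ultimately have "l2norm M (op f) / ?a \<le> opnorm"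
    unfolding opnorm_def by (intro cSup_upper opnorm_bdd) (auto intro!: exI[of _ ?g])
  then show ?thesis using pos by (simp add: pos_divide_le_eq)
qed

lemma opnorm_least:
  assumes "\<And>f. f \<in> sqint M \<Longrightarrow> l2norm M (op f) \<le> s * l2norm M f" "0 \<le> s"
  shows "opnorm \<le> s"
  unfolding opnorm_def
proof (rule cSup_least)
  show "{l2norm M (op f) |f. f \<in> sqint M \<and> l2norm M f \<le> 1} \<noteq> {}"
    by (auto intro!: exI[of _ "\<lambda>x. 0"])
  fix y assume "y \<in> {l2norm M (op f) |f. f \<in> sqint M \<and> l2norm M f \<le> 1}"
  then obtain f where f: "f \<in> sqint M" "l2norm M f \<le> 1" "y = l2norm M (op f)" by blast
  have "y \<le> s * l2norm M f" using assms(1) f by simp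
  also have "\<dots> \<le> s * 1" using f assms(2) by (intro mult_left_mono) auto
  finally show "y \<le> s" by simp
qed

end


section \<open>Eigenvalues: the operator norm of a nonnegative kernel is attained\<close>

context sym_kernel
begin

lemma funpow_op_opnorm:
  assumes "w \<in> sqint M"
  shows "l2norm M ((op ^^ Suc n) w) \<le> opnorm * l2norm M ((op ^^ n) w)"
  using op_le_opnorm[OF funpow_op_sqint[OF assms]] by simp

text \<open>
  After division by \<open>opnorm\<^sup>2\<close> the even powers of the operator form a decreasing sequence of
  positive contractions, so they converge strongly; the limit is fixed by the scaled square.
\<close>

lemma even_powers_limit:
  assumes w: "w \<in> sqint M" and w0: "\<And>x. x \<in> space M \<Longrightarrow> 0 \<le> w x"
    and K0: "\<And>x y. x \<in> space M \<Longrightarrow> y \<in> space M \<Longrightarrow> 0 \<le> K x y"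
    and mu: "0 < opnorm"
    and nz: "\<not> (\<lambda>n. (l2norm M ((op ^^ n) w) / opnorm ^ n)\<^sup>2) \<longlonglongrightarrow> 0"
  shows "\<exists>g\<in>sqint M. 0 < l2norm M g \<and> (AE x in M. 0 \<le> g x) \<and>
    l2norm M (\<lambda>x. op (op g) x - opnorm\<^sup>2 * g x) = 0"
proof -
  define a where "a n = (l2norm M ((op ^^ n) w) / opnorm ^ n)\<^sup>2" for n
  have a_dec: "a (Suc n) \<le> a n" for n
  proof -
    have "l2norm M ((op ^^ Suc n) w) / opnorm ^ Suc n \<le> l2norm M ((op ^^ n) w) / opnorm ^ n"
      using funpow_op_opnorm[OF w, of n] mu by (simp add: field_simps)
    then show ?thesis unfolding a_def using mu by (intro power_mono) auto
  qed
  then have dec: "decseq a" by (rule decseq_SucI)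
  have "bdd_below (range a)" by (rule bdd_belowI[of _ 0]) (auto simp: a_def)
  then obtain l where l: "a \<longlonglongrightarrow> l" and la: "\<And>n. l \<le> a n"
    using decseq_convergent[OF dec, of 0] unfolding a_def by (metis (no_types, lifting) zero_le_power2)
  have l0: "0 < l"
  proof -
    have "0 \<le> l" using l by (rule LIMSEQ_le_const) (auto simp: a_def)
    moreover have "l \<noteq> 0" using nz l unfolding a_def by auto
    ultimately show ?thesis by simp
  qed
  define x where "x n t = (1 / opnorm ^ (2 * n)) * (op ^^ (2 * n)) w t" for n t
  have xs: "x n \<in> sqint M" for n
    unfolding x_def by (intro sqint_scale funpow_op_sqint w)
  \<comment> \<open>By self-adjointness the inner product depends only on \<open>m + n\<close>. The
    squared distance of \<open>x m\<close> and \<open>x n\<close> is therefore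
    \<open>a (2 * m) - 2 * a (m + n) + a (2 * n)\<close>, which is small because \<open>a\<close>
    decreases to a limit.\<close>
  have xinner: "l2inner M (x m) (x n) = a (m + n)" for m n
  proof -
    have "l2inner M ((op ^^ (2 * m)) w) ((op ^^ (2 * n)) w) = l2inner M w ((op ^^ (2 * m + 2 * n)) w)"
      using funpow_op_inner[OF w funpow_op_sqint[OF w], of "2 * m" "2 * n"] by (simp add: funpow_add)
    also have "2 * m + 2 * n = (m + n) + (m + n)" by simp
    also have "l2inner M w ((op ^^ ((m + n) + (m + n))) w) = l2inner M ((op ^^ (m + n)) w) ((op ^^ (m + n)) w)"
      using funpow_op_inner[OF w funpow_op_sqint[OF w], of "m + n" "m + n"]
      by (simp only: funpow_add o_apply)
    finally have "l2inner M ((op ^^ (2 * m)) w) ((op ^^ (2 * n)) w) = (l2norm M ((op ^^ (m + n)) w))\<^sup>2"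
      unfolding l2inner_self .
    moreover have "l2inner M (x m) (x n)
        = l2inner M ((op ^^ (2 * m)) w) ((op ^^ (2 * n)) w) / (opnorm ^ (2 * m) * opnorm ^ (2 * n))"
      unfolding l2inner_def x_def by (simp add: mult.assoc mult.left_commute)
    ultimately show ?thesis
      unfolding a_def by (simp add: power_divide power_add power_mult[symmetric] power_mult_distrib mult.commute)
  qed
  have xnorm: "(l2norm M (x n))\<^sup>2 = a (2 * n)" for n
    using xinner[of n n] by (simp add: l2inner_self mult_2)
  have xdiff: "(l2norm M (\<lambda>t. x m t - x n t))\<^sup>2 \<le> 2 * (a n - l)" if "n \<le> m" for m n
  proof -
    have "(l2norm M (\<lambda>t. x m t - x n t))\<^sup>2 = a (2 * m) - 2 * a (m + n) + a (2 * n)"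
      using l2norm_lincomb_sq[OF xs xs, of 1 m "-1" n] by (simp add: xnorm xinner)
    moreover have "a (2 * m) \<le> a n" "a (2 * n) \<le> a n"
      using dec that by (auto intro: decseqD)
    moreover have "a (2 * m) - 2 * a (m + n) + a (2 * n) \<le> 2 * (a n - l)"
    proof -
      have "p - 2 * q + r \<le> 2 * (s - l)" if "p \<le> s" "r \<le> s" "l \<le> q" for p q r s :: real
        using that by argo
      then show ?thesis using calculation(2,3) la[of "m + n"] by blast
    qed
    ultimately show ?thesis by simp
  qed
  have "\<exists>g\<in>sqint M. (\<lambda>n. l2norm M (\<lambda>t. x n t - g t)) \<longlonglongrightarrow> 0"
  proof (rule l2_complete[OF xs])
    fix e :: real assume e: "0 < e"
    have "(\<lambda>n. 2 * (a n - l)) \<longlonglongrightarrow> 2 * (l - l)"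
      by (intro tendsto_intros l)
    then have "\<forall>\<^sub>F n in sequentially. 2 * (a n - l) < e\<^sup>2"
      using e by (intro order_tendstoD(2)) auto
    then obtain n where n: "2 * (a n - l) < e\<^sup>2"
      using eventually_happens'[OF sequentially_bot] by blast
    have "l2norm M (\<lambda>t. x m t - x n t) < e" if "n \<le> m" for m
      using power2_less_imp_less[OF order.strict_trans1[OF xdiff[OF that] n]] e by simp
    then show "\<exists>n. \<forall>m\<ge>n. l2norm M (\<lambda>t. x m t - x n t) < e" by blast
  qed
  then obtain g where g: "g \<in> sqint M" and lim: "(\<lambda>n. l2norm M (\<lambda>t. x n t - g t)) \<longlonglongrightarrow> 0" by blast
  have opx: "op (op (x n)) t = opnorm\<^sup>2 * x (Suc n) t" for n t
    using mu unfolding x_def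
    by (simp add: mult.left_commute[of "K _ _"] power2_eq_square)
  have "sqrt l \<le> l2norm M g"
  proof -
    have "sqrt l \<le> l2norm M g + l2norm M (\<lambda>t. x n t - g t)" for n
    proof -
      have "sqrt l \<le> l2norm M (x n)"
        using la[of "2 * n"] xnorm[of n] by (intro real_le_lsqrt) auto
      also have "\<dots> \<le> l2norm M g + l2norm M (\<lambda>t. x n t - g t)"
        by (rule l2norm_le_add_diff[OF xs g])
      finally show ?thesis .
    qed
    moreover have "(\<lambda>n. l2norm M g + l2norm M (\<lambda>t. x n t - g t)) \<longlonglongrightarrow> l2norm M g + 0"
      by (intro tendsto_intros lim)
    ultimately show ?thesis using LIMSEQ_le_const by fastforce
  qed
  then have "0 < l2norm M g" using l0 real_sqrt_gt_zero[of l] by linarith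
  \<comment> \<open>Where \<open>g\<close> is negative it is at least as far from the nonnegative
    \<open>x n\<close> as from 0, so the norm of its negative part is at most that of
    \<open>x n - g\<close>.\<close>
  moreover have "AE t in M. 0 \<le> g t"
  proof -
    have x0: "0 \<le> x n t" if "t \<in> space M" for n t
    proof -
      have "t \<in> space M \<Longrightarrow> 0 \<le> (op ^^ k) w t" for k t
        by (induction k arbitrary: t) (auto intro!: w0 Bochner_Integration.integral_nonneg mult_nonneg_nonneg K0)
      with that mu show ?thesis unfolding x_def by simp
    qed
    have [measurable]: "g \<in> borel_measurable M" using g by (rule sqint_measurable)
    have le: "l2norm M (\<lambda>t. min 0 (g t)) \<le> l2norm M (\<lambda>t. x n t - g t)" for n
    proof (rule l2norm_mono(2)[OF sqint_diff[OF xs g]])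
      show "AE t in M. \<bar>min 0 (g t)\<bar> \<le> \<bar>x n t - g t\<bar>"
      proof (rule AE_I2)
        fix t assume "t \<in> space M"
        then show "\<bar>min 0 (g t)\<bar> \<le> \<bar>x n t - g t\<bar>" using x0[of t n] by (auto simp: min_def)
      qed
    qed measurable
    have "l2norm M (\<lambda>t. min 0 (g t)) \<le> 0"
      using LIMSEQ_le_const[OF lim] le by blast
    moreover have "(\<lambda>t. min 0 (g t)) \<in> sqint M"
      by (rule l2norm_mono(1)[OF g]) (auto simp: min_def)
    ultimately have "AE t in M. min 0 (g t) = 0"
      using l2norm_eq_0_iff by (metis antisym l2norm_nonneg)
    then show ?thesis by eventually_elim (auto simp: min_def split: if_splits)
  qed
  moreover have "l2norm M (\<lambda>t. op (op g) t - opnorm\<^sup>2 * g t) = 0"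
  proof -
    have "l2norm M (\<lambda>t. op (op g) t - opnorm\<^sup>2 * g t)
        \<le> l2norm M (\<lambda>t. x n t - g t) + opnorm\<^sup>2 * l2norm M (\<lambda>t. x (Suc n) t - g t)" for n
    proof -
      have "l2norm M (\<lambda>t. op (op g) t - opnorm\<^sup>2 * g t)
        \<le> l2norm M (\<lambda>t. op (op g) t - op (op (x n)) t) + l2norm M (\<lambda>t. op (op (x n)) t - opnorm\<^sup>2 * g t)"
        by (intro l2norm_triangle_diff op_sqint sqint_scale g xs)
      also have "l2norm M (\<lambda>t. op (op (x n)) t - opnorm\<^sup>2 * g t)
          = opnorm\<^sup>2 * l2norm M (\<lambda>t. x (Suc n) t - g t)"
        unfolding opx right_diff_distrib[symmetric] l2norm_scale by simp
      also have "l2norm M (\<lambda>t. op (op g) t - op (op (x n)) t) \<le> l2norm M (\<lambda>t. op g t - op (x n) t)"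
        unfolding op_diff_l2norm[OF op_sqint[OF g] op_sqint[OF xs]]
        by (intro op_l2norm_le sqint_diff op_sqint g xs)
      also have "\<dots> \<le> l2norm M (\<lambda>t. g t - x n t)"
        unfolding op_diff_l2norm[OF g xs] by (intro op_l2norm_le sqint_diff g xs)
      also have "\<dots> = l2norm M (\<lambda>t. x n t - g t)" by (rule l2norm_minus_commute)
      finally show ?thesis by simp
    qed
    moreover have "(\<lambda>n. l2norm M (\<lambda>t. x n t - g t) + opnorm\<^sup>2 * l2norm M (\<lambda>t. x (Suc n) t - g t))
        \<longlonglongrightarrow> 0 + opnorm\<^sup>2 * 0"
      by (intro tendsto_intros lim LIMSEQ_Suc)
    ultimately have "l2norm M (\<lambda>t. op (op g) t - opnorm\<^sup>2 * g t) \<le> 0"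
      using LIMSEQ_le_const by fastforce
    then show ?thesis using l2norm_nonneg antisym by blast
  qed
  ultimately show ?thesis using g by blast
qed

text \<open>As a function of \<open>x\<close> and \<open>y\<close> this is the kernel of the power
  \<open>n + 1\<close> of the operator: the operator acts \<open>n\<close> times on the column of
  \<open>K\<close> at \<open>y\<close>. Joint measurability prepares the Fubini arguments
  below.\<close>

lemma iterated_kernel_measurable [measurable]:
  "(\<lambda>(x, y). (op ^^ n) (\<lambda>z. K z y) x) \<in> borel_measurable (M \<Otimes>\<^sub>M M)"
proof (induction n)
  case (Suc n)
  note Suc[measurable]
  have [measurable]: "(\<lambda>p. (op ^^ n) (\<lambda>z. K z (snd (fst p))) (snd p)) \<in> borel_measurable ((M \<Otimes>\<^sub>M M) \<Otimes>\<^sub>M M)"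
    using measurable_compose[OF _ Suc, of "\<lambda>p. (snd p, snd (fst p))" "(M \<Otimes>\<^sub>M M) \<Otimes>\<^sub>M M"] by simp
  have [measurable]: "(\<lambda>p. K (fst (fst p)) (snd p)) \<in> borel_measurable ((M \<Otimes>\<^sub>M M) \<Otimes>\<^sub>M M)"
    using measurable_compose[OF _ K_measurable, of "\<lambda>p. (fst (fst p), snd p)" "(M \<Otimes>\<^sub>M M) \<Otimes>\<^sub>M M"] by simp
  show ?case
    unfolding funpow.simps o_apply case_prod_beta by measurable
qed (simp)

lemma column_sqint:
  assumes "y \<in> space M"
  shows "(\<lambda>z. K z y) \<in> sqint M"
  using measurable_Pair1[OF K_measurable assms] K_abs_le[OF _ assms]
  by (intro sqint_bounded[where B = 1]) auto

lemma iterated_kernel_abs_le: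
  assumes "y \<in> space M" "x \<in> space M"
  shows "\<bar>(op ^^ n) (\<lambda>z. K z y) x\<bar> \<le> 1"
  using assms(2)
proof (induction n arbitrary: x)
  case (Suc n)
  have "\<bar>op ((op ^^ n) (\<lambda>z. K z y)) x\<bar> \<le> (LINT t|M. \<bar>(op ^^ n) (\<lambda>z. K z y) t\<bar>)"
    by (intro op_abs_le_integral funpow_op_sqint column_sqint assms Suc.prems)
  also have "\<dots> \<le> (LINT t|M. 1)"
    using Suc.IH sqint_integrable[OF funpow_op_sqint[OF column_sqint[OF assms(1)]], of n]
    by (intro integral_mono) auto
  finally show ?case by (simp add: prob_space)
qed (use assms K_abs_le in auto)

lemma funpow_op_eq_iterated_kernel:
  assumes f: "f \<in> sqint M" and x: "x \<in> space M"
  shows "(op ^^ Suc n) f x = (LINT y|M. (op ^^ n) (\<lambda>z. K z y) x * f y)"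
  using x
proof (induction n arbitrary: x)
  case (Suc n)
  interpret MM: pair_prob_space M M ..
  note x[measurable] = Suc.prems
  have fm[measurable]: "f \<in> borel_measurable M" using f by (rule sqint_measurable)
  have fi: "integrable M f" using f by (rule sqint_integrable)
  let ?k = "\<lambda>z y. (op ^^ n) (\<lambda>z. K z y) z"
  have int: "integrable (M \<Otimes>\<^sub>M M) (\<lambda>(z, y). K x z * (?k z y * f y))"
  proof (rule Bochner_Integration.integrable_bound)
    have "integrable (M \<Otimes>\<^sub>M M) (\<lambda>(z, y). f y)"
      by (rule MM.Fubini_integrable) (use fi in auto)
    then show "integrable (M \<Otimes>\<^sub>M M) (\<lambda>p. f (snd p))" unfolding case_prod_beta .
    have [measurable]: "(\<lambda>p. K x (fst p)) \<in> borel_measurable (M \<Otimes>\<^sub>M M)"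
      by measurable
    show "(\<lambda>(z, y). K x z * (?k z y * f y)) \<in> borel_measurable (M \<Otimes>\<^sub>M M)"
      using iterated_kernel_measurable[of n] unfolding case_prod_beta by measurable
    show "AE p in M \<Otimes>\<^sub>M M. norm (case p of (z, y) \<Rightarrow> K x z * (?k z y * f y)) \<le> norm (f (snd p))"
    proof (rule AE_I2, clarsimp simp: space_pair_measure abs_mult)
      fix z y assume "z \<in> space M" "y \<in> space M"
      then have "\<bar>K x z\<bar> * \<bar>?k z y\<bar> \<le> 1 * 1"
        using x by (intro mult_mono K_abs_le iterated_kernel_abs_le) auto
      then show "\<bar>K x z\<bar> * (\<bar>?k z y\<bar> * \<bar>f y\<bar>) \<le> \<bar>f y\<bar>"
        unfolding mult.assoc[symmetric] by (simp add: mult_left_le_one_le)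
    qed
  qed
  have "(op ^^ Suc (Suc n)) f x = (LINT z|M. K x z * (op ^^ Suc n) f z)"
    by simp
  also have "\<dots> = (LINT z|M. LINT y|M. K x z * (?k z y * f y))"
    using Suc.IH by (intro Bochner_Integration.integral_cong) auto
  also have "\<dots> = (LINT y|M. LINT z|M. K x z * (?k z y * f y))"
    using MM.Fubini_integral[OF int] by simp
  also have "\<dots> = (LINT y|M. op (\<lambda>z. ?k z y) x * f y)"
    by (simp add: mult.assoc[symmetric])
  finally show ?case by simp
qed simp

text \<open>The norm of an integral operator is at most the Hilbert-Schmidt norm of its kernel.
  Cauchy-Schwarz uses the rows of the iterated kernel; Fubini regroups the double integral by
  columns, which are powers applied to single functions.\<close>

lemma funpow_op_hilbert_schmidt:
  assumes f: "f \<in> sqint M"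
  shows "(l2norm M ((op ^^ Suc n) f))\<^sup>2
    \<le> (LINT y|M. (l2norm M ((op ^^ n) (\<lambda>z. K z y)))\<^sup>2) * (l2norm M f)\<^sup>2"
proof -
  interpret MM: pair_prob_space M M ..
  let ?k = "\<lambda>x y. (op ^^ n) (\<lambda>z. K z y) x"
  have km[measurable]: "(\<lambda>(x, y). ?k x y) \<in> borel_measurable (M \<Otimes>\<^sub>M M)"
    by (rule iterated_kernel_measurable)
  have int: "integrable (M \<Otimes>\<^sub>M M) (\<lambda>(x, y). (?k x y)\<^sup>2)"
  proof (rule MM.integrable_const_bound[where B = 1])
    show "(\<lambda>(x, y). (?k x y)\<^sup>2) \<in> borel_measurable (M \<Otimes>\<^sub>M M)"
      using km unfolding case_prod_beta by measurable
  qed (use iterated_kernel_abs_le in \<open>auto simp: space_pair_measure abs_square_le_1\<close>)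
  have rows: "?k x \<in> sqint M" if "x \<in> space M" for x
    using measurable_Pair2[OF km that] iterated_kernel_abs_le[OF _ that]
    by (intro sqint_bounded[where B = 1]) auto
  have "(l2norm M ((op ^^ Suc n) f))\<^sup>2 = (LINT x|M. ((op ^^ Suc n) f x)\<^sup>2)"
    by (rule l2norm_sq)
  also have "\<dots> \<le> (LINT x|M. (LINT y|M. (?k x y)\<^sup>2) * (l2norm M f)\<^sup>2)"
  proof (rule integral_mono)
    show "integrable M (\<lambda>x. ((op ^^ Suc n) f x)\<^sup>2)"
      by (intro sqint_integrable_sq funpow_op_sqint f)
    show "integrable M (\<lambda>x. (LINT y|M. (?k x y)\<^sup>2) * (l2norm M f)\<^sup>2)"
      using MM.integrable_fst[OF int] by simp
    fix x assume x: "x \<in> space M"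
    have "\<bar>l2inner M (?k x) f\<bar>\<^sup>2 \<le> (l2norm M (?k x) * l2norm M f)\<^sup>2"
      by (intro power_mono l2_Cauchy_Schwarz rows x f) simp
    then show "((op ^^ Suc n) f x)\<^sup>2 \<le> (LINT y|M. (?k x y)\<^sup>2) * (l2norm M f)\<^sup>2"
      unfolding funpow_op_eq_iterated_kernel[OF f x] l2inner_def
      by (simp add: power_mult_distrib l2norm_sq[of M "?k x"])
  qed
  also have "\<dots> = (LINT y|M. (l2norm M (\<lambda>x. ?k x y))\<^sup>2) * (l2norm M f)\<^sup>2"
    using MM.Fubini_integral[OF int] by (simp add: l2norm_sq)
  finally show ?thesis by simp
qed

text \<open>
  The operator norm is an eigenvalue: otherwise all scaled powers applied to columns of the kernel
  would tend to \<open>0\<close>, and so would the Hilbert-Schmidt norms of the scaled powers, which are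
  bounded below.
\<close>

theorem opnorm_eigenvalue:
  assumes K0: "\<And>x y. x \<in> space M \<Longrightarrow> y \<in> space M \<Longrightarrow> 0 \<le> K x y"
  shows "\<exists>h\<in>sqint M. 0 < l2norm M h \<and> (AE x in M. op h x = opnorm * h x)"
proof (cases "opnorm = 0")
  \<comment> \<open>If the norm is zero, the operator annihilates everything and the constant 1 is
    an eigenfunction.\<close>
  case True
  have one: "(\<lambda>x. 1) \<in> sqint M" by (rule sqint_const)
  have "l2norm M (op (\<lambda>x. 1)) = 0"
    using op_le_opnorm[OF one] True by (simp add: order_antisym)
  then have "AE x in M. op (\<lambda>x. 1) x = 0"
    using l2norm_eq_0_iff[OF op_sqint[OF one]] by simp
  moreover have "l2norm M (\<lambda>x. 1) = 1" by (simp add: l2norm_def prob_space)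
  ultimately show ?thesis using one True by (intro bexI[of _ "\<lambda>x. 1"]) auto
next
  case False
  then have mu: "0 < opnorm" using opnorm_nonneg by simp
  define a where "a n y = (l2norm M ((op ^^ n) (\<lambda>z. K z y)) / opnorm ^ n)\<^sup>2" for n y
  have "\<exists>y\<in>space M. \<not> (\<lambda>n. a n y) \<longlonglongrightarrow> 0"
  proof (rule ccontr)
    assume "\<not> ?thesis"
    then have lim: "\<And>y. y \<in> space M \<Longrightarrow> (\<lambda>n. a n y) \<longlonglongrightarrow> 0" by blast
    have am[measurable]: "a n \<in> borel_measurable M" for n
    proof -
      have [measurable]: "(\<lambda>(y, x). (op ^^ n) (\<lambda>z. K z y) x) \<in> borel_measurable (M \<Otimes>\<^sub>M M)"
        using measurable_pair_swap[OF iterated_kernel_measurable[of n]] by simp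
      show ?thesis unfolding a_def[abs_def] l2norm_def by measurable
    qed
    have a0: "\<bar>a n y\<bar> = a n y" for n y by (simp add: a_def)
    have a_le: "a n y \<le> 1" if y: "y \<in> space M" for n y
    proof -
      have "l2norm M ((op ^^ n) (\<lambda>z. K z y)) / opnorm ^ n \<le> 1"
      proof (induction n)
        case 0
        have "l2norm M (\<lambda>z. K z y) \<le> l2norm M (\<lambda>z. 1)"
          using K_abs_le[OF _ y] sqint_measurable[OF column_sqint[OF y]]
          by (intro l2norm_mono(2) sqint_const) auto
        then show ?case by (simp add: l2norm_def[of M "\<lambda>z. 1"] prob_space)
      next
        case (Suc n)
        then have "opnorm * l2norm M ((op ^^ n) (\<lambda>z. K z y)) \<le> opnorm * opnorm ^ n"
          using mu by (intro mult_left_mono) (auto simp: pos_divide_le_eq)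
        then have "l2norm M ((op ^^ Suc n) (\<lambda>z. K z y)) \<le> opnorm ^ Suc n"
          unfolding power_Suc by (rule order_trans[OF funpow_op_opnorm[OF column_sqint[OF y], of n]])
        then show ?case
          using mu by (simp only: pos_divide_le_eq zero_less_power mult_1)
      qed
      then show ?thesis unfolding a_def using mu by (intro power_le_one) auto
    qed
    have "(\<lambda>n. LINT y|M. a n y) \<longlonglongrightarrow> (LINT y|M. 0)"
      by (rule integral_dominated_convergence[where w = "\<lambda>y. 1"])
        (use lim a_le am in \<open>auto simp: a0\<close>)
    \<comment> \<open>The squared Hilbert-Schmidt norm of the power \<open>n + 1\<close> is
      \<open>opnorm ^ (2 * n)\<close> times this integral, so a value below
      \<open>opnorm\<^sup>2\<close> makes the norm of that power strictly smaller than
      \<open>opnorm ^ (n + 1)\<close>.\<close>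
    then have "\<forall>\<^sub>F n in sequentially. (LINT y|M. a n y) < opnorm\<^sup>2"
      using mu by (intro order_tendstoD(2)) auto
    then obtain N where N: "\<And>n. n \<ge> N \<Longrightarrow> (LINT y|M. a n y) < opnorm\<^sup>2"
      unfolding eventually_sequentially by blast
    \<comment> \<open>\<open>Suc n\<close> has to be a power of two for
      \<open>op_power_bound\<close>.\<close>
    define n where "n = 2 ^ Suc N - (1::nat)"
    have Sn: "Suc n = 2 ^ Suc N" unfolding n_def by simp
    have "N \<le> n" using less_exp[of "Suc N"] unfolding n_def by linarith
    define J where "J = (LINT y|M. a n y) / opnorm\<^sup>2"
    have "0 \<le> (LINT y|M. a n y)"
      by (intro Bochner_Integration.integral_nonneg) (simp add: a_def)
    then have J: "0 \<le> J" "J < 1"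
      using N[OF \<open>N \<le> n\<close>] mu unfolding J_def by simp_all
    \<comment> \<open>The gain \<open>J\<close> appears in a squared estimate for the power
      \<open>2 ^ Suc N\<close>. A root of twice that order turns it into a gain \<open>r < 1\<close>
      for the operator itself, which contradicts the choice of \<open>opnorm\<close>.\<close>
    define r where "r = root (2 * 2 ^ Suc N) J"
    have r: "0 \<le> r" "r < 1" "r ^ (2 * 2 ^ Suc N) = J"
      using J unfolding r_def by auto
    have "opnorm \<le> opnorm * r"
    proof (rule opnorm_least)
      fix f assume f: "f \<in> sqint M"
      have hs: "(l2norm M ((op ^^ Suc n) f))\<^sup>2 \<le> (opnorm ^ Suc n * l2norm M f)\<^sup>2 * J"
      proof -
        have "(l2norm M ((op ^^ n) (\<lambda>z. K z y)))\<^sup>2 = (opnorm ^ n)\<^sup>2 * a n y" for y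
          unfolding a_def using mu by (simp add: power_divide)
        then have "(l2norm M ((op ^^ Suc n) f))\<^sup>2 \<le> (opnorm ^ n)\<^sup>2 * (LINT y|M. a n y) * (l2norm M f)\<^sup>2"
          using funpow_op_hilbert_schmidt[OF f, of n] by simp
        also have "\<dots> = (opnorm ^ Suc n * l2norm M f)\<^sup>2 * J"
          using mu unfolding J_def by (simp add: power_mult_distrib)
        finally show ?thesis .
      qed
      let ?k = "2 ^ Suc N :: nat" and ?u = "l2norm M f"
      have "(l2norm M (op f) ^ ?k)\<^sup>2 \<le> (?u ^ (?k - 1) * l2norm M ((op ^^ ?k) f))\<^sup>2"
        by (intro power_mono op_power_bound f) simp
      also have "\<dots> \<le> (?u ^ (?k - 1))\<^sup>2 * ((opnorm ^ ?k * ?u)\<^sup>2 * J)"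
        unfolding power_mult_distrib[of "?u ^ (?k - 1)"]
        using hs unfolding Sn by (intro mult_left_mono) auto
      also have "\<dots> = ((?u ^ (?k - 1) * ?u) * opnorm ^ ?k)\<^sup>2 * J"
        by (simp add: power_mult_distrib)
      also have "?u ^ (?k - 1) * ?u = ?u ^ ?k"
        by (rule power_minus_mult) simp
      also have "(?u ^ ?k * opnorm ^ ?k)\<^sup>2 * J = (opnorm * r * ?u) ^ (2 * ?k)"
        unfolding r(3)[symmetric] by (simp add: power_mult_distrib power_mult[symmetric] mult.commute)
      finally have "l2norm M (op f) ^ (2 * ?k) \<le> (opnorm * r * ?u) ^ (2 * ?k)"
        by (simp add: power_mult[symmetric] mult.commute)
      then show "l2norm M (op f) \<le> opnorm * r * ?u"
        using mu r by (subst (asm) power_mono_iff) auto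
    qed (use mu r in auto)
    then show False using mu r by simp
  qed
  then obtain y where y: "y \<in> space M" and nz: "\<not> (\<lambda>n. a n y) \<longlonglongrightarrow> 0" by blast
  obtain g where g: "g \<in> sqint M" "0 < l2norm M g" "AE x in M. 0 \<le> g x"
    and eq: "l2norm M (\<lambda>x. op (op g) x - opnorm\<^sup>2 * g x) = 0"
    using even_powers_limit[OF column_sqint[OF y] K0[OF _ y] K0 mu nz[unfolded a_def]] by blast
  have og: "op g \<in> sqint M" by (rule op_sqint[OF g(1)])
  \<comment> \<open>With \<open>T\<close> the operator and \<open>m = opnorm\<close>, applying
    \<open>T - m\<close> to \<open>(T + m) g\<close> gives \<open>T^2 g - m^2 g = 0\<close>, so this
    is an eigenfunction for \<open>m\<close>. It is nonzero: \<open>g\<close> and the kernel are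
    nonnegative, so it is at least \<open>m g\<close>.\<close>
  let ?h = "\<lambda>x. 1 * op g x + opnorm * g x"
  have h: "?h \<in> sqint M" by (rule sqint_lincomb[OF og g(1)])
  have og0: "0 \<le> op g x" if "x \<in> space M" for x
    using g(3) K0[OF that] by (intro integral_nonneg_AE) (auto elim!: AE_mp)
  have "opnorm * l2norm M g = l2norm M (\<lambda>x. opnorm * g x)"
    using mu by (simp add: l2norm_scale)
  also have "\<dots> \<le> l2norm M ?h"
  proof (rule l2norm_mono(2)[OF h])
    show "AE x in M. \<bar>opnorm * g x\<bar> \<le> \<bar>?h x\<bar>"
      using g(3) AE_space by eventually_elim (use og0 mu in auto)
  qed (use g(1) in \<open>auto simp: sqint_def\<close>)
  finally have "0 < l2norm M ?h" using mu g(2) by (smt (verit) mult_pos_pos)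
  moreover have "AE x in M. op ?h x = opnorm * ?h x"
  proof -
    have "AE x in M. op (op g) x - opnorm\<^sup>2 * g x = 0"
      using eq by (subst (asm) l2norm_eq_0_iff) (intro sqint_diff op_sqint og sqint_scale g, simp)
    then show ?thesis
      using AE_space
    proof eventually_elim
      case (elim x)
      then show ?case
        unfolding op_lincomb[OF og g(1) elim(2)] by (simp add: power2_eq_square algebra_simps)
    qed
  qed
  ultimately show ?thesis using h by blast
qed

end


section \<open>Graphons on an extension of the Lebesgue space\<close>

locale lebesgue_extension =
  fixes \<nu> :: "real measure"
  assumes ext: "extends_lebesgue_01 \<nu>"
begin

abbreviation leb01 :: "real measure" where "leb01 \<equiv> lebesgue_on {0..1}"

sublocale prob_space \<nu>
  using ext by (simp add: extends_lebesgue_01_def)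

lemma space_eq [simp]: "space \<nu> = {0..1}"
  using ext by (simp add: extends_lebesgue_01_def)

lemma leb_subalgebra: "subalgebra \<nu> leb01"
  using ext by (auto simp: extends_lebesgue_01_def subalgebra_def)

text \<open>Turns the general facts on sub-sigma-algebras into the transfer of integrals and null
  sets between \<open>leb01\<close> and \<open>\<nu>\<close>.\<close>

lemma restr_leb: "restr_to_subalg \<nu> leb01 = leb01"
proof (rule measure_eqI)
  show s: "sets (restr_to_subalg \<nu> leb01) = sets leb01"
    by (rule sets_restr_to_subalg[OF leb_subalgebra])
  fix A assume "A \<in> sets (restr_to_subalg \<nu> leb01)"
  then have "A \<in> sets leb01" using s by simp
  then show "emeasure (restr_to_subalg \<nu> leb01) A = emeasure leb01 A"
    using ext emeasure_restr_to_subalg[OF leb_subalgebra] by (simp add: extends_lebesgue_01_def)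
qed

lemma leb_measurable: "f \<in> measurable leb01 N \<Longrightarrow> f \<in> measurable \<nu> N"
  by (rule measurable_from_subalg[OF leb_subalgebra])

lemma leb_integral: "f \<in> borel_measurable leb01 \<Longrightarrow> integral\<^sup>L leb01 f = (integral\<^sup>L \<nu> f :: real)"
  using integral_subalgebra2[OF leb_subalgebra, of f] by (simp add: restr_leb)

lemma leb_integrable: "integrable leb01 f \<Longrightarrow> integrable \<nu> (f :: _ \<Rightarrow> real)"
  using integrable_from_subalg[OF leb_subalgebra, of f] by (simp add: restr_leb)

lemma leb_AE: "AE x in leb01. P x \<Longrightarrow> AE x in \<nu>. P x"
  by (rule AE_restr_to_subalg[OF leb_subalgebra, unfolded restr_leb])

lemma measure_01 [simp]: "measure \<nu> {0..1} = 1"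
  using prob_space by simp

lemma leb_l2norm: "f \<in> borel_measurable leb01 \<Longrightarrow> l2norm \<nu> f = l2norm leb01 f"
  unfolding l2norm_def by (subst leb_integral) auto

lemma leb_sqint: "f \<in> sqint leb01 \<Longrightarrow> f \<in> sqint \<nu>"
  by (auto simp: sqint_def intro: leb_measurable leb_integrable)

lemma leb_ident: "(\<lambda>x. x) \<in> measurable \<nu> leb01"
  by (rule leb_measurable) simp

lemma leb_ident_pair: "(\<lambda>p. (fst p, snd p)) \<in> measurable (\<nu> \<Otimes>\<^sub>M \<nu>) (leb01 \<Otimes>\<^sub>M leb01)"
  "(\<lambda>p. (fst p, snd p)) \<in> measurable (leb01 \<Otimes>\<^sub>M \<nu>) (leb01 \<Otimes>\<^sub>M leb01)"
  by (intro measurable_Pair measurable_compose[OF measurable_fst leb_ident]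
      measurable_compose[OF measurable_snd leb_ident] measurable_fst)+

end

locale lebesgue_kernel = lebesgue_extension \<nu> for \<nu> :: "real measure" +
  fixes K :: "real \<Rightarrow> real \<Rightarrow> real"
  assumes leb_K: "(\<lambda>(x, y). K x y) \<in> borel_measurable (lebesgue_on {0..1} \<Otimes>\<^sub>M lebesgue_on {0..1})"
    and leb_K_sym: "\<And>x y. x \<in> {0..1} \<Longrightarrow> y \<in> {0..1} \<Longrightarrow> K x y = K y x"
    and leb_K_abs: "\<And>x y. x \<in> {0..1} \<Longrightarrow> y \<in> {0..1} \<Longrightarrow> \<bar>K x y\<bar> \<le> 1"
begin

lemma K_leb_ext: "(\<lambda>(x, y). K x y) \<in> borel_measurable (leb01 \<Otimes>\<^sub>M \<nu>)"
  using measurable_compose[OF leb_ident_pair(2) leb_K] by (simp add: case_prod_beta)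

sublocale sym_kernel \<nu> K
proof
  show "(\<lambda>(x, y). K x y) \<in> borel_measurable (\<nu> \<Otimes>\<^sub>M \<nu>)"
    using measurable_compose[OF leb_ident_pair(1) leb_K] by (simp add: case_prod_beta)
qed (use leb_K_sym leb_K_abs in auto)

text \<open>The image depends on the player through the kernel alone, whatever the sigma-algebra of
  \<open>f\<close>. Hence sign sets of images are Lebesgue sets, and eigenfunctions can be replaced
  by Lebesgue measurable ones.\<close>

lemma op_leb_measurable:
  assumes [measurable]: "f \<in> borel_measurable \<nu>"
  shows "op f \<in> borel_measurable leb01"
proof -
  note K_leb_ext[measurable]
  show ?thesis by measurable
qed

lemma leb_section: "x \<in> {0..1} \<Longrightarrow> K x \<in> borel_measurable leb01"
  using measurable_Pair2[OF leb_K, of x] by simp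

lemma leb_op:
  assumes "f \<in> borel_measurable leb01" "x \<in> {0..1}"
  shows "(LINT y|leb01. K x y * f y) = op f x"
  using leb_section[OF assms(2)] assms(1) by (intro leb_integral) auto

section \<open>Cut norm and operator norm\<close>

lemma borel_rectangle_eq:
  assumes S: "S\<^sub>1 \<in> sets borel" "S\<^sub>2 \<in> sets borel" "S\<^sub>1 \<subseteq> {0..1}" "S\<^sub>2 \<subseteq> {0..1}"
  shows "(LINT x:S\<^sub>1|lebesgue. (LINT y:S\<^sub>2|lebesgue. K x y))
    = (LINT x|\<nu>. indicator S\<^sub>1 x * op (indicator S\<^sub>2) x)"
proof -
  have S': "S\<^sub>1 \<in> sets leb01" "S\<^sub>2 \<in> sets leb01"
    using S by (auto simp: sets_restrict_space_iff)
  have inner: "(LINT y:S\<^sub>2|lebesgue. K x y) = op (indicator S\<^sub>2) x" if "x \<in> {0..1}" for x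
  proof -
    have "(LINT y:S\<^sub>2|lebesgue. K x y) = (LINT y|leb01. K x y * indicator S\<^sub>2 y)"
      unfolding set_lebesgue_integral_def
      by (subst integral_restrict_space)
        (use S(4) in \<open>auto intro!: Bochner_Integration.integral_cong simp: indicator_def\<close>)
    also have "\<dots> = op (indicator S\<^sub>2) x"
      using S' that by (intro leb_op) auto
    finally show ?thesis .
  qed
  have "(LINT x:S\<^sub>1|lebesgue. (LINT y:S\<^sub>2|lebesgue. K x y))
      = (LINT x|leb01. indicator S\<^sub>1 x * op (indicator S\<^sub>2) x)"
    unfolding set_lebesgue_integral_def[of _ S\<^sub>1]
    by (subst integral_restrict_space)
      (use S(3) inner in \<open>auto intro!: Bochner_Integration.integral_cong simp: indicator_def\<close>)
  also have "\<dots> = (LINT x|\<nu>. indicator S\<^sub>1 x * op (indicator S\<^sub>2) x)"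
    using S' leb_measurable[of "indicator S\<^sub>2" borel]
    by (intro leb_integral borel_measurable_times op_leb_measurable) auto
  finally show ?thesis .
qed

text \<open>Keeps the set in \<open>cut_norm\<close> bounded, so that \<open>Sup\<close> there is a
  genuine supremum.\<close>

lemma rectangle_bdd:
  assumes S: "S\<^sub>1 \<in> sets \<nu>" "S\<^sub>2 \<in> sets \<nu>"
  shows "\<bar>LINT x|\<nu>. indicator S\<^sub>1 x * op (indicator S\<^sub>2) x\<bar> \<le> 1"
proof -
  have i: "(indicator S :: real \<Rightarrow> real) \<in> sqint \<nu>" "l2norm \<nu> (indicator S) \<le> 1" if "S \<in> sets \<nu>" for S
    using l2norm_mono[OF sqint_const[of 1], of "indicator S"] that
    by (auto simp: l2norm_def[of \<nu> "\<lambda>x. 1"] prob_space indicator_def[abs_def])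
  have "\<bar>l2inner \<nu> (indicator S\<^sub>1) (op (indicator S\<^sub>2))\<bar>
      \<le> l2norm \<nu> (indicator S\<^sub>1) * l2norm \<nu> (op (indicator S\<^sub>2))"
    using i S by (intro l2_Cauchy_Schwarz op_sqint)
  also have "\<dots> \<le> 1 * 1"
    using i S order_trans[OF op_l2norm_le[OF i(1)[OF S(2)]]] by (intro mult_mono) auto
  finally show ?thesis by (simp add: l2inner_def)
qed

lemma borel_rectangle_le_cut_norm:
  assumes S: "S\<^sub>1 \<in> sets borel" "S\<^sub>2 \<in> sets borel" "S\<^sub>1 \<subseteq> {0..1}" "S\<^sub>2 \<subseteq> {0..1}"
  shows "\<bar>LINT x|\<nu>. indicator S\<^sub>1 x * op (indicator S\<^sub>2) x\<bar> \<le> cut_norm K"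
proof -
  have borel_sets: "S \<in> sets \<nu>" if "S \<in> sets borel" "S \<subseteq> {0..1}" for S
    using leb_subalgebra that by (auto simp: subalgebra_def sets_restrict_space_iff)
  show ?thesis
    unfolding cut_norm_def
  proof (rule cSup_upper)
    show "\<bar>LINT x|\<nu>. indicator S\<^sub>1 x * op (indicator S\<^sub>2) x\<bar> \<in>
      {\<bar>LINT x:S\<^sub>1|lebesgue. (LINT y:S\<^sub>2|lebesgue. K x y)\<bar> | S\<^sub>1 S\<^sub>2.
        S\<^sub>1 \<in> sets borel \<and> S\<^sub>2 \<in> sets borel \<and> S\<^sub>1 \<subseteq> {0..1} \<and> S\<^sub>2 \<subseteq> {0..1}}"
      unfolding borel_rectangle_eq[OF S, symmetric] using S by blast
    show "bdd_above {\<bar>LINT x:S\<^sub>1|lebesgue. (LINT y:S\<^sub>2|lebesgue. K x y)\<bar> | S\<^sub>1 S\<^sub>2.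
        S\<^sub>1 \<in> sets borel \<and> S\<^sub>2 \<in> sets borel \<and> S\<^sub>1 \<subseteq> {0..1} \<and> S\<^sub>2 \<subseteq> {0..1}}"
    proof (rule bdd_aboveI[of _ 1], clarify)
      fix S\<^sub>1 S\<^sub>2 :: "real set"
      assume "S\<^sub>1 \<in> sets borel" "S\<^sub>2 \<in> sets borel" "S\<^sub>1 \<subseteq> {0..1}" "S\<^sub>2 \<subseteq> {0..1}"
      then show "\<bar>LINT x:S\<^sub>1|lebesgue. (LINT y:S\<^sub>2|lebesgue. K x y)\<bar> \<le> 1"
        using rectangle_bdd[of S\<^sub>1 S\<^sub>2] borel_sets by (simp add: borel_rectangle_eq)
    qed
  qed
qed

lemma cut_norm_nonneg: "0 \<le> cut_norm K"
  using borel_rectangle_le_cut_norm[of "{}" "{}"] by simp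

text \<open>The cut norm ranges over Borel sets, while the sign sets below are only Lebesgue sets;
  the two differ by a null set.\<close>

lemma leb_set_borel:
  assumes "A \<in> sets leb01"
  obtains S where "S \<in> sets borel" "S \<subseteq> {0..1}" "AE x in \<nu>. indicator A x = (indicator S x :: real)"
proof -
  have A: "A \<in> sets (completion lborel)" "A \<subseteq> {0..1}"
    using assms by (auto simp: sets_restrict_space_iff)
  obtain S N N' where S: "A = S \<union> N" "N \<subseteq> N'" "N' \<in> null_sets lborel" "S \<in> sets lborel"
    using sets_completionE[OF A(1)] by metis
  have "AE x in lebesgue. x \<notin> N'"
    using AE_not_in[OF S(3)] by (rule AE_completion)
  then have "AE x in leb01. x \<notin> N'"
    by (subst AE_restrict_space_iff) auto
  then have "AE x in \<nu>. x \<notin> N'" by (rule leb_AE)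
  then have "AE x in \<nu>. indicator A x = (indicator S x :: real)"
    by eventually_elim (use S in \<open>auto simp: indicator_def\<close>)
  then show thesis using that[of S] S A by auto
qed

lemma rectangle_le_cut_norm:
  assumes "A \<in> sets leb01" "B \<in> sets leb01"
  shows "\<bar>LINT x|\<nu>. indicator A x * op (indicator B) x\<bar> \<le> cut_norm K"
proof -
  obtain S where S: "S \<in> sets borel" "S \<subseteq> {0..1}" "AE x in \<nu>. indicator A x = (indicator S x :: real)"
    using leb_set_borel[OF assms(1)] by metis
  obtain T where T: "T \<in> sets borel" "T \<subseteq> {0..1}" "AE x in \<nu>. indicator B x = (indicator T x :: real)"
    using leb_set_borel[OF assms(2)] by metis
  have m: "(indicator C :: real \<Rightarrow> real) \<in> sqint \<nu>" if "C \<in> sets leb01" for C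
    using leb_measurable[of "indicator C" borel] that
    by (intro sqint_bounded[where B = 1]) (auto simp: indicator_def)
  have S': "S \<in> sets leb01" "T \<in> sets leb01"
    using S T by (auto simp: sets_restrict_space_iff)
  have "(LINT x|\<nu>. indicator A x * op (indicator B) x) = (LINT x|\<nu>. indicator S x * op (indicator T) x)"
  proof (rule integral_cong_AE)
    show "AE x in \<nu>. indicator A x * op (indicator B) x = indicator S x * op (indicator T) x"
      using S(3) AE_space
    proof eventually_elim
      case (elim x)
      then show ?case
        using op_cong_AE[OF m[OF assms(2)] m[OF S'(2)] T(3), of x] by simp
    qed
    show "(\<lambda>x. indicator A x * op (indicator B) x) \<in> borel_measurable \<nu>"
      "(\<lambda>x. indicator S x * op (indicator T) x) \<in> borel_measurable \<nu>"
      using m[OF assms(1)] m[OF assms(2)] m[OF S'(1)] m[OF S'(2)]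
      by (auto intro!: borel_measurable_times intro: sqint_measurable sqint_measurable[OF op_sqint])
  qed
  then show ?thesis using borel_rectangle_le_cut_norm[of S T] S T by simp
qed

text \<open>\<open>A\<close> is the set where the image is nonnegative. Multiplying by its sign and
  moving the operator to the indicators by self-adjointness leaves \<open>f\<close>, which is only
  \<open>\<nu>\<close>-measurable, paired with images of Lebesgue sets.\<close>

lemma integral_abs_op_split:
  assumes f: "f \<in> sqint \<nu>"
  obtains A where "A \<in> sets leb01"
    "(LINT x|\<nu>. \<bar>op f x\<bar>) = (LINT x|\<nu>. f x * op (indicator A) x)
      - (LINT x|\<nu>. f x * op (indicator ({0..1} - A)) x)"
proof
  let ?A = "{x \<in> space leb01. 0 \<le> op f x}"
  have h: "op f \<in> borel_measurable leb01"
    using sqint_measurable[OF f] by (rule op_leb_measurable)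
  then show A: "?A \<in> sets leb01" by measurable
  have A': "{0..1} - ?A \<in> sets leb01"
    using sets.compl_sets[OF A] by simp
  have m: "(indicator C :: real \<Rightarrow> real) \<in> sqint \<nu>" if "C \<in> sets leb01" for C
    using leb_measurable[of "indicator C" borel] that
    by (intro sqint_bounded[where B = 1]) (auto simp: indicator_def)
  have of: "op f \<in> sqint \<nu>" by (rule op_sqint[OF f])
  have "(LINT x|\<nu>. \<bar>op f x\<bar>)
      = (LINT x|\<nu>. op f x * indicator ?A x - op f x * indicator ({0..1} - ?A) x)"
    by (intro Bochner_Integration.integral_cong) (auto simp: indicator_def)
  also have "\<dots> = l2inner \<nu> (op f) (indicator ?A) - l2inner \<nu> (op f) (indicator ({0..1} - ?A))"
    unfolding l2inner_def
    by (intro Bochner_Integration.integral_diff sqint_mult_integrable of m A A')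
  finally show "(LINT x|\<nu>. \<bar>op f x\<bar>) = (LINT x|\<nu>. f x * op (indicator ?A) x)
      - (LINT x|\<nu>. f x * op (indicator ({0..1} - ?A)) x)"
    unfolding op_selfadjoint[OF f m[OF A]] op_selfadjoint[OF f m[OF A']] by (simp add: l2inner_def)
qed

lemma integral_abs_op_indicator:
  assumes "A \<in> sets leb01"
  shows "(LINT x|\<nu>. \<bar>op (indicator A) x\<bar>) \<le> 2 * cut_norm K"
proof -
  have "(indicator A :: real \<Rightarrow> real) \<in> sqint \<nu>"
    using leb_measurable[of "indicator A" borel] assms
    by (intro sqint_bounded[where B = 1]) (auto simp: indicator_def)
  from integral_abs_op_split[OF this]
  obtain B where B: "B \<in> sets leb01"
    "(LINT x|\<nu>. \<bar>op (indicator A) x\<bar>) = (LINT x|\<nu>. indicator A x * op (indicator B) x)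
      - (LINT x|\<nu>. indicator A x * op (indicator ({0..1} - B)) x)" .
  have B': "{0..1} - B \<in> sets leb01" using sets.compl_sets[OF B(1)] by simp
  show ?thesis
    unfolding B(2)
    using abs_le_D1[OF rectangle_le_cut_norm[OF assms B(1)]]
      abs_le_D2[OF rectangle_le_cut_norm[OF assms B']]
    by argo
qed

text \<open>For \<open>f\<close> bounded by \<open>B\<close> the sign set of the image splits the L1
  norm into two pieces. Each is at most \<open>B\<close> times the L1 norm of the image of an
  indicator, which by a second sign split costs two rectangles; this is the factor 4.
  \<open>l2_bound_of_L1_bound\<close> turns it into the square root.\<close>

lemma op_cut_norm:
  assumes f: "f \<in> sqint \<nu>"
  shows "l2norm \<nu> (op f) \<le> sqrt (4 * cut_norm K) * l2norm \<nu> f"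
proof (rule l2_bound_of_L1_bound[OF _ _ f])
  fix f :: "real \<Rightarrow> real" and B :: real
  assume fm[measurable]: "f \<in> borel_measurable \<nu>" and B: "\<And>x. x \<in> space \<nu> \<Longrightarrow> \<bar>f x\<bar> \<le> B"
  have f: "f \<in> sqint \<nu>" using B by (intro sqint_bounded[where B = B]) auto
  have B0: "0 \<le> B" using B[of 0] by simp
  obtain A where A: "A \<in> sets leb01"
    "(LINT x|\<nu>. \<bar>op f x\<bar>) = (LINT x|\<nu>. f x * op (indicator A) x)
      - (LINT x|\<nu>. f x * op (indicator ({0..1} - A)) x)"
    by (rule integral_abs_op_split[OF f])
  have *: "\<bar>LINT x|\<nu>. f x * op (indicator C) x\<bar> \<le> B * (2 * cut_norm K)" if C: "C \<in> sets leb01" for C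
  proof -
    have m: "(indicator C :: real \<Rightarrow> real) \<in> sqint \<nu>"
      using leb_measurable[of "indicator C" borel] C
      by (intro sqint_bounded[where B = 1]) (auto simp: indicator_def)
    have "\<bar>LINT x|\<nu>. f x * op (indicator C) x\<bar> \<le> (LINT x|\<nu>. \<bar>f x * op (indicator C) x\<bar>)"
      by (rule integral_abs_bound)
    also have "\<dots> \<le> (LINT x|\<nu>. B * \<bar>op (indicator C) x\<bar>)"
    proof (rule integral_mono)
      show "integrable \<nu> (\<lambda>x. \<bar>f x * op (indicator C) x\<bar>)"
        by (intro integrable_abs sqint_mult_integrable f op_sqint m)
      show "integrable \<nu> (\<lambda>x. B * \<bar>op (indicator C) x\<bar>)"
        by (intro integrable_mult_right integrable_abs sqint_integrable op_sqint m)
      show "\<bar>f x * op (indicator C) x\<bar> \<le> B * \<bar>op (indicator C) x\<bar>" if "x \<in> space \<nu>" for x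
        unfolding abs_mult using B[OF that] by (intro mult_right_mono) auto
    qed
    also have "\<dots> \<le> B * (2 * cut_norm K)"
      using integral_abs_op_indicator[OF C] B0 by (simp add: mult_left_mono)
    finally show ?thesis .
  qed
  have "{0..1} - A \<in> sets leb01" using sets.compl_sets[OF A(1)] by simp
  then show "(LINT x|\<nu>. \<bar>op f x\<bar>) \<le> 4 * cut_norm K * B"
    unfolding A(2) using *[OF A(1)] *[of "{0..1} - A"] by (simp only: abs_le_iff) argo
qed (use cut_norm_nonneg in simp)

text \<open>\<open>GREATEST\<close> needs an attained maximum: \<open>opnorm\<close> is an
  eigenvalue by \<open>opnorm_eigenvalue\<close>, and any eigenvalue is bounded by it in absolute
  value, as an eigenfunction shows.\<close>

lemma largest_eigenvalue_eq_opnorm: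
  assumes K0: "\<And>x y. x \<in> {0..1} \<Longrightarrow> y \<in> {0..1} \<Longrightarrow> 0 \<le> K x y"
  shows "largest_eigenvalue K = opnorm"
  unfolding largest_eigenvalue_def
proof (rule Greatest_equality)
  have finl: "finite_measure leb01"
    by (rule finite_measureI) (simp add: emeasure_restrict_space)
  have conclude: "graphon_eigenvalue K l"
    if f: "f \<in> borel_measurable leb01" "f \<in> sqint \<nu>" and nz: "l2norm \<nu> f \<noteq> 0"
      and eq: "l2norm \<nu> (\<lambda>x. op f x - l * f x) = 0" for f l
  proof -
    have fl: "f \<in> sqint leb01"
    proof -
      have "(\<integral>\<^sup>+x. ennreal ((f x)\<^sup>2) \<partial>leb01) = (\<integral>\<^sup>+x. ennreal ((f x)\<^sup>2) \<partial>\<nu>)"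
        using nn_integral_subalgebra2[OF leb_subalgebra, of "\<lambda>x. ennreal ((f x)\<^sup>2)"] f(1)
        by (simp add: restr_leb)
      then show ?thesis using f by (simp add: sqint_nn_integral)
    qed
    have dm: "(\<lambda>x. op f x - l * f x) \<in> borel_measurable leb01"
      using op_leb_measurable[OF sqint_measurable[OF f(2)]] f(1) by auto
    interpret L: finite_measure leb01 by (rule finl)
    have dl: "(\<lambda>x. op f x - l * f x) \<in> sqint leb01"
    proof (rule sqint_diff[OF _ sqint_scale[OF fl]])
      show "op f \<in> sqint leb01"
        using op_leb_measurable[OF sqint_measurable[OF f(2)]] op_abs_le[OF f(2)]
        by (intro L.sqint_bounded[where B = "l2norm \<nu> f"]) auto
    qed
    have "AE x in leb01. op f x - l * f x = 0"
      using eq l2norm_eq_0_iff[OF dl] leb_l2norm[OF dm] by simp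
    then have "AE x in leb01. graphon_op leb01 K f x = l * f x"
      using AE_space by eventually_elim (use leb_op[OF f(1)] in \<open>auto simp: graphon_op_def\<close>)
    moreover have "\<not> (AE x in leb01. f x = 0)"
      using nz l2norm_eq_0_iff[OF fl] leb_l2norm[OF f(1)] by simp
    ultimately show ?thesis
      unfolding graphon_eigenvalue_def using fl f(1) by (auto simp: sqint_def)
  qed
  obtain h where h: "h \<in> sqint \<nu>" "0 < l2norm \<nu> h" "AE x in \<nu>. op h x = opnorm * h x"
    using opnorm_eigenvalue K0 unfolding space_eq by blast
  show "graphon_eigenvalue K opnorm"
  proof (cases "opnorm = 0")
    case True
    have one: "(\<lambda>x. 1) \<in> sqint \<nu>" by (rule sqint_const)
    show ?thesis
    proof (rule conclude[OF _ one])
      show "l2norm \<nu> (\<lambda>x. op (\<lambda>x. 1) x - opnorm * 1) = 0"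
        using op_le_opnorm[OF one] True by (simp add: order_antisym)
    qed (auto simp: l2norm_def prob_space)
  next
    \<comment> \<open>The eigenfunction \<open>h\<close> is only \<open>\<nu>\<close>-measurable.
      Its image is Lebesgue measurable and, as \<open>opnorm\<close> is positive, still a nonzero
      eigenfunction.\<close>
    case False
    then have mu: "0 < opnorm" using opnorm_nonneg by simp
    have oh: "op h \<in> sqint \<nu>" by (rule op_sqint[OF h(1)])
    have ooh: "op (op h) x = opnorm * op h x" if "x \<in> space \<nu>" for x
      using op_cong_AE[OF oh sqint_scale[OF h(1)] h(3) that]
        op_lincomb[OF h(1) h(1) that, of opnorm 0] by simp
    show ?thesis
    proof (rule conclude[OF _ oh])
      show "op h \<in> borel_measurable leb01"
        using sqint_measurable[OF h(1)] by (rule op_leb_measurable)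
      have "l2norm \<nu> (op h) = l2norm \<nu> (\<lambda>x. opnorm * h x)"
        by (intro l2norm_cong_AE sqint_measurable[OF oh] sqint_measurable[OF sqint_scale[OF h(1)]] h(3))
      then show "l2norm \<nu> (op h) \<noteq> 0"
        using mu h(2) by (simp add: l2norm_scale)
      have "l2norm \<nu> (\<lambda>x. op (op h) x - opnorm * op h x) = l2norm \<nu> (\<lambda>x. 0)"
        unfolding l2norm_def using ooh
        by (intro arg_cong[where f = sqrt] Bochner_Integration.integral_cong) auto
      then show "l2norm \<nu> (\<lambda>x. op (op h) x - opnorm * op h x) = 0" by simp
    qed
  qed
  fix l assume "graphon_eigenvalue K l"
  then obtain f where f: "f \<in> sqint leb01" "\<not> (AE x in leb01. f x = 0)"
    "AE x in leb01. graphon_op leb01 K f x = l * f x"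
    unfolding graphon_eigenvalue_def sqint_def by blast
  have fm: "f \<in> borel_measurable leb01" using f(1) by (rule sqint_measurable)
  have fn: "f \<in> sqint \<nu>" using f(1) by (rule leb_sqint)
  have nz: "0 < l2norm \<nu> f"
    using f(2) l2norm_eq_0_iff[OF f(1)] leb_l2norm[OF fm] l2norm_nonneg[of \<nu> f] by linarith
  have "AE x in \<nu>. op f x = l * f x"
    using leb_AE[OF f(3)] AE_space
    by eventually_elim (use leb_op[OF fm] in \<open>auto simp: graphon_op_def\<close>)
  then have "l2norm \<nu> (op f) = l2norm \<nu> (\<lambda>x. l * f x)"
    by (intro l2norm_cong_AE sqint_measurable[OF op_sqint[OF fn]] sqint_measurable[OF sqint_scale[OF fn]])
  then have "\<bar>l\<bar> * l2norm \<nu> f \<le> opnorm * l2norm \<nu> f"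
    using op_le_opnorm[OF fn] by (simp add: l2norm_scale)
  then show "l \<le> opnorm" using nz by simp
qed

end


section \<open>Separability of the sections of product measurable functions\<close>

text \<open>\<open>\<nu>\<close> and \<open>P\<close> are arbitrary, so their L2 spaces may fail to
  be separable. The sections of one jointly measurable function nevertheless stay in a separable
  part; the countable set \<open>C\<close> need not consist of sections.\<close>

definition separable_sections :: "'a measure \<Rightarrow> 'b measure \<Rightarrow> ('a \<Rightarrow> 'b \<Rightarrow> real) \<Rightarrow> bool" where
  "separable_sections M N f \<longleftrightarrow>
     (\<exists>C. countable C \<and> C \<subseteq> sqint N \<and>
        (\<forall>x\<in>space M. f x \<in> sqint N \<and> (\<forall>e>0. \<exists>c\<in>C. l2norm N (\<lambda>y. f x y - c y) < e)))"

lemma separable_sections_sqint: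
  "separable_sections M N f \<Longrightarrow> x \<in> space M \<Longrightarrow> f x \<in> sqint N"
  by (auto simp: separable_sections_def)

lemma separable_sections_cong:
  assumes "separable_sections M N f"
    and "\<And>x y. x \<in> space M \<Longrightarrow> y \<in> space N \<Longrightarrow> f x y = g x y"
  shows "separable_sections M N g"
proof -
  have "g x \<in> sqint N \<longleftrightarrow> f x \<in> sqint N" if "x \<in> space M" for x
    unfolding sqint_def using assms(2)[OF that]
    by (auto cong: measurable_cong Bochner_Integration.integrable_cong)
  moreover have "l2norm N (\<lambda>y. g x y - c y) = l2norm N (\<lambda>y. f x y - c y)" if "x \<in> space M" for x c
    unfolding l2norm_def using assms(2)[OF that]
    by (intro arg_cong[where f = sqrt] Bochner_Integration.integral_cong) auto
  ultimately show ?thesis using assms(1) unfolding separable_sections_def by simp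
qed

lemma separable_sections_lincomb:
  assumes f: "separable_sections M N f" and g: "separable_sections M N g"
  shows "separable_sections M N (\<lambda>x y. a * f x y + b * g x y)"
proof -
  obtain C where C: "countable C" "C \<subseteq> sqint N"
    "\<And>x e. x \<in> space M \<Longrightarrow> 0 < e \<Longrightarrow> \<exists>c\<in>C. l2norm N (\<lambda>y. f x y - c y) < e"
    using f unfolding separable_sections_def by blast
  obtain D where D: "countable D" "D \<subseteq> sqint N"
    "\<And>x e. x \<in> space M \<Longrightarrow> 0 < e \<Longrightarrow> \<exists>c\<in>D. l2norm N (\<lambda>y. g x y - c y) < e"
    using g unfolding separable_sections_def by blast
  let ?E = "(\<lambda>(c, d). \<lambda>y. a * c y + b * d y) ` (C \<times> D)"
  have "\<exists>c\<in>?E. l2norm N (\<lambda>y. (a * f x y + b * g x y) - c y) < e"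
    if x: "x \<in> space M" and e: "0 < e" for x and e :: real
  proof -
    let ?s = "\<bar>a\<bar> + \<bar>b\<bar> + 1"
    have pos: "0 < e / ?s" using e by (intro divide_pos_pos) auto
    obtain c where c: "c \<in> C" "l2norm N (\<lambda>y. f x y - c y) < e / ?s"
      using C(3)[OF x pos] by blast
    obtain d where d: "d \<in> D" "l2norm N (\<lambda>y. g x y - d y) < e / ?s"
      using D(3)[OF x pos] by blast
    have fs: "(\<lambda>y. f x y - c y) \<in> sqint N" "(\<lambda>y. g x y - d y) \<in> sqint N"
      using separable_sections_sqint[OF f x] separable_sections_sqint[OF g x] c d C(2) D(2)
      by (auto intro: sqint_diff)
    have "l2norm N (\<lambda>y. (a * f x y + b * g x y) - (a * c y + b * d y))
        = l2norm N (\<lambda>y. a * (f x y - c y) + b * (g x y - d y))"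
      by (simp add: algebra_simps)
    also have "\<dots> \<le> \<bar>a\<bar> * l2norm N (\<lambda>y. f x y - c y) + \<bar>b\<bar> * l2norm N (\<lambda>y. g x y - d y)"
      using l2norm_triangle[OF sqint_scale[OF fs(1), of a] sqint_scale[OF fs(2), of b]]
      by (simp add: l2norm_scale)
    also have "\<dots> \<le> \<bar>a\<bar> * (e / ?s) + \<bar>b\<bar> * (e / ?s)"
      using c(2) d(2) by (intro add_mono mult_left_mono) auto
    also have "\<dots> = (\<bar>a\<bar> + \<bar>b\<bar>) * (e / ?s)" by (simp only: distrib_right)
    also have "\<dots> < ?s * (e / ?s)" using pos by (intro mult_strict_right_mono) auto
    also have "\<dots> = e" by simp
    finally show ?thesis using c(1) d(1) by (intro bexI[of _ "\<lambda>y. a * c y + b * d y"]) auto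
  qed
  moreover have "?E \<subseteq> sqint N" using C(2) D(2) by (auto intro!: sqint_lincomb)
  moreover have "countable ?E" using C(1) D(1) by simp
  ultimately show ?thesis
    unfolding separable_sections_def
    using sqint_lincomb[OF separable_sections_sqint[OF f] separable_sections_sqint[OF g]]
    by (intro exI[of _ ?E]) blast
qed

lemma separable_sections_zero: "separable_sections M N (\<lambda>x y. 0)"
  unfolding separable_sections_def by (intro exI[of _ "{\<lambda>y. 0}"]) auto

lemma separable_sections_sum:
  assumes "finite I" "\<And>i. i \<in> I \<Longrightarrow> separable_sections M N (f i)"
  shows "separable_sections M N (\<lambda>x y. \<Sum>i\<in>I. a i * f i x y)"
  using assms
proof (induction I rule: finite_induct)
  case (insert i I)
  have "separable_sections M N (\<lambda>x y. a i * f i x y + 1 * (\<Sum>i\<in>I. a i * f i x y))"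
    by (rule separable_sections_lincomb) (use insert in auto)
  then show ?case using insert by simp
qed (simp add: separable_sections_zero)

lemma separable_sections_limit:
  assumes f: "\<And>n::nat. separable_sections M N (f n)"
    and g: "\<And>x. x \<in> space M \<Longrightarrow> g x \<in> sqint N"
    and lim: "\<And>x. x \<in> space M \<Longrightarrow> (\<lambda>n. l2norm N (\<lambda>y. f n x y - g x y)) \<longlonglongrightarrow> 0"
  shows "separable_sections M N g"
proof -
  have "\<forall>n. \<exists>C. countable C \<and> C \<subseteq> sqint N \<and>
      (\<forall>x\<in>space M. f n x \<in> sqint N \<and> (\<forall>e>0. \<exists>c\<in>C. l2norm N (\<lambda>y. f n x y - c y) < e))"
    using f unfolding separable_sections_def by blast
  then obtain C where C: "\<And>n. countable (C n)" "\<And>n. C n \<subseteq> sqint N"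
    "\<And>n x e. x \<in> space M \<Longrightarrow> 0 < e \<Longrightarrow> \<exists>c\<in>C n. l2norm N (\<lambda>y. f n x y - c y) < e"
    by metis
  have "\<exists>c\<in>(\<Union>n. C n). l2norm N (\<lambda>y. g x y - c y) < e"
    if x: "x \<in> space M" and e: "0 < e" for x and e :: real
  proof -
    have "\<forall>\<^sub>F n in sequentially. l2norm N (\<lambda>y. f n x y - g x y) < e / 2"
      using order_tendstoD(2)[OF lim[OF x], of "e / 2"] e by simp
    then obtain n where n: "l2norm N (\<lambda>y. f n x y - g x y) < e / 2"
      using eventually_happens'[OF sequentially_bot] by blast
    obtain c where c: "c \<in> C n" "l2norm N (\<lambda>y. f n x y - c y) < e / 2"
      using C(3)[OF x, of "e / 2" n] e by auto
    have "l2norm N (\<lambda>y. g x y - c y)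
        \<le> l2norm N (\<lambda>y. g x y - f n x y) + l2norm N (\<lambda>y. f n x y - c y)"
      using g[OF x] separable_sections_sqint[OF f x] c(1) C(2)
      by (intro l2norm_triangle_diff) auto
    also have "\<dots> < e" using n c(2) l2norm_minus_commute[of N "g x" "f n x"] by simp
    finally show ?thesis using c(1) by blast
  qed
  moreover have "(\<Union>n. C n) \<subseteq> sqint N" using C(2) by blast
  moreover have "countable (\<Union>n. C n)" using C(1) by simp
  ultimately show ?thesis
    unfolding separable_sections_def using g by (intro exI[of _ "\<Union>n. C n"]) blast
qed

context finite_measure
begin

lemma separable_sections_rectangle:
  assumes "A \<in> sets L" "B \<in> sets M"
  shows "separable_sections L M (\<lambda>x y. indicator (A \<times> B) (x, y))"
proof -
  have ind: "(indicator B :: 'a \<Rightarrow> real) \<in> sqint M"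
    by (rule sqint_bounded[where B = 1]) (use assms in \<open>auto simp: indicator_def\<close>)
  have "separable_sections L M (\<lambda>x y. indicator A x * indicator B y)"
    unfolding separable_sections_def
  proof (intro exI[of _ "{\<lambda>y. 0, indicator B}"] conjI ballI allI impI)
    show "(\<lambda>y. indicator A x * indicator B y) \<in> sqint M" for x by (intro sqint_scale ind)
    fix x and e :: real assume "0 < e"
    show "\<exists>c\<in>{\<lambda>y. 0, indicator B}. l2norm M (\<lambda>y. indicator A x * indicator B y - c y) < e"
      using \<open>0 < e\<close> by (cases "x \<in> A") auto
  qed (use ind in auto)
  then show ?thesis
    by (rule separable_sections_cong) (auto simp: indicator_def)
qed

text \<open>Dynkin's argument: the property holds for rectangles and survives complements and
  countable disjoint unions, the last because the sections of the partial unions converge in L2 by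
  domination.\<close>

lemma separable_sections_indicator:
  assumes "S \<in> sets (L \<Otimes>\<^sub>M M)"
  shows "separable_sections L M (\<lambda>x y. indicator S (x, y))"
  using Int_stable_pair_measure_generator pair_measure_closed assms
  unfolding sets_pair_measure
proof (induction S rule: sigma_sets_induct_disjoint)
  case (basic A)
  then show ?case using separable_sections_rectangle by auto
next
  case empty
  then show ?case using separable_sections_zero by simp
next
  case (compl A)
  have "separable_sections L M (\<lambda>x y. 1 * indicator (space L \<times> space M) (x, y) + (-1) * indicator A (x, y))"
    by (intro separable_sections_lincomb separable_sections_rectangle compl) auto
  then show ?case by (rule separable_sections_cong) (auto simp: indicator_def)
next
  case (union A)
  have Am: "A n \<in> sets (L \<Otimes>\<^sub>M M)" for n
    using union(2) unfolding sets_pair_measure by auto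
  have fin: "separable_sections L M (\<lambda>x y. indicator (\<Union>i<n. A i) (x, y))" for n
  proof -
    have "separable_sections L M (\<lambda>x y. \<Sum>i<n. 1 * indicator (A i) (x, y))"
      by (intro separable_sections_sum union.IH) auto
    then show ?thesis
    proof (rule separable_sections_cong)
      fix x y
      have "disjoint_family_on A {..<n}" using union(1) by (rule disjoint_family_on_mono[rotated]) simp
      then show "(\<Sum>i<n. 1 * indicator (A i) (x, y)) = (indicator (\<Union>i<n. A i) (x, y) :: real)"
        by (subst indicator_UN_disjoint) auto
    qed
  qed
  show ?case
  proof (rule separable_sections_limit[OF fin])
    fix x assume x: "x \<in> space L"
    have sec: "{y \<in> space M. (x, y) \<in> S} \<in> sets M" if "S \<in> sets (L \<Otimes>\<^sub>M M)" for S
      using that x by measurable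
    have meas: "(\<lambda>y. indicator S (x, y) :: real) \<in> borel_measurable M" if "S \<in> sets (L \<Otimes>\<^sub>M M)" for S
      using measurable_Pair2[OF borel_measurable_indicator[OF that] x] .
    have U: "(\<Union>i. A i) \<in> sets (L \<Otimes>\<^sub>M M)" "(\<Union>i<n. A i) \<in> sets (L \<Otimes>\<^sub>M M)" for n
      using Am by auto
    show "(\<lambda>y. indicator (\<Union> (range A)) (x, y)) \<in> sqint M"
      using meas[OF U(1)] by (intro sqint_bounded[where B = 1]) (auto simp: indicator_def)
    have "(\<lambda>n. LINT y|M. (indicator (\<Union>i<n. A i) (x, y) - indicator (\<Union> (range A)) (x, y))\<^sup>2)
        \<longlonglongrightarrow> (LINT y|M. (0 :: real))"
    proof (rule integral_dominated_convergence[where w = "\<lambda>_. 1"])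
      show "AE y in M. (\<lambda>n. (indicator (\<Union>i<n. A i) (x, y) - indicator (\<Union> (range A)) (x, y) :: real)\<^sup>2) \<longlonglongrightarrow> 0"
      proof (rule AE_I2)
        fix y
        show "(\<lambda>n. (indicator (\<Union>i<n. A i) (x, y) - indicator (\<Union> (range A)) (x, y) :: real)\<^sup>2) \<longlonglongrightarrow> 0"
        proof (cases "\<exists>i. (x, y) \<in> A i")
          case True
          then obtain i where i: "(x, y) \<in> A i" by blast
          have "\<forall>\<^sub>F n in sequentially. (indicator (\<Union>i<n. A i) (x, y) - indicator (\<Union> (range A)) (x, y) :: real)\<^sup>2 = 0"
            using eventually_gt_at_top[of i] by eventually_elim (use i in \<open>auto simp: indicator_def\<close>)
          then show ?thesis by (rule tendsto_eventually)
        qed (simp add: indicator_def)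
      qed
      show "(\<lambda>y. (indicator (\<Union>i<n. A i) (x, y) - indicator (\<Union> (range A)) (x, y) :: real)\<^sup>2)
          \<in> borel_measurable M" for n
        by (intro borel_measurable_power borel_measurable_diff meas U)
    qed (auto simp: indicator_def)
    then show "(\<lambda>n. l2norm M (\<lambda>y. indicator (\<Union>i<n. A i) (x, y) - indicator (\<Union> (range A)) (x, y))) \<longlonglongrightarrow> 0"
      unfolding l2norm_def using tendsto_real_sqrt by fastforce
  qed
qed

lemma separable_sections_measurable:
  fixes f :: "'b \<Rightarrow> 'a \<Rightarrow> real"
  assumes f: "(\<lambda>(x, y). f x y) \<in> borel_measurable (L \<Otimes>\<^sub>M M)"
    and sq: "\<And>x. x \<in> space L \<Longrightarrow> f x \<in> sqint M"
  shows "separable_sections L M f"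
proof -
  obtain s where s: "\<And>i. simple_function (L \<Otimes>\<^sub>M M) (s i)"
    "\<And>p. p \<in> space (L \<Otimes>\<^sub>M M) \<Longrightarrow> (\<lambda>i. s i p) \<longlonglongrightarrow> (case p of (x, y) \<Rightarrow> f x y)"
    "\<And>i p. p \<in> space (L \<Otimes>\<^sub>M M) \<Longrightarrow> dist (s i p) 0 \<le> 2 * dist (case p of (x, y) \<Rightarrow> f x y) 0"
    using borel_measurable_implies_sequence_metric[OF f, of 0] by blast
  have simple: "separable_sections L M (\<lambda>x y. t (x, y))" if t: "simple_function (L \<Otimes>\<^sub>M M) t" for t :: "_ \<Rightarrow> real"
  proof -
    let ?V = "t ` space (L \<Otimes>\<^sub>M M)"
    have "separable_sections L M (\<lambda>x y. \<Sum>v\<in>?V. v * indicator (t -` {v} \<inter> space (L \<Otimes>\<^sub>M M)) (x, y))"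
      using simple_functionD[OF t] by (intro separable_sections_sum separable_sections_indicator) auto
    then show ?thesis
    proof (rule separable_sections_cong)
      fix x y assume "x \<in> space L" "y \<in> space M"
      then have p: "(x, y) \<in> space (L \<Otimes>\<^sub>M M)" by (simp add: space_pair_measure)
      have "(\<Sum>v\<in>?V. v * indicator (t -` {v} \<inter> space (L \<Otimes>\<^sub>M M)) (x, y))
          = (\<Sum>v\<in>?V. if t (x, y) = v then v else 0)"
        using p by (intro sum.cong) (auto simp: indicator_def)
      then show "(\<Sum>v\<in>?V. v * indicator (t -` {v} \<inter> space (L \<Otimes>\<^sub>M M)) (x, y)) = t (x, y)"
        using simple_functionD(1)[OF t] p by simp
    qed
  qed
  show ?thesis
  proof (rule separable_sections_limit[OF simple[OF s(1)] sq])
    fix x assume x: "x \<in> space L"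
    note fx = sq[OF x]
    have [measurable]: "f x \<in> borel_measurable M" using fx by (rule sqint_measurable)
    have [measurable]: "(\<lambda>y. s i (x, y)) \<in> borel_measurable M" for i
      using measurable_Pair2[OF borel_measurable_simple_function[OF s(1)] x] .
    have p: "y \<in> space M \<Longrightarrow> (x, y) \<in> space (L \<Otimes>\<^sub>M M)" for y
      using x by (simp add: space_pair_measure)
    have "(\<lambda>n. LINT y|M. (s n (x, y) - f x y)\<^sup>2) \<longlonglongrightarrow> (LINT y|M. 0)"
    \<comment> \<open>The approximants are at most twice \<open>f\<close> in absolute value, so the
      error is at most three times \<open>f\<close>.\<close>
    proof (rule integral_dominated_convergence[where w = "\<lambda>y. 9 * (f x y)\<^sup>2"])
      show "AE y in M. (\<lambda>n. (s n (x, y) - f x y)\<^sup>2) \<longlonglongrightarrow> 0"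
      proof (rule AE_I2)
        fix y assume "y \<in> space M"
        then have "(\<lambda>n. (s n (x, y) - f x y)\<^sup>2) \<longlonglongrightarrow> (f x y - f x y)\<^sup>2"
          using s(2)[OF p] by (intro tendsto_intros) auto
        then show "(\<lambda>n. (s n (x, y) - f x y)\<^sup>2) \<longlonglongrightarrow> 0" by simp
      qed
      show "AE y in M. norm ((s n (x, y) - f x y)\<^sup>2) \<le> 9 * (f x y)\<^sup>2" for n
      proof (rule AE_I2)
        fix y assume "y \<in> space M"
        from s(3)[OF p[OF this], of n] have "\<bar>s n (x, y) - f x y\<bar> \<le> \<bar>3 * f x y\<bar>"
          by (auto simp: abs_mult dist_real_def)
        then have "(s n (x, y) - f x y)\<^sup>2 \<le> (3 * f x y)\<^sup>2"
          by (simp only: abs_le_square_iff)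
        then show "norm ((s n (x, y) - f x y)\<^sup>2) \<le> 9 * (f x y)\<^sup>2" by (simp add: power_mult_distrib)
      qed
    qed (use fx in \<open>auto simp: sqint_def\<close>)
    then show "(\<lambda>n. l2norm M (\<lambda>y. s n (x, y) - f x y)) \<longlonglongrightarrow> 0"
      unfolding l2norm_def using tendsto_real_sqrt by fastforce
  qed
qed

text \<open>The approximating values are themselves sections of \<open>f\<close>, so they lie in
  every set that contains the sections. Each centre of a ball of radius \<open>e / 2\<close> that
  meets the sections is exchanged for a section in it; taking the least admissible index makes the
  choice measurable.\<close>

lemma countable_valued_approximation:
  fixes f :: "'b \<Rightarrow> 'a \<Rightarrow> real"
  assumes f: "(\<lambda>(x, y). f x y) \<in> borel_measurable (L \<Otimes>\<^sub>M M)"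
    and sq: "\<And>x. x \<in> space L \<Longrightarrow> f x \<in> sqint M"
    and ne: "space L \<noteq> {}" and e: "0 < e"
  shows "\<exists>k c. k \<in> measurable L (count_space UNIV) \<and> (\<forall>n::nat. c n \<in> space L) \<and>
    (\<forall>x\<in>space L. l2norm M (\<lambda>y. f x y - f (c (k x)) y) < e)"
proof -
  obtain C where C: "countable C" "C \<subseteq> sqint M"
    "\<And>x e. x \<in> space L \<Longrightarrow> 0 < e \<Longrightarrow> \<exists>c\<in>C. l2norm M (\<lambda>y. f x y - c y) < e"
    using separable_sections_measurable[OF f sq] unfolding separable_sections_def by blast
  let ?near = "\<lambda>c x. x \<in> space L \<and> l2norm M (\<lambda>y. f x y - c y) < e / 2"
  define C' where "C' = {c \<in> C. \<exists>x. ?near c x}"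
  have C'_ne: "C' \<noteq> {}"
    using ne C(3)[of _ "e / 2"] e unfolding C'_def by fastforce
  have C'_count: "countable C'" using C(1) unfolding C'_def by simp
  define c where "c n = (SOME x. ?near (from_nat_into C' n) x)" for n
  have near: "?near (from_nat_into C' n) (c n)" for n
  proof -
    have "\<exists>x. ?near d x" if "d \<in> C'" for d using that by (simp add: C'_def)
    from this[OF from_nat_into[OF C'_ne]] show ?thesis unfolding c_def by (rule someI_ex)
  qed
  have ex: "\<exists>n. l2norm M (\<lambda>y. f x y - f (c n) y) < e" if x: "x \<in> space L" for x
  proof -
    obtain d where d: "d \<in> C" "l2norm M (\<lambda>y. f x y - d y) < e / 2"
      using C(3)[OF x, of "e / 2"] e by auto
    then have "d \<in> C'" using x unfolding C'_def by blast
    then obtain n where n: "d = from_nat_into C' n"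
      using from_nat_into_surj[OF C'_count] by metis
    have "l2norm M (\<lambda>y. f x y - f (c n) y)
        \<le> l2norm M (\<lambda>y. f x y - d y) + l2norm M (\<lambda>y. d y - f (c n) y)"
      using near[of n] x d(1) C(2) sq by (intro l2norm_triangle_diff) auto
    also have "\<dots> < e"
      using near[of n] d(2) l2norm_minus_commute[of M d "f (c n)"] unfolding n by simp
    finally show ?thesis by blast
  qed
  define k where "k x = (LEAST n. l2norm M (\<lambda>y. f x y - f (c n) y) < e)" for x
  have "k \<in> measurable L (count_space UNIV)"
  proof -
    have [measurable]: "(\<lambda>x. l2norm M (\<lambda>y. f x y - f (c n) y)) \<in> borel_measurable L" for n
    proof -
      note f[measurable]
      have [measurable]: "f (c n) \<in> borel_measurable M"
        using sq near[of n] by (auto intro: sqint_measurable)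
      show ?thesis unfolding l2norm_def by measurable
    qed
    show ?thesis unfolding k_def[abs_def] by measurable
  qed
  moreover have "l2norm M (\<lambda>y. f x y - f (c (k x)) y) < e" if "x \<in> space L" for x
    unfolding k_def by (rule LeastI_ex[OF ex[OF that]])
  ultimately show ?thesis using near by blast
qed

end


section \<open>The space of progressively measurable processes\<close>

locale process_space = P: prob_space P for P :: "'w measure" +
  fixes \<FF> :: "real \<Rightarrow> 'w measure" and Tm :: real
  assumes Tm_pos: "0 < Tm"
    and filtration_space: "\<And>t. t \<in> {0..Tm} \<Longrightarrow> space (\<FF> t) = space P"
    and filtration_sets: "\<And>t. t \<in> {0..Tm} \<Longrightarrow> sets (\<FF> t) \<subseteq> sets P"
begin

abbreviation V :: "'w process set" where "V \<equiv> proc_space P \<FF> Tm"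
abbreviation nrm :: "'w process \<Rightarrow> real" where "nrm \<equiv> proc_norm P Tm"
abbreviation inn :: "'w process \<Rightarrow> 'w process \<Rightarrow> real" where "inn \<equiv> proc_inner P Tm"

definition TT :: "real measure" where "TT = restrict_space lborel {0..Tm}"

text \<open>Time comes first, as in \<open>prof_space\<close>;
  \<open>progressively_measurable\<close> and \<open>graphon_aggregate\<close> use the opposite
  order of the factors.\<close>

definition Q :: "(real \<times> 'w) measure" where "Q = TT \<Otimes>\<^sub>M P"

definition pr :: "'w process \<Rightarrow> real \<times> 'w \<Rightarrow> real" where "pr a = (\<lambda>(t, \<omega>). a \<omega> t)"

lemma space_TT [simp]: "space TT = {0..Tm}"
  by (simp add: TT_def)

sublocale TT: finite_measure TT
  using Tm_pos by (intro finite_measureI) (simp add: TT_def emeasure_restrict_space)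

sublocale Q: finite_measure Q
  unfolding Q_def by (rule finite_measure_pair_measure) unfold_locales

lemma sets_TT: "sets TT = sets (restrict_space borel {0..Tm})"
  unfolding TT_def by (rule sets_restrict_space_cong) simp

lemma sets_Q: "sets Q = sets (restrict_space borel {0..Tm} \<Otimes>\<^sub>M P)"
  unfolding Q_def by (rule sets_pair_measure_cong) (simp_all add: sets_TT)

lemma pr_minus: "pr (a - b) = (\<lambda>p. pr a p - pr b p)"
  by (auto simp: pr_def)

lemma pr_plus: "pr (a + b) = (\<lambda>p. pr a p + pr b p)"
  by (auto simp: pr_def)

lemma pr_lincomb: "pr (\<lambda>\<omega> t. x * a \<omega> t + y * b \<omega> t) = (\<lambda>p. x * pr a p + y * pr b p)"
  by (auto simp: pr_def)

lemma progressive_measurable: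
  assumes "progressively_measurable \<FF> Tm a"
  shows "pr a \<in> borel_measurable Q"
proof -
  have T: "Tm \<in> {0..Tm}" using Tm_pos by simp
  have a: "(\<lambda>(\<omega>, s). a \<omega> s) \<in> borel_measurable (\<FF> Tm \<Otimes>\<^sub>M restrict_space borel {0..Tm})"
    using assms T unfolding progressively_measurable_def by blast
  have "(\<lambda>\<omega>. \<omega>) \<in> measurable P (\<FF> Tm)"
    using filtration_space[OF T] filtration_sets[OF T] by (auto simp: measurable_def)
  moreover have "(\<lambda>t. t) \<in> measurable TT (restrict_space borel {0..Tm})"
    by (rule measurable_ident_sets[OF sets_TT])
  ultimately have "(\<lambda>p. (snd p, fst p)) \<in> measurable Q (\<FF> Tm \<Otimes>\<^sub>M restrict_space borel {0..Tm})"
    unfolding Q_def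
    by (intro measurable_Pair measurable_compose[OF measurable_snd] measurable_compose[OF measurable_fst])
  from measurable_compose[OF this a] show ?thesis
    by (simp add: pr_def case_prod_beta)
qed

lemma nn_integral_Q:
  assumes "f \<in> borel_measurable Q"
  shows "(\<integral>\<^sup>+t\<in>{0..Tm}. (\<integral>\<^sup>+\<omega>. f (t, \<omega>) \<partial>P) \<partial>lborel) = (\<integral>\<^sup>+p. f p \<partial>Q)"
  using assms P.nn_integral_fst[of f TT] unfolding Q_def TT_def
  by (subst (asm) (1) nn_integral_restrict_space) auto

lemma V_iff: "a \<in> V \<longleftrightarrow> progressively_measurable \<FF> Tm a \<and> pr a \<in> sqint Q"
proof -
  have "(\<integral>\<^sup>+t\<in>{0..Tm}. (\<integral>\<^sup>+\<omega>. ennreal ((a \<omega> t)\<^sup>2) \<partial>P) \<partial>lborel) = (\<integral>\<^sup>+p. ennreal ((pr a p)\<^sup>2) \<partial>Q)"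
    if "pr a \<in> borel_measurable Q"
    using nn_integral_Q[of "\<lambda>p. ennreal ((pr a p)\<^sup>2)"] that by (simp add: pr_def)
  then show ?thesis
    using progressive_measurable[of a] by (auto simp: proc_space_def sqint_nn_integral)
qed

lemma V_sqint: "a \<in> V \<Longrightarrow> pr a \<in> sqint Q"
  by (simp add: V_iff)

lemma integral_Q:
  assumes "integrable Q f"
  shows "(LINT t:{0..Tm}|lborel. (LINT \<omega>|P. f (t, \<omega>))) = (LINT p|Q. f p :: real)"
proof -
  interpret TP: pair_sigma_finite TT P ..
  have "(LINT p|Q. f p) = (LINT t|TT. LINT \<omega>|P. f (t, \<omega>))"
    using TP.integral_fst'[of f] assms unfolding Q_def by simp
  also have "\<dots> = (LINT t:{0..Tm}|lborel. (LINT \<omega>|P. f (t, \<omega>)))"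
    unfolding TT_def set_lebesgue_integral_def by (subst integral_restrict_space) auto
  finally show ?thesis by simp
qed

lemma nrm_eq: "pr a \<in> sqint Q \<Longrightarrow> nrm a = l2norm Q (pr a)"
  using integral_Q[of "\<lambda>p. (pr a p)\<^sup>2"]
  by (simp add: proc_norm_def l2norm_def sqint_integrable_sq pr_def)

lemma inn_eq: "pr a \<in> sqint Q \<Longrightarrow> pr b \<in> sqint Q \<Longrightarrow> inn a b = l2inner Q (pr a) (pr b)"
  using integral_Q[of "\<lambda>p. pr a p * pr b p"]
  by (simp add: proc_inner_def l2inner_def sqint_mult_integrable pr_def)

lemma nrm_nonneg [simp]: "0 \<le> nrm a"
  unfolding proc_norm_def set_lebesgue_integral_def
  by (intro real_sqrt_ge_zero Bochner_Integration.integral_nonneg) simp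

lemma nrm_sq: "(nrm a)\<^sup>2 = (LINT t:{0..Tm}|lborel. (LINT \<omega>|P. (a \<omega> t)\<^sup>2))"
  unfolding proc_norm_def set_lebesgue_integral_def
  by (intro real_sqrt_pow2 Bochner_Integration.integral_nonneg) simp

lemma V_lincomb:
  assumes "a \<in> V" "b \<in> V"
  shows "(\<lambda>\<omega> t. x * a \<omega> t + y * b \<omega> t) \<in> V"
proof -
  have "progressively_measurable \<FF> Tm (\<lambda>\<omega> t. x * a \<omega> t + y * b \<omega> t)"
    unfolding progressively_measurable_def case_prod_beta
  proof
    fix t assume "t \<in> {0..Tm}"
    then have [measurable]:
      "(\<lambda>p. a (fst p) (snd p)) \<in> borel_measurable (\<FF> t \<Otimes>\<^sub>M restrict_space borel {0..t})"
      "(\<lambda>p. b (fst p) (snd p)) \<in> borel_measurable (\<FF> t \<Otimes>\<^sub>M restrict_space borel {0..t})"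
      using assms unfolding V_iff progressively_measurable_def case_prod_beta by auto
    show "(\<lambda>p. x * a (fst p) (snd p) + y * b (fst p) (snd p))
        \<in> borel_measurable (\<FF> t \<Otimes>\<^sub>M restrict_space borel {0..t})"
      by measurable
  qed
  then show ?thesis
    using assms unfolding V_iff pr_lincomb by (auto intro: sqint_lincomb)
qed

lemma V_diff: "a \<in> V \<Longrightarrow> b \<in> V \<Longrightarrow> a - b \<in> V"
  using V_lincomb[of a b 1 "-1"] by (simp add: fun_diff_def)

lemma V_add: "a \<in> V \<Longrightarrow> b \<in> V \<Longrightarrow> a + b \<in> V"
  using V_lincomb[of a b 1 1] by (simp add: plus_fun_def)

lemma V_const: "(\<lambda>\<omega> t. c) \<in> V"
proof -
  have "pr (\<lambda>\<omega> t. c) = (\<lambda>p. c)" by (auto simp: pr_def)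
  then show ?thesis
    using Q.sqint_const by (auto simp: V_iff progressively_measurable_def case_prod_beta)
qed

lemma nrm_const: "nrm (\<lambda>\<omega> t. c) = \<bar>c\<bar> * sqrt Tm"
  using Tm_pos by (simp add: proc_norm_def P.prob_space set_lebesgue_integral_def real_sqrt_mult)

lemma nrm_diff: "a \<in> V \<Longrightarrow> b \<in> V \<Longrightarrow> nrm (a - b) = l2norm Q (\<lambda>p. pr a p - pr b p)"
  using nrm_eq[of "a - b"] V_sqint[OF V_diff[of a b]] by (simp add: pr_minus)

lemma nrm_zero [simp]: "nrm 0 = 0"
  by (simp add: proc_norm_def set_lebesgue_integral_def)

lemma nrm_minus_commute: "nrm (a - b) = nrm (b - a)"
  by (simp add: proc_norm_def power2_commute)

lemma nrm_lincomb_sq: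
  assumes "a \<in> V" "b \<in> V"
  shows "(nrm (\<lambda>\<omega> t. x * a \<omega> t + y * b \<omega> t))\<^sup>2
    = x\<^sup>2 * (nrm a)\<^sup>2 + 2 * x * y * inn a b + y\<^sup>2 * (nrm b)\<^sup>2"
  using l2norm_lincomb_sq[OF V_sqint[OF assms(1)] V_sqint[OF assms(2)], of x y]
    nrm_eq[OF V_sqint[OF V_lincomb[OF assms]]] assms
  by (simp add: nrm_eq inn_eq V_sqint pr_lincomb)

lemma nrm_scale: "nrm (\<lambda>\<omega> t. x * a \<omega> t) = \<bar>x\<bar> * nrm a"
  by (simp add: proc_norm_def power_mult_distrib set_lebesgue_integral_def mult.left_commute real_sqrt_mult)

lemma nrm_triangle: "a \<in> V \<Longrightarrow> b \<in> V \<Longrightarrow> c \<in> V \<Longrightarrow> nrm (a - c) \<le> nrm (a - b) + nrm (b - c)"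
  by (simp add: nrm_diff l2norm_triangle_diff V_sqint)

lemma nrm_triangle_add: "a \<in> V \<Longrightarrow> b \<in> V \<Longrightarrow> nrm (a + b) \<le> nrm a + nrm b"
  using nrm_eq[of "a + b"] V_sqint[OF V_add[of a b]] l2norm_triangle[OF V_sqint[of a] V_sqint[of b]]
  by (simp add: pr_plus nrm_eq V_sqint)

lemma nrm_le_add_diff: "a \<in> V \<Longrightarrow> b \<in> V \<Longrightarrow> nrm a \<le> nrm b + nrm (a - b)"
  using l2norm_le_add_diff[OF V_sqint[of a] V_sqint[of b]] by (simp add: nrm_diff nrm_eq V_sqint)

lemma inn_le: "a \<in> V \<Longrightarrow> b \<in> V \<Longrightarrow> inn a b \<le> nrm a * nrm b"
  using l2_Cauchy_Schwarz[OF V_sqint[of a] V_sqint[of b]] by (simp add: inn_eq nrm_eq V_sqint)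

lemma inn_diff_left: "a \<in> V \<Longrightarrow> b \<in> V \<Longrightarrow> c \<in> V \<Longrightarrow> inn (a - b) c = inn a c - inn b c"
  using sqint_mult_integrable[OF V_sqint[of a] V_sqint[of c]] sqint_mult_integrable[OF V_sqint[of b] V_sqint[of c]]
    V_sqint[OF V_diff[of a b]]
  by (simp add: inn_eq V_sqint pr_minus l2inner_def left_diff_distrib)

text \<open>
  A divergent sequence has a fixed (unspecified) \<^const>\<open>lim\<close>, so \<open>plim\<close> is measurable for
  every sigma-algebra for which all terms are; this makes \<open>plim\<close> progressively measurable.
\<close>

definition plim :: "(nat \<Rightarrow> 'w process) \<Rightarrow> 'w process" where
  "plim b \<omega> t = lim (\<lambda>n. b n \<omega> t)"

lemma V_fast_limit:
  assumes b: "\<And>n. b n \<in> V" and step: "\<And>n. nrm (b (Suc n) - b n) \<le> c n" and c: "summable c"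
  shows "plim b \<in> V" and "nrm (b n - plim b) \<le> (\<Sum>i. c (i + n))"
    and "(\<lambda>n. nrm (b n - plim b)) \<longlonglongrightarrow> 0"
proof -
  have pl: "pr (plim b) = (\<lambda>p. lim (\<lambda>n. pr (b n) p))"
    by (auto simp: pr_def plim_def)
  have st: "l2norm Q (\<lambda>p. pr (b (Suc n)) p - pr (b n) p) \<le> c n" for n
    using step[of n] by (simp add: nrm_diff b)
  note lim = Q.l2_fast_limit[OF V_sqint[OF b] st c]
  have "progressively_measurable \<FF> Tm (plim b)"
    unfolding progressively_measurable_def case_prod_beta plim_def
    using b unfolding V_iff progressively_measurable_def case_prod_beta
    by (auto intro!: borel_measurable_lim_metric)
  then show pV: "plim b \<in> V"
    unfolding V_iff pl using lim(2) by simp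
  show le: "nrm (b n - plim b) \<le> (\<Sum>i. c (i + n))" for n
    using lim(3)[of n] by (simp add: nrm_diff b pV pl)
  show "(\<lambda>n. nrm (b n - plim b)) \<longlonglongrightarrow> 0"
    by (rule tendsto_sandwich[OF _ _ tendsto_const tendsto_tail_suminf[OF c]]) (auto simp: le)
qed

text \<open>Progressive processes form a closed subspace of L2: the limit of fast converging
  progressive approximants can be taken as \<open>plim\<close>, which is again progressive. This
  supplies representatives of integrals of profiles.\<close>

lemma progressive_version:
  assumes z: "z \<in> sqint Q" and approx: "\<And>e. 0 < e \<Longrightarrow> \<exists>b\<in>V. l2norm Q (\<lambda>p. pr b p - z p) < e"
  shows "\<exists>z'\<in>V. AE p in Q. pr z' p = z p"
proof -
  have "\<forall>n::nat. \<exists>b\<in>V. l2norm Q (\<lambda>p. pr b p - z p) < (1/2)^n"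
    using approx by simp
  then obtain b where b: "\<And>n::nat. b n \<in> V" "\<And>n. l2norm Q (\<lambda>p. pr (b n) p - z p) < (1/2)^n"
    by metis
  have step: "nrm (b (Suc n) - b n) \<le> 2 * (1/2)^n" for n
  proof -
    have "nrm (b (Suc n) - b n)
        \<le> l2norm Q (\<lambda>p. pr (b (Suc n)) p - z p) + l2norm Q (\<lambda>p. z p - pr (b n) p)"
      using l2norm_triangle_diff[OF V_sqint[OF b(1)[of "Suc n"]] z V_sqint[OF b(1)[of n]]]
      by (simp add: nrm_diff b(1))
    also have "\<dots> \<le> (1/2)^Suc n + (1/2)^n"
      using b(2)[of "Suc n"] b(2)[of n] l2norm_minus_commute[of Q z "pr (b n)"] by simp
    also have "\<dots> \<le> 2 * (1/2)^n"
      unfolding power_Suc using zero_le_power[of "1/2 :: real" n] by linarith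
    finally show ?thesis .
  qed
  have s: "summable (\<lambda>n. 2 * (1/2)^n :: real)" by (intro summable_mult summable_geometric) simp
  note lim = V_fast_limit[OF b(1) step s]
  have "l2norm Q (\<lambda>p. pr (plim b) p - z p) \<le> nrm (b n - plim b) + (1/2)^n" for n
  proof -
    have "l2norm Q (\<lambda>p. pr (plim b) p - z p)
        \<le> l2norm Q (\<lambda>p. pr (plim b) p - pr (b n) p) + l2norm Q (\<lambda>p. pr (b n) p - z p)"
      by (intro l2norm_triangle_diff V_sqint lim(1) b(1) z)
    then show ?thesis
      using b(2)[of n] by (simp add: nrm_minus_commute[of "b n"] nrm_diff lim(1) b(1))
  qed
  moreover have "(\<lambda>n. nrm (b n - plim b) + (1/2)^n) \<longlonglongrightarrow> 0 + 0"
    by (intro tendsto_add lim(3) LIMSEQ_power_zero) simp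
  ultimately have "l2norm Q (\<lambda>p. pr (plim b) p - z p) \<le> 0"
    using LIMSEQ_le_const by fastforce
  then have "l2norm Q (\<lambda>p. pr (plim b) p - z p) = 0" by (simp add: order_antisym)
  then have "AE p in Q. pr (plim b) p - z p = 0"
    using l2norm_eq_0_iff[OF sqint_diff[OF V_sqint[OF lim(1)] z]] by simp
  then show ?thesis using lim(1) by (intro bexI[of _ "plim b"]) auto
qed

end

section \<open>Best responses\<close>

locale best_response = process_space P \<FF> Tm for P :: "'w measure" and \<FF> Tm +
  fixes U :: "'w utility" and A :: "'w process set" and D :: "'w process \<Rightarrow> 'w process \<Rightarrow> 'w process \<Rightarrow> 'w process"
    and \<alpha> l\<^sub>U l\<^sub>\<theta> M \<Lambda> :: real
  assumes U_functional: "utility_functional P \<FF> Tm U"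
    and A_sub: "A \<subseteq> V"
    and A_ne: "A \<noteq> {}"
    and A_convex: "proc_convex A"
    and A_closed: "proc_closed P \<FF> Tm A"
    and A_bounded: "\<And>a. a \<in> A \<Longrightarrow> nrm a \<le> M"
    and D_gradient: "\<And>a z \<eta>. a \<in> V \<Longrightarrow> z \<in> V \<Longrightarrow> \<eta> \<in> V
      \<Longrightarrow> gateaux_gradient P \<FF> Tm (\<lambda>a. U a z \<eta>) a (D a z \<eta>)"
    and D_lipschitz: "\<And>a z \<eta> z' \<eta>'. a \<in> V \<Longrightarrow> z \<in> V \<Longrightarrow> \<eta> \<in> V
      \<Longrightarrow> z' \<in> V \<Longrightarrow> \<eta>' \<in> V
      \<Longrightarrow> nrm (D a z \<eta> - D a z' \<eta>')
               \<le> l\<^sub>U * nrm (z - z') + l\<^sub>\<theta> * nrm (\<eta> - \<eta>')"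
    and \<alpha>_pos: "0 < \<alpha>"
    and U_concave: "\<And>z \<eta>. z \<in> V \<Longrightarrow> \<eta> \<in> V
      \<Longrightarrow> proc_concave P \<FF> Tm (\<lambda>a. U a z \<eta> + \<alpha> / 2 * (nrm a)\<^sup>2)"
    and \<Lambda>_nonneg: "0 \<le> \<Lambda>"
    and U_lipschitz: "\<And>a a' z z' \<eta> \<eta>'. a \<in> A \<Longrightarrow> a' \<in> A
      \<Longrightarrow> z \<in> V \<Longrightarrow> z' \<in> V
      \<Longrightarrow> \<eta> \<in> V \<Longrightarrow> \<eta>' \<in> V
      \<Longrightarrow> \<bar>U a z \<eta> - U a' z' \<eta>'\<bar>
          \<le> \<Lambda> * (nrm (a - a') + nrm (z - z') + nrm (\<eta> - \<eta>'))"
begin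

lemma A_V: "a \<in> A \<Longrightarrow> a \<in> V"
  using A_sub by blast

lemma M_nonneg: "0 \<le> M"
  using A_ne A_bounded order_trans[OF nrm_nonneg] by blast

lemma l\<^sub>U_nonneg: "0 \<le> l\<^sub>U"
proof -
  obtain a where a: "a \<in> V" using A_ne A_V by blast
  \<comment> \<open>Testing the Lipschitz bound on the constants 1 and 0, whose distance is
    \<open>sqrt Tm > 0\<close>, forces the constant to be nonnegative.\<close>
  let ?z = "\<lambda>(\<omega>::'w) (t::real). 1 :: real"
  have "0 \<le> l\<^sub>U * nrm (?z - (\<lambda>\<omega> t. 0)) + l\<^sub>\<theta> * nrm (?z - ?z)"
    by (rule order_trans[OF nrm_nonneg D_lipschitz[OF a V_const V_const V_const V_const]])
  moreover have "?z - (\<lambda>\<omega> t. 0) = ?z" by (simp add: fun_diff_def)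
  ultimately show ?thesis
    using Tm_pos by (simp add: nrm_const zero_le_mult_iff)
qed

lemma l\<^sub>\<theta>_nonneg: "0 \<le> l\<^sub>\<theta>"
proof -
  obtain a where a: "a \<in> V" using A_ne A_V by blast
  let ?z = "\<lambda>(\<omega>::'w) (t::real). 1 :: real"
  have "0 \<le> l\<^sub>U * nrm (?z - ?z) + l\<^sub>\<theta> * nrm (?z - (\<lambda>\<omega> t. 0))"
    by (rule order_trans[OF nrm_nonneg D_lipschitz[OF a V_const V_const V_const V_const]])
  moreover have "?z - (\<lambda>\<omega> t. 0) = ?z" by (simp add: fun_diff_def)
  ultimately show ?thesis
    using Tm_pos by (simp add: nrm_const zero_le_mult_iff)
qed


lemma A_limit: "(\<And>n. b n \<in> A) \<Longrightarrow> a \<in> V \<Longrightarrow> (\<lambda>n::nat. nrm (b n - a)) \<longlonglongrightarrow> 0 \<Longrightarrow> a \<in> A"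
  using A_closed unfolding proc_closed_def by blast

lemma A_equiv: "a \<in> A \<Longrightarrow> b \<in> V \<Longrightarrow> nrm (a - b) = 0 \<Longrightarrow> b \<in> A"
  using A_limit[of "\<lambda>_. a" b] by simp

lemma U_equiv:
  assumes "a \<in> V" "a' \<in> V" "z \<in> V" "z' \<in> V" "\<eta> \<in> V" "\<eta>' \<in> V"
    and "nrm (a - a') = 0" "nrm (z - z') = 0" "nrm (\<eta> - \<eta>') = 0"
  shows "U a z \<eta> = U a' z' \<eta>'"
  using U_functional assms unfolding utility_functional_def by blast

definition best :: "'w process \<Rightarrow> 'w process \<Rightarrow> 'w process \<Rightarrow> bool" where
  "best z \<eta> a \<longleftrightarrow> is_arg_max (\<lambda>b. U b z \<eta>) (\<lambda>b. b \<in> A) a"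

lemma best_iff: "best z \<eta> a \<longleftrightarrow> a \<in> A \<and> (\<forall>b\<in>A. U b z \<eta> \<le> U a z \<eta>)"
  by (auto simp: best_def is_arg_max_linorder)

lemma best_A: "best z \<eta> a \<Longrightarrow> a \<in> A" and best_V: "best z \<eta> a \<Longrightarrow> a \<in> V"
  using A_V by (auto simp: best_iff)

lemma best_equiv:
  assumes "best z \<eta> a" "a' \<in> V" "z \<in> V" "z' \<in> V" "\<eta> \<in> V" "\<eta>' \<in> V"
    and "nrm (a - a') = 0" "nrm (z - z') = 0" "nrm (\<eta> - \<eta>') = 0"
  shows "best z' \<eta>' a'"
proof -
  have a: "a \<in> A" "a \<in> V" using assms(1) by (auto intro: best_A best_V)
  have "U b z \<eta> = U b z' \<eta>'" if "b \<in> A" for b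
    using that assms A_V by (intro U_equiv) auto
  moreover have "U a z \<eta> = U a' z' \<eta>'"
    using a assms by (intro U_equiv) auto
  ultimately show ?thesis
    using assms(1) A_equiv[OF a(1) assms(2,7)] unfolding best_iff by metis
qed

text \<open>For a convex combination \<open>m\<close> of \<open>a\<close> and \<open>b\<close> with
  weights \<open>1 - s\<close> and \<open>s\<close>, the convex combination of the squared norms
  exceeds the squared norm of \<open>m\<close> by exactly \<open>s * (1 - s)\<close> times the
  squared distance of \<open>a\<close> and \<open>b\<close>.\<close>

lemma U_strongly_concave:
  assumes "a \<in> V" "b \<in> V" "z \<in> V" "\<eta> \<in> V" "s \<in> {0..1}"
  shows "(1 - s) * U a z \<eta> + s * U b z \<eta> + \<alpha> / 2 * (s * (1 - s)) * (nrm (a - b))\<^sup>2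
    \<le> U (\<lambda>\<omega> t. (1 - s) * a \<omega> t + s * b \<omega> t) z \<eta>"
proof -
  let ?m = "\<lambda>\<omega> t. (1 - s) * a \<omega> t + s * b \<omega> t"
  have le: "(1 - s) * (U a z \<eta> + \<alpha> / 2 * (nrm a)\<^sup>2) + s * (U b z \<eta> + \<alpha> / 2 * (nrm b)\<^sup>2)
      \<le> U ?m z \<eta> + \<alpha> / 2 * (nrm ?m)\<^sup>2"
    using U_concave[OF assms(3,4)] assms unfolding proc_concave_def by blast
  have "(nrm ?m)\<^sup>2 = (1 - s)\<^sup>2 * (nrm a)\<^sup>2 + 2 * (1 - s) * s * inn a b + s\<^sup>2 * (nrm b)\<^sup>2"
    by (rule nrm_lincomb_sq[OF assms(1,2)])
  moreover have "(nrm (a - b))\<^sup>2 = (nrm a)\<^sup>2 - 2 * inn a b + (nrm b)\<^sup>2"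
    using nrm_lincomb_sq[OF assms(1,2), of 1 "-1"] by (simp add: fun_diff_def)
  moreover have "(1 - s) * x + s * y - ((1 - s)\<^sup>2 * x + 2 * (1 - s) * s * i + s\<^sup>2 * y)
      = s * (1 - s) * (x - 2 * i + y)" for x y i :: real
    by (simp add: power2_eq_square algebra_simps)
  ultimately have "(1 - s) * (nrm a)\<^sup>2 + s * (nrm b)\<^sup>2 - (nrm ?m)\<^sup>2 = s * (1 - s) * (nrm (a - b))\<^sup>2"
    by simp
  then have "\<alpha> / 2 * (s * (1 - s)) * (nrm (a - b))\<^sup>2
      = \<alpha> / 2 * ((1 - s) * (nrm a)\<^sup>2 + s * (nrm b)\<^sup>2 - (nrm ?m)\<^sup>2)"
    by simp
  with le show ?thesis
    by (simp add: distrib_left right_diff_distrib mult.left_commute)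
qed

lemma nrm_diff_A: "a \<in> A \<Longrightarrow> b \<in> A \<Longrightarrow> nrm (a - b) \<le> 2 * M"
proof -
  assume a: "a \<in> A" "b \<in> A"
  have "nrm (a - b) \<le> nrm (a - (\<lambda>\<omega> t. 0)) + nrm ((\<lambda>\<omega> t. 0) - b)"
    using a by (intro nrm_triangle A_V V_const)
  also have "nrm ((\<lambda>\<omega> t. 0) - b) = nrm (b - (\<lambda>\<omega> t. 0))" by (rule nrm_minus_commute)
  finally show ?thesis using A_bounded[OF a(1)] A_bounded[OF a(2)] by (simp add: fun_diff_def)
qed

text \<open>The direct method without weak compactness: by strong concavity the midpoint of two
  almost optimal actions would beat the supremum if they were far apart, so a maximizing sequence is
  Cauchy.\<close>

lemma best_exists:
  assumes z: "z \<in> V" and \<eta>: "\<eta> \<in> V"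
  shows "\<exists>a. best z \<eta> a"
proof -
  obtain a0 where a0: "a0 \<in> A" using A_ne by blast
  let ?f = "\<lambda>a. U a z \<eta>"
  have bdd: "bdd_above (?f ` A)"
  proof (rule bdd_aboveI2)
    fix a assume a: "a \<in> A"
    have "?f a \<le> ?f a0 + \<Lambda> * (nrm (a - a0) + nrm (z - z) + nrm (\<eta> - \<eta>))"
      using abs_le_D1[OF U_lipschitz[OF a a0 z z \<eta> \<eta>]] by simp
    also have "\<dots> \<le> ?f a0 + \<Lambda> * (2 * M)"
      using nrm_diff_A[OF a a0] \<Lambda>_nonneg by (simp add: mult_left_mono)
    finally show "?f a \<le> ?f a0 + \<Lambda> * (2 * M)" .
  qed
  define S where "S = Sup (?f ` A)"
  have upper: "?f a \<le> S" if "a \<in> A" for a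
    unfolding S_def using bdd that by (rule cSUP_upper2[OF _ _ order_refl])
  have "\<exists>a\<in>A. S - (1/4)^n < ?f a" for n :: nat
    using less_cSUP_iff[OF A_ne bdd, of "S - (1/4)^n"] unfolding S_def by simp
  then obtain b where b: "\<And>n::nat. b n \<in> A" "\<And>n. S - (1/4)^n < ?f (b n)" by metis
  \<comment> \<open>At midpoints the concavity gain is \<open>\<alpha> / 8\<close> times the squared
    distance. Tolerances \<open>(1/4)^n\<close> therefore allow steps of order
    \<open>(1/2)^n\<close>, which are summable.\<close>
  have step: "nrm (b (Suc n) - b n) \<le> sqrt (8 / \<alpha>) * (1/2)^n" for n
  proof -
    let ?m = "\<lambda>\<omega> t. (1 - 1/2) * b (Suc n) \<omega> t + 1/2 * b n \<omega> t"
    have "\<forall>s\<in>{0..1}. (\<lambda>\<omega> t. (1 - s) * b (Suc n) \<omega> t + s * b n \<omega> t) \<in> A"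
      using A_convex b(1)[of n] b(1)[of "Suc n"] unfolding proc_convex_def by blast
    from bspec[OF this, of "1/2"] have "?m \<in> A" by simp
    then have h1: "?f ?m \<le> S" by (rule upper)
    have h2: "(1 - 1/2) * ?f (b (Suc n)) + 1/2 * ?f (b n) + \<alpha> / 2 * (1/2 * (1 - 1/2)) * (nrm (b (Suc n) - b n))\<^sup>2 \<le> ?f ?m"
      using b(1) A_V z \<eta> by (intro U_strongly_concave) auto
    have h3: "x \<le> q"
      if "u \<le> S" "(1 - 1/2) * v + 1/2 * w + x \<le> u" "S - q < w" "S - q / 4 < v" "0 \<le> q"
      for x q u v w :: real
      using that by argo
    have h4: "S - (1/4)^n / 4 < ?f (b (Suc n))" "0 \<le> (1/4 :: real)^n"
      using b(2)[of "Suc n"] by simp_all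
    from h3[OF h1 h2 b(2)[of n] h4] have "\<alpha> / 8 * (nrm (b (Suc n) - b n))\<^sup>2 \<le> (1/4)^n"
      by simp
    then have "(nrm (b (Suc n) - b n))\<^sup>2 \<le> 8 / \<alpha> * (1/4)^n"
      using \<alpha>_pos by (simp add: pos_le_divide_eq mult.commute)
    also have "(1/4)^n = ((1/2)^n * (1/2)^n :: real)"
      unfolding power_mult_distrib[symmetric] by simp
    also have "8 / \<alpha> * ((1/2)^n * (1/2)^n) = (sqrt (8 / \<alpha>) * (1/2)^n)\<^sup>2"
      using \<alpha>_pos unfolding power_mult_distrib by (simp add: power2_eq_square)
    finally show ?thesis
      by (rule power2_le_imp_le) (use \<alpha>_pos in simp)
  qed
  have s: "summable (\<lambda>n. sqrt (8 / \<alpha>) * (1/2)^n)" by (intro summable_mult summable_geometric) simp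
  note lim = V_fast_limit[OF A_V[OF b(1)] step s]
  have pA: "plim b \<in> A" by (rule A_limit[OF b(1) lim(1) lim(3)])
  have "S \<le> ?f (plim b)"
  proof (rule LIMSEQ_le_const2[of "\<lambda>n. S - (1/4)^n - \<Lambda> * nrm (b n - plim b)"])
    have "(\<lambda>n. S - (1/4)^n - \<Lambda> * nrm (b n - plim b)) \<longlonglongrightarrow> S - 0 - \<Lambda> * 0"
      by (intro tendsto_intros lim(3) LIMSEQ_power_zero) simp
    then show "(\<lambda>n. S - (1/4)^n - \<Lambda> * nrm (b n - plim b)) \<longlonglongrightarrow> S" by simp
    have "S - (1/4)^n - \<Lambda> * nrm (b n - plim b) \<le> ?f (plim b)" for n
      using abs_le_D1[OF U_lipschitz[OF b(1)[of n] pA z z \<eta> \<eta>]] b(2)[of n] by simp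
    then show "\<exists>N. \<forall>n\<ge>N. S - (1/4)^n - \<Lambda> * nrm (b n - plim b) \<le> ?f (plim b)" by blast
  qed
  then show ?thesis
    using pA upper unfolding best_iff by (intro exI[of _ "plim b"]) (auto intro: order_trans)
qed

section \<open>First-order conditions and dependence of best responses on the data\<close>

lemma derivative_nonpos_at_max:
  fixes \<phi> :: "real \<Rightarrow> real"
  assumes "(\<phi> has_real_derivative l) (at 0)" "\<And>e. 0 \<le> e \<Longrightarrow> e \<le> 1 \<Longrightarrow> \<phi> e \<le> \<phi> 0"
  shows "l \<le> 0"
proof (rule ccontr)
  assume "\<not> l \<le> 0"
  then obtain d where d: "0 < d" "\<And>h. 0 < h \<Longrightarrow> h < d \<Longrightarrow> \<phi> 0 < \<phi> (0 + h)"
    using DERIV_pos_inc_right[OF assms(1)] by auto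
  have "0 < min 1 (d / 2)" "min 1 (d / 2) < d" "min 1 (d / 2) \<le> 1"
    using d(1) by (auto simp: min_def)
  then show False using d(2)[of "min 1 (d / 2)"] assms(2)[of "min 1 (d / 2)"] by simp
qed

lemma gradient_direction:
  assumes "a \<in> V" "b \<in> V" "z \<in> V" "\<eta> \<in> V"
  shows "((\<lambda>e. U (\<lambda>\<omega> t. (1 - e) * a \<omega> t + e * b \<omega> t) z \<eta>) has_real_derivative inn (D a z \<eta>) (b - a)) (at 0)"
proof -
  have "((\<lambda>e. U (\<lambda>\<omega> t. a \<omega> t + e * (b - a) \<omega> t) z \<eta>) has_real_derivative inn (D a z \<eta>) (b - a)) (at 0)"
    using D_gradient[OF assms(1,3,4)] V_diff[OF assms(2,1)] unfolding gateaux_gradient_def by blast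
  moreover have "(\<lambda>\<omega> t. a \<omega> t + e * (b - a) \<omega> t) = (\<lambda>\<omega> t. (1 - e) * a \<omega> t + e * b \<omega> t)" for e
    by (simp add: algebra_simps)
  ultimately show ?thesis by simp
qed

lemma variational_inequality:
  assumes "best z \<eta> a" "b \<in> A" "z \<in> V" "\<eta> \<in> V"
  shows "inn (D a z \<eta>) (b - a) \<le> 0"
proof (rule derivative_nonpos_at_max[OF gradient_direction])
  fix e :: real assume "0 \<le> e" "e \<le> 1"
  then have "(\<lambda>\<omega> t. (1 - e) * a \<omega> t + e * b \<omega> t) \<in> A"
    using A_convex best_A[OF assms(1)] assms(2) unfolding proc_convex_def by auto
  then show "U (\<lambda>\<omega> t. (1 - e) * a \<omega> t + e * b \<omega> t) z \<eta> \<le> U (\<lambda>\<omega> t. (1 - 0) * a \<omega> t + 0 * b \<omega> t) z \<eta>"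
    using assms(1) unfolding best_iff by simp
qed (use assms A_V best_V in auto)

text \<open>The defect \<open>?\<psi>\<close> in the strong concavity inequality vanishes at 0 and
  is nonpositive on [0,1], so its derivative at 0 is nonpositive; that derivative is the difference
  of the two sides.\<close>

lemma gradient_strongly_concave:
  assumes "a \<in> V" "b \<in> V" "z \<in> V" "\<eta> \<in> V"
  shows "U b z \<eta> - U a z \<eta> + \<alpha> / 2 * (nrm (a - b))\<^sup>2 \<le> inn (D a z \<eta>) (b - a)"
proof -
  let ?u = "\<lambda>e. U (\<lambda>\<omega> t. (1 - e) * a \<omega> t + e * b \<omega> t) z \<eta>"
  let ?\<psi> = "\<lambda>e. (1 - e) * U a z \<eta> + e * U b z \<eta> + \<alpha> / 2 * (e * (1 - e)) * (nrm (a - b))\<^sup>2 - ?u e"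
  have "(?\<psi> has_real_derivative
      - U a z \<eta> + U b z \<eta> + \<alpha> / 2 * (nrm (a - b))\<^sup>2 - inn (D a z \<eta>) (b - a)) (at 0)"
    by (rule derivative_eq_intros gradient_direction assms refl)+ simp
  then have "- U a z \<eta> + U b z \<eta> + \<alpha> / 2 * (nrm (a - b))\<^sup>2 - inn (D a z \<eta>) (b - a) \<le> 0"
  proof (rule derivative_nonpos_at_max)
    fix e :: real assume "0 \<le> e" "e \<le> 1"
    then show "?\<psi> e \<le> ?\<psi> 0" using U_strongly_concave[OF assms, of e] by simp
  qed
  then show ?thesis by simp
qed

text \<open>Strong monotonicity: \<open>gradient_strongly_concave\<close> in both directions bounds
  \<open>\<alpha>\<close> times the squared distance by gradients at the data
  \<open>(z, \<eta>)\<close>. The two variational inequalities leave only the change of the gradient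
  at \<open>a'\<close> under the change of data. Equal data give uniqueness up to norm zero.\<close>

lemma best_lipschitz:
  assumes a: "best z \<eta> a" and a': "best z' \<eta>' a'"
    and V: "z \<in> V" "\<eta> \<in> V" "z' \<in> V" "\<eta>' \<in> V"
  shows "\<alpha> * nrm (a - a') \<le> l\<^sub>U * nrm (z - z') + l\<^sub>\<theta> * nrm (\<eta> - \<eta>')"
proof (cases "nrm (a - a') = 0")
  case True
  then show ?thesis using l\<^sub>U_nonneg l\<^sub>\<theta>_nonneg by simp
next
  case False
  then have pos: "0 < nrm (a - a')" using nrm_nonneg[of "a - a'"] by linarith
  note aV = best_V[OF a] best_V[OF a'] and aA = best_A[OF a] best_A[OF a']
  have DV: "D x y w \<in> V" if "x \<in> V" "y \<in> V" "w \<in> V" for x y w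
    using D_gradient[OF that] unfolding gateaux_gradient_def by blast
  have "\<alpha> * (nrm (a - a'))\<^sup>2 \<le> inn (D a z \<eta>) (a' - a) + inn (D a' z \<eta>) (a - a')"
    using gradient_strongly_concave[OF aV V(1,2)] gradient_strongly_concave[OF aV(2,1) V(1,2)]
    by (simp add: nrm_minus_commute[of a' a])
  also have "\<dots> \<le> inn (D a' z \<eta>) (a - a') - inn (D a' z' \<eta>') (a - a')"
    using variational_inequality[OF a aA(2) V(1,2)] variational_inequality[OF a' aA(1) V(3,4)] by simp
  also have "\<dots> = inn (D a' z \<eta> - D a' z' \<eta>') (a - a')"
    using aV V by (intro inn_diff_left[symmetric] DV V_diff)
  also have "\<dots> \<le> nrm (D a' z \<eta> - D a' z' \<eta>') * nrm (a - a')"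
    using aV V by (intro inn_le V_diff DV)
  also have "\<dots> \<le> (l\<^sub>U * nrm (z - z') + l\<^sub>\<theta> * nrm (\<eta> - \<eta>')) * nrm (a - a')"
    using D_lipschitz[OF aV(2) V] by (rule mult_right_mono) simp
  finally have "(\<alpha> * nrm (a - a')) * nrm (a - a')
      \<le> (l\<^sub>U * nrm (z - z') + l\<^sub>\<theta> * nrm (\<eta> - \<eta>')) * nrm (a - a')"
    by (simp add: power2_eq_square mult.assoc)
  then show ?thesis using pos by simp
qed

text \<open>A best response \<open>a'\<close> to the limiting data exists, and the Lipschitz
  estimate shows that \<open>b n\<close> converges to it as well; so \<open>a\<close> and
  \<open>a'\<close> are the same element.\<close>

lemma best_limit:
  assumes b: "\<And>n::nat. best (z n) (\<eta> n) (b n)"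
    and V: "\<And>n. z n \<in> V" "\<And>n. \<eta> n \<in> V" "z' \<in> V" "\<eta>' \<in> V" "a \<in> V"
    and lim: "(\<lambda>n. nrm (z n - z')) \<longlonglongrightarrow> 0" "(\<lambda>n. nrm (\<eta> n - \<eta>')) \<longlonglongrightarrow> 0" "(\<lambda>n. nrm (b n - a)) \<longlonglongrightarrow> 0"
  shows "best z' \<eta>' a"
proof -
  obtain a' where a': "best z' \<eta>' a'" using best_exists[OF V(3,4)] by blast
  have "\<alpha> * nrm (a' - a) \<le> l\<^sub>U * nrm (z n - z') + l\<^sub>\<theta> * nrm (\<eta> n - \<eta>') + \<alpha> * nrm (b n - a)" for n
  proof -
    have "nrm (a' - a) \<le> nrm (a' - b n) + nrm (b n - a)"
      by (intro nrm_triangle best_V[OF a'] best_V[OF b] V)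
    then have "\<alpha> * nrm (a' - a) \<le> \<alpha> * nrm (b n - a') + \<alpha> * nrm (b n - a)"
      using \<alpha>_pos nrm_minus_commute[of a' "b n"] by (simp add: distrib_left[symmetric])
    then show ?thesis
      using best_lipschitz[OF b a' V(1,2,3,4), of n] by linarith
  qed
  moreover have "(\<lambda>n. l\<^sub>U * nrm (z n - z') + l\<^sub>\<theta> * nrm (\<eta> n - \<eta>') + \<alpha> * nrm (b n - a))
      \<longlonglongrightarrow> l\<^sub>U * 0 + l\<^sub>\<theta> * 0 + \<alpha> * 0"
    by (intro tendsto_intros lim)
  ultimately have "\<alpha> * nrm (a' - a) \<le> 0"
    using LIMSEQ_le_const by fastforce
  then have "nrm (a' - a) = 0"
    using \<alpha>_pos nrm_nonneg[of "a' - a"] by (simp add: mult_le_0_iff)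
  then show ?thesis
    by (intro best_equiv[OF a']) (use V in auto)
qed

end


section \<open>Profiles\<close>

locale profile_space = process_space P \<FF> Tm + lebesgue_extension \<nu>
  for P :: "'w measure" and \<FF> Tm and \<nu> :: "real measure"
begin

abbreviation prof :: "'w profile set" where "prof \<equiv> prof_space P \<FF> Tm \<nu>"
abbreviation pn :: "'w profile \<Rightarrow> real" where "pn \<equiv> prof_norm P Tm \<nu>"

definition joint :: "'w profile \<Rightarrow> bool" where
  "joint a \<longleftrightarrow> (\<lambda>(x, p). pr (a x) p) \<in> borel_measurable (\<nu> \<Otimes>\<^sub>M Q)"

lemma joint_nrm_measurable:
  assumes "joint a" "\<And>x. x \<in> {0..1} \<Longrightarrow> a x \<in> V"
  shows "(\<lambda>x. nrm (a x)) \<in> borel_measurable \<nu>"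
proof -
  have [measurable]: "(\<lambda>(x, p). pr (a x) p) \<in> borel_measurable (\<nu> \<Otimes>\<^sub>M Q)"
    using assms(1) by (simp add: joint_def)
  have "(\<lambda>x. l2norm Q (pr (a x))) \<in> borel_measurable \<nu>"
    unfolding l2norm_def by measurable
  then show ?thesis
    using assms(2) by (subst measurable_cong) (auto simp: nrm_eq V_sqint)
qed

lemma prof_iff:
  "a \<in> prof \<longleftrightarrow> (\<forall>x\<in>{0..1}. a x \<in> V) \<and> joint a \<and> (\<integral>\<^sup>+x. ennreal ((nrm (a x))\<^sup>2) \<partial>\<nu>) < \<infinity>"
proof -
  have "sets (\<nu> \<Otimes>\<^sub>M (restrict_space borel {0..Tm} \<Otimes>\<^sub>M P)) = sets (\<nu> \<Otimes>\<^sub>M Q)"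
    by (intro sets_pair_measure_cong sets_Q[symmetric] refl)
  then have "(borel_measurable (\<nu> \<Otimes>\<^sub>M (restrict_space borel {0..Tm} \<Otimes>\<^sub>M P)) :: (_ \<Rightarrow> real) set)
      = borel_measurable (\<nu> \<Otimes>\<^sub>M Q)"
    by (intro measurable_cong_sets) auto
  moreover have "(\<lambda>(x, t, \<omega>). a x \<omega> t) = (\<lambda>(x, p). pr (a x) p)"
    by (auto simp: pr_def)
  ultimately have j: "(\<lambda>(x, t, \<omega>). a x \<omega> t) \<in> borel_measurable (\<nu> \<Otimes>\<^sub>M (restrict_space borel {0..Tm} \<Otimes>\<^sub>M P))
      \<longleftrightarrow> joint a"
    by (simp add: joint_def)
  have "(\<integral>\<^sup>+x. (\<integral>\<^sup>+t\<in>{0..Tm}. (\<integral>\<^sup>+\<omega>. ennreal ((a x \<omega> t)\<^sup>2) \<partial>P) \<partial>lborel) \<partial>\<nu>)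
      = (\<integral>\<^sup>+x. ennreal ((nrm (a x))\<^sup>2) \<partial>\<nu>)" if "\<forall>x\<in>{0..1}. a x \<in> V"
  proof (rule nn_integral_cong)
    fix x assume "x \<in> space \<nu>"
    then have s: "pr (a x) \<in> sqint Q" using that by (auto intro: V_sqint)
    then have "(\<integral>\<^sup>+t\<in>{0..Tm}. (\<integral>\<^sup>+\<omega>. ennreal ((a x \<omega> t)\<^sup>2) \<partial>P) \<partial>lborel) = (\<integral>\<^sup>+p. ennreal ((pr (a x) p)\<^sup>2) \<partial>Q)"
      using nn_integral_Q[of "\<lambda>p. ennreal ((pr (a x) p)\<^sup>2)"] sqint_measurable[OF s] by (simp add: pr_def)
    then show "(\<integral>\<^sup>+t\<in>{0..Tm}. (\<integral>\<^sup>+\<omega>. ennreal ((a x \<omega> t)\<^sup>2) \<partial>P) \<partial>lborel) = ennreal ((nrm (a x))\<^sup>2)"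
      using nn_integral_eq_l2norm_sq[OF s] by (simp add: nrm_eq[OF s])
  qed
  then show ?thesis
    unfolding prof_space_def j mem_Collect_eq by auto
qed

lemma prof_V: "a \<in> prof \<Longrightarrow> x \<in> {0..1} \<Longrightarrow> a x \<in> V"
  by (auto simp: prof_iff)

lemma prof_joint: "a \<in> prof \<Longrightarrow> joint a"
  by (auto simp: prof_iff)

lemma prof_nrm_sqint: "a \<in> prof \<Longrightarrow> (\<lambda>x. nrm (a x)) \<in> sqint \<nu>"
  unfolding sqint_nn_integral using joint_nrm_measurable[of a] by (auto simp: prof_iff)

lemma profI:
  assumes "joint a" "\<And>x. x \<in> {0..1} \<Longrightarrow> a x \<in> V"
    and "f \<in> sqint \<nu>" "\<And>x. x \<in> {0..1} \<Longrightarrow> nrm (a x) \<le> f x"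
  shows "a \<in> prof"
proof -
  have "(\<lambda>x. nrm (a x)) \<in> sqint \<nu>"
  proof (rule l2norm_mono(1)[OF assms(3)])
    show "AE x in \<nu>. \<bar>nrm (a x)\<bar> \<le> \<bar>f x\<bar>"
      by (rule AE_I2) (use assms(4) in \<open>simp add: order_trans[OF _ abs_ge_self]\<close>)
  qed (use assms(1,2) in \<open>rule joint_nrm_measurable\<close>)
  then show ?thesis using assms(1,2) by (auto simp: prof_iff sqint_nn_integral)
qed

lemma profI_bounded:
  assumes "joint a" "\<And>x. x \<in> {0..1} \<Longrightarrow> a x \<in> V" "\<And>x. x \<in> {0..1} \<Longrightarrow> nrm (a x) \<le> B"
  shows "a \<in> prof"
  using assms by (intro profI[where f = "\<lambda>_. B"] sqint_const)

lemma pn_eq: "pn a = l2norm \<nu> (\<lambda>x. nrm (a x))"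
  by (simp add: prof_norm_def l2norm_def nrm_sq)

lemma pn_nonneg [simp]: "0 \<le> pn a"
  by (simp add: pn_eq)

lemma l2norm_le_mono:
  assumes "f \<in> sqint \<nu>" "g \<in> borel_measurable \<nu>" "\<And>x. x \<in> {0..1} \<Longrightarrow> 0 \<le> g x" "\<And>x. x \<in> {0..1} \<Longrightarrow> g x \<le> f x"
  shows "l2norm \<nu> g \<le> l2norm \<nu> f" and "g \<in> sqint \<nu>"
proof -
  have "AE x in \<nu>. \<bar>g x\<bar> \<le> \<bar>f x\<bar>"
    by (rule AE_I2) (use assms(3,4) in fastforce)
  from l2norm_mono[OF assms(1,2) this] show "l2norm \<nu> g \<le> l2norm \<nu> f" "g \<in> sqint \<nu>" by auto
qed

lemma pn_le:
  assumes "a \<in> prof" "f \<in> sqint \<nu>" "\<And>x. x \<in> {0..1} \<Longrightarrow> nrm (a x) \<le> f x"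
  shows "pn a \<le> l2norm \<nu> f"
  unfolding pn_eq
  using assms(2) sqint_measurable[OF prof_nrm_sqint[OF assms(1)]] assms(3)
  by (intro l2norm_le_mono(1)) auto

lemma l2norm_const: "l2norm \<nu> (\<lambda>x. c) = \<bar>c\<bar>"
  by (simp add: l2norm_def)

lemma pn_bounded: "a \<in> prof \<Longrightarrow> (\<And>x. x \<in> {0..1} \<Longrightarrow> nrm (a x) \<le> B) \<Longrightarrow> 0 \<le> B \<Longrightarrow> pn a \<le> B"
  using pn_le[of a "\<lambda>_. B"] by (simp add: sqint_const l2norm_const)

lemma joint_diff: "joint a \<Longrightarrow> joint b \<Longrightarrow> joint (a - b)"
  unfolding joint_def by (simp add: pr_minus case_prod_beta)

lemma joint_add: "joint a \<Longrightarrow> joint b \<Longrightarrow> joint (a + b)"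
  unfolding joint_def by (simp add: pr_plus case_prod_beta)

lemma prof_diff:
  assumes "a \<in> prof" "b \<in> prof"
  shows "a - b \<in> prof"
proof (rule profI)
  show "joint (a - b)" using assms by (intro joint_diff prof_joint)
  show "(\<lambda>x. nrm (a x) + nrm (b x)) \<in> sqint \<nu>" using assms by (intro sqint_add prof_nrm_sqint)
  fix x :: real assume x: "x \<in> {0..1}"
  show "(a - b) x \<in> V" using assms x by (simp add: V_diff prof_V)
  show "nrm ((a - b) x) \<le> nrm (a x) + nrm (b x)"
    using nrm_triangle[of "a x" "\<lambda>\<omega> t. 0" "b x"] assms x V_const nrm_minus_commute[of "\<lambda>\<omega> t. 0" "b x"]
    by (simp add: prof_V fun_diff_def)
qed

lemma prof_add:
  assumes "a \<in> prof" "b \<in> prof"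
  shows "a + b \<in> prof"
proof (rule profI)
  show "joint (a + b)" using assms by (intro joint_add prof_joint)
  show "(\<lambda>x. nrm (a x) + nrm (b x)) \<in> sqint \<nu>" using assms by (intro sqint_add prof_nrm_sqint)
  fix x :: real assume x: "x \<in> {0..1}"
  show "(a + b) x \<in> V" using assms x by (simp add: V_add prof_V)
  show "nrm ((a + b) x) \<le> nrm (a x) + nrm (b x)"
    using nrm_triangle_add[of "a x" "b x"] assms x by (simp add: prof_V)
qed

lemma pn_triangle:
  assumes "a \<in> prof" "b \<in> prof" "c \<in> prof"
  shows "pn (a - c) \<le> pn (a - b) + pn (b - c)"
proof -
  have "pn (a - c) \<le> l2norm \<nu> (\<lambda>x. nrm ((a - b) x) + nrm ((b - c) x))"
    using assms by (intro pn_le sqint_add prof_nrm_sqint prof_diff) (auto simp: prof_V intro: nrm_triangle)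
  also have "\<dots> \<le> pn (a - b) + pn (b - c)"
    unfolding pn_eq using assms by (intro l2norm_triangle prof_nrm_sqint prof_diff)
  finally show ?thesis .
qed

lemma pn_minus_commute: "pn (a - b) = pn (b - a)"
  by (simp add: pn_eq nrm_minus_commute)

lemma pn_le_add_diff:
  assumes "a \<in> prof" "b \<in> prof"
  shows "pn a \<le> pn b + pn (a - b)"
proof -
  have "pn a \<le> l2norm \<nu> (\<lambda>x. nrm (b x) + nrm ((a - b) x))"
    using assms nrm_le_add_diff by (intro pn_le sqint_add prof_nrm_sqint prof_diff) (auto simp: prof_V)
  also have "\<dots> \<le> pn b + pn (a - b)"
    unfolding pn_eq using assms by (intro l2norm_triangle prof_nrm_sqint prof_diff)
  finally show ?thesis .
qed

section \<open>Approximation by countably-valued families\<close>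

text \<open>
  Stands in for strong measurability of \<open>x \<mapsto> a x\<close> in the Hilbert space.  Aggregates and best
  responses are selected player by player and carry no joint measurability, but uniform
  countably-valued approximation survives Lipschitz maps and yields a jointly measurable version.
\<close>

definition approximable :: "'w process set \<Rightarrow> 'w profile \<Rightarrow> bool" where
  "approximable S a \<longleftrightarrow> (\<forall>x\<in>{0..1}. a x \<in> S) \<and>
    (\<forall>e>0. \<exists>k c. k \<in> measurable \<nu> (count_space UNIV) \<and> (\<forall>n::nat. c n \<in> S) \<and>
      (\<forall>x\<in>{0..1}. nrm (a x - c (k x)) < e))"

lemma approximableD:
  assumes "approximable S a" "0 < e"
  obtains k and c :: "nat \<Rightarrow> 'w process" where "k \<in> measurable \<nu> (count_space UNIV)" "\<And>n. c n \<in> S"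
    "\<And>x. x \<in> {0..1} \<Longrightarrow> nrm (a x - c (k x)) < e"
  using assms unfolding approximable_def by blast

lemma approximable_in: "approximable S a \<Longrightarrow> x \<in> {0..1} \<Longrightarrow> a x \<in> S"
  by (simp add: approximable_def)

lemma approximable_seq:
  assumes "approximable S a"
  obtains k and c :: "nat \<Rightarrow> nat \<Rightarrow> 'w process" where "\<And>n. k n \<in> measurable \<nu> (count_space UNIV)" "\<And>n i. c n i \<in> S"
    "\<And>n x. x \<in> {0..1} \<Longrightarrow> nrm (a x - c n (k n x)) < (1/2)^n"
proof -
  have "\<forall>n::nat. \<exists>k c. k \<in> measurable \<nu> (count_space UNIV) \<and> (\<forall>n::nat. c n \<in> S) \<and>
      (\<forall>x\<in>{0..1}. nrm (a x - c (k x)) < (1/2)^n)"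
    using assms unfolding approximable_def by simp
  then obtain k c where "\<forall>n::nat. k n \<in> measurable \<nu> (count_space UNIV) \<and> (\<forall>i::nat. c n i \<in> S) \<and>
      (\<forall>x\<in>{0..1}. nrm (a x - c n (k n x)) < (1/2)^n)"
    by metis
  then show thesis using that[of k c] by blast
qed

text \<open>The approximating values are values of \<open>a\<close> itself and hence stay in
  \<open>S\<close>. This permits \<open>S\<close> to be the action set, where the utility is
  Lipschitz.\<close>

lemma joint_approximable:
  assumes "joint a" "\<And>x. x \<in> {0..1} \<Longrightarrow> a x \<in> S" "S \<subseteq> V"
  shows "approximable S a"
  unfolding approximable_def
proof (intro conjI allI impI)
  fix e :: real assume "0 < e"
  have aV: "\<And>x. x \<in> {0..1} \<Longrightarrow> a x \<in> V" using assms by blast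
  obtain k c where kc: "k \<in> measurable \<nu> (count_space UNIV)" "\<forall>n::nat. c n \<in> space \<nu>"
    "\<forall>x\<in>space \<nu>. l2norm Q (\<lambda>y. pr (a x) y - pr (a (c (k x))) y) < e"
    using Q.countable_valued_approximation[of "\<lambda>x. pr (a x)" \<nu> e] assms(1) aV \<open>0 < e\<close> V_sqint
    unfolding joint_def by auto
  show "\<exists>k c. k \<in> measurable \<nu> (count_space UNIV) \<and> (\<forall>n::nat. c n \<in> S) \<and>
      (\<forall>x\<in>{0..1}. nrm (a x - c (k x)) < e)"
    using kc assms(2) aV
    by (intro exI[of _ k] exI[of _ "\<lambda>n. a (c n)"]) (auto simp: nrm_diff)
qed (use assms in auto)

lemma approximable_map2:
  assumes a: "approximable S a" and b: "approximable R b"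
    and F: "\<And>u v. u \<in> S \<Longrightarrow> v \<in> R \<Longrightarrow> F u v \<in> S'"
    and lip: "\<And>u v u' v'. u \<in> S \<Longrightarrow> v \<in> R \<Longrightarrow> u' \<in> S \<Longrightarrow> v' \<in> R
      \<Longrightarrow> nrm (F u v - F u' v') \<le> C * (nrm (u - u') + nrm (v - v'))"
    and C: "0 < C"
  shows "approximable S' (\<lambda>x. F (a x) (b x))"
  unfolding approximable_def
proof (intro conjI allI impI)
  fix e :: real assume "0 < e"
  then have e: "0 < e / (2 * C)" using C by simp
  obtain k c where k: "k \<in> measurable \<nu> (count_space UNIV)" "\<And>n::nat. c n \<in> S"
    "\<And>x. x \<in> {0..1} \<Longrightarrow> nrm (a x - c (k x)) < e / (2 * C)"
    using approximableD[OF a e] by metis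
  obtain l d where l: "l \<in> measurable \<nu> (count_space UNIV)" "\<And>n::nat. d n \<in> R"
    "\<And>x. x \<in> {0..1} \<Longrightarrow> nrm (b x - d (l x)) < e / (2 * C)"
    using approximableD[OF b e] by metis
  note k(1)[measurable] l(1)[measurable]
  \<comment> \<open>Index of the common refinement of the two countable partitions.\<close>
  let ?m = "\<lambda>x. prod_encode (k x, l x)"
  let ?f = "\<lambda>n. F (c (fst (prod_decode n))) (d (snd (prod_decode n)))"
  have "?m \<in> measurable \<nu> (count_space UNIV)" by measurable
  moreover have "\<forall>n. ?f n \<in> S'" using F k(2) l(2) by blast
  moreover have "nrm (F (a x) (b x) - ?f (?m x)) < e" if x: "x \<in> {0..1}" for x
  proof -
    have "nrm (F (a x) (b x) - F (c (k x)) (d (l x))) \<le> C * (nrm (a x - c (k x)) + nrm (b x - d (l x)))"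
      using x by (intro lip k(2) l(2) approximable_in[OF a] approximable_in[OF b])
    also have "\<dots> < C * (e / (2 * C) + e / (2 * C))"
      using k(3)[OF x] l(3)[OF x] C by (intro mult_strict_left_mono add_strict_mono)
    also have "\<dots> = e" using C by (simp add: field_simps)
    finally show ?thesis by simp
  qed
  ultimately show "\<exists>k c. k \<in> measurable \<nu> (count_space UNIV) \<and> (\<forall>n::nat. c n \<in> S') \<and>
      (\<forall>x\<in>{0..1}. nrm (F (a x) (b x) - c (k x)) < e)"
    by (intro exI[of _ ?m] exI[of _ ?f]) blast
qed (use F a b in \<open>auto simp: approximable_in\<close>)

lemma joint_countable_valued:
  assumes k: "k \<in> measurable \<nu> (count_space UNIV)" and c: "\<And>n::nat. c n \<in> V"
  shows "joint (\<lambda>x. c (k x))"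
proof -
  note k[measurable]
  have [measurable]: "pr (c n) \<in> borel_measurable Q" for n
    using V_sqint[OF c] by (rule sqint_measurable)
  have "(\<lambda>q. pr (c (k (fst q))) (snd q)) \<in> borel_measurable (\<nu> \<Otimes>\<^sub>M Q)"
    by (rule measurable_compose_countable[where f = "\<lambda>n q. pr (c n) (snd q)" and g = "\<lambda>q. k (fst q)"]) measurable
  then show ?thesis by (simp add: joint_def case_prod_beta)
qed

lemma joint_plim:
  assumes "\<And>n. joint (b n)"
  shows "joint (\<lambda>x. plim (\<lambda>n. b n x))"
proof -
  have [measurable]: "(\<lambda>q. pr (b n (fst q)) (snd q)) \<in> borel_measurable (\<nu> \<Otimes>\<^sub>M Q)" for n
    using assms by (simp add: joint_def case_prod_beta)
  have "pr (plim (\<lambda>n. b n x)) p = lim (\<lambda>n. pr (b n x) p)" for x p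
    by (cases p) (simp add: pr_def plim_def)
  then show ?thesis by (simp add: joint_def case_prod_beta)
qed

text \<open>Countably-valued families are jointly measurable, and approximants within
  \<open>(1/2)^n\<close> converge for every player; their pathwise limit changes no player's
  element.\<close>

lemma approximable_joint_version:
  assumes a: "approximable V a"
  shows "\<exists>b. joint b \<and> (\<forall>x\<in>{0..1}. b x \<in> V \<and> nrm (a x - b x) = 0)"
proof -
  obtain k and c :: "nat \<Rightarrow> nat \<Rightarrow> 'w process"
    where k: "\<And>n. k n \<in> measurable \<nu> (count_space UNIV)" and c: "\<And>n i. c n i \<in> V"
    and near: "\<And>n x. x \<in> {0..1} \<Longrightarrow> nrm (a x - c n (k n x)) < (1/2)^n"
    using approximable_seq[OF a] by metis
  let ?b = "\<lambda>n x. c n (k n x)"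
  have "joint (\<lambda>x. plim (\<lambda>n. ?b n x))"
    by (intro joint_plim joint_countable_valued k c)
  moreover have "plim (\<lambda>n. ?b n x) \<in> V \<and> nrm (a x - plim (\<lambda>n. ?b n x)) = 0" if x: "x \<in> {0..1}" for x
  proof -
    have aV: "a x \<in> V" using a x by (rule approximable_in)
    have step: "nrm (?b (Suc n) x - ?b n x) \<le> 2 * (1/2)^n" for n
    proof -
      have "nrm (?b (Suc n) x - ?b n x) \<le> nrm (?b (Suc n) x - a x) + nrm (a x - ?b n x)"
        by (intro nrm_triangle c aV)
      also have "\<dots> \<le> (1/2)^Suc n + (1/2)^n"
        using near[OF x, of "Suc n"] near[OF x, of n] nrm_minus_commute[of "a x" "?b (Suc n) x"] by simp
      also have "\<dots> \<le> 2 * (1/2)^n"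
        unfolding power_Suc using zero_le_power[of "1/2 :: real" n] by linarith
      finally show ?thesis .
    qed
    have s: "summable (\<lambda>n. 2 * (1/2)^n :: real)" by (intro summable_mult summable_geometric) simp
    note lim = V_fast_limit[of "\<lambda>n. ?b n x" "\<lambda>n. 2 * (1/2)^n", OF c step s]
    have "nrm (a x - plim (\<lambda>n. ?b n x)) \<le> (1/2)^n + nrm (?b n x - plim (\<lambda>n. ?b n x))" for n
      using nrm_triangle[OF aV c[of n "k n x"] lim(1)] near[OF x, of n] by linarith
    moreover have "(\<lambda>n. (1/2)^n + nrm (?b n x - plim (\<lambda>n. ?b n x))) \<longlonglongrightarrow> 0 + 0"
      by (intro tendsto_add lim(3) LIMSEQ_power_zero) simp
    ultimately have "nrm (a x - plim (\<lambda>n. ?b n x)) \<le> 0"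
      using LIMSEQ_le_const by fastforce
    then show ?thesis using lim(1) by (simp add: order_antisym)
  qed
  ultimately show ?thesis by blast
qed

text \<open>Gives measurability of the welfare integrand, whose aggregates are selected player by
  player: it is a pointwise limit of countably-valued functions.\<close>

lemma approximable_map3_measurable:
  fixes F :: "'w process \<Rightarrow> 'w process \<Rightarrow> 'w process \<Rightarrow> real"
  assumes a: "approximable S a" and z: "approximable V z" and \<eta>: "approximable V \<eta>"
    and lip: "\<And>u v w u' v' w'. u \<in> S \<Longrightarrow> u' \<in> S \<Longrightarrow> v \<in> V \<Longrightarrow> v' \<in> V \<Longrightarrow> w \<in> V \<Longrightarrow> w' \<in> V
      \<Longrightarrow> \<bar>F u v w - F u' v' w'\<bar> \<le> C * (nrm (u - u') + nrm (v - v') + nrm (w - w'))"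
    and C: "0 \<le> C"
  shows "(\<lambda>x. F (a x) (z x) (\<eta> x)) \<in> borel_measurable \<nu>"
proof -
  obtain k and c :: "nat \<Rightarrow> nat \<Rightarrow> 'w process"
    where k: "\<And>n. k n \<in> measurable \<nu> (count_space UNIV)" and c: "\<And>n i. c n i \<in> S"
    and near_a: "\<And>n x. x \<in> {0..1} \<Longrightarrow> nrm (a x - c n (k n x)) < (1/2)^n"
    using approximable_seq[OF a] by metis
  obtain l and d :: "nat \<Rightarrow> nat \<Rightarrow> 'w process"
    where l: "\<And>n. l n \<in> measurable \<nu> (count_space UNIV)" and d: "\<And>n i. d n i \<in> V"
    and near_z: "\<And>n x. x \<in> {0..1} \<Longrightarrow> nrm (z x - d n (l n x)) < (1/2)^n"
    using approximable_seq[OF z] by metis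
  obtain m and e :: "nat \<Rightarrow> nat \<Rightarrow> 'w process"
    where m: "\<And>n. m n \<in> measurable \<nu> (count_space UNIV)" and e: "\<And>n i. e n i \<in> V"
    and near_\<eta>: "\<And>n x. x \<in> {0..1} \<Longrightarrow> nrm (\<eta> x - e n (m n x)) < (1/2)^n"
    using approximable_seq[OF \<eta>] by metis
  note k[measurable] l[measurable] m[measurable]
  let ?F = "\<lambda>n x. F (c n (k n x)) (d n (l n x)) (e n (m n x))"
  show ?thesis
  proof (rule borel_measurable_LIMSEQ_real)
    show "?F n \<in> borel_measurable \<nu>" for n
    proof -
      let ?g = "\<lambda>i. F (c n (fst (prod_decode i))) (d n (fst (prod_decode (snd (prod_decode i))))) (e n (snd (prod_decode (snd (prod_decode i)))))"
      have "(\<lambda>x. ?g (prod_encode (k n x, prod_encode (l n x, m n x)))) \<in> borel_measurable \<nu>"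
        by measurable
      then show ?thesis by simp
    qed
    fix x assume "x \<in> space \<nu>"
    then have x: "x \<in> {0..1}" by simp
    show "(\<lambda>n. ?F n x) \<longlonglongrightarrow> F (a x) (z x) (\<eta> x)"
    proof (rule LIM_zero_cancel, rule Lim_null_comparison)
      show "\<forall>\<^sub>F n in sequentially. norm (?F n x - F (a x) (z x) (\<eta> x)) \<le> C * (3 * (1/2)^n)"
      proof (intro always_eventually allI)
        fix n
        have "norm (?F n x - F (a x) (z x) (\<eta> x)) = \<bar>F (a x) (z x) (\<eta> x) - ?F n x\<bar>" by simp
        also have "\<dots> \<le> C * (nrm (a x - c n (k n x)) + nrm (z x - d n (l n x)) + nrm (\<eta> x - e n (m n x)))"
          using x by (intro lip c d e approximable_in[OF a] approximable_in[OF z] approximable_in[OF \<eta>])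
        also have "\<dots> \<le> C * (3 * (1/2)^n)"
          using near_a[OF x, of n] near_z[OF x, of n] near_\<eta>[OF x, of n] C by (intro mult_left_mono) auto
        finally show "norm (?F n x - F (a x) (z x) (\<eta> x)) \<le> C * (3 * (1/2)^n)" .
      qed
      have "(\<lambda>n. C * (3 * (1/2)^n)) \<longlonglongrightarrow> C * (3 * 0 :: real)"
        by (intro tendsto_intros LIMSEQ_power_zero) simp
      then show "(\<lambda>n. C * (3 * (1/2)^n)) \<longlonglongrightarrow> (0 :: real)" by simp
    qed
  qed
qed

end


section \<open>Aggregates\<close>

context profile_space
begin

sublocale NQ: pair_sigma_finite \<nu> Q ..

lemma zero_V: "(0 :: 'w process) \<in> V"
  using V_const[of 0] by (simp add: zero_fun_def)

lemma V_sum: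
  assumes "finite J" "\<And>j. j \<in> J \<Longrightarrow> c j \<in> V"
  shows "(\<lambda>\<omega> t. \<Sum>j\<in>J. w j * c j \<omega> t) \<in> V"
  using assms
proof (induction J rule: finite_induct)
  case (insert j J)
  have "(\<lambda>\<omega> t. w j * c j \<omega> t + 1 * (\<Sum>j\<in>J. w j * c j \<omega> t)) \<in> V"
    using insert by (intro V_lincomb) auto
  then show ?case using insert by simp
qed (simp add: V_const)

lemma joint_measurable: "joint a \<Longrightarrow> (\<lambda>(x, p). pr (a x) p) \<in> borel_measurable (\<nu> \<Otimes>\<^sub>M Q)"
  by (simp add: joint_def)

section \<open>Integrals of a profile against a scalar weight\<close>

lemma prof_nn_integral:
  assumes "a \<in> prof"
  shows "(\<integral>\<^sup>+p. (\<integral>\<^sup>+y. ennreal ((pr (a y) p)\<^sup>2) \<partial>\<nu>) \<partial>Q) = ennreal ((pn a)\<^sup>2)"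
proof -
  note [measurable] = joint_measurable[OF prof_joint[OF assms]]
  have "(\<integral>\<^sup>+p. (\<integral>\<^sup>+y. ennreal ((pr (a y) p)\<^sup>2) \<partial>\<nu>) \<partial>Q) = (\<integral>\<^sup>+y. (\<integral>\<^sup>+p. ennreal ((pr (a y) p)\<^sup>2) \<partial>Q) \<partial>\<nu>)"
    by (rule NQ.Fubini') measurable
  also have "\<dots> = (\<integral>\<^sup>+y. ennreal ((nrm (a y))\<^sup>2) \<partial>\<nu>)"
    using prof_V[OF assms] by (intro nn_integral_cong) (auto simp: nn_integral_eq_l2norm_sq V_sqint nrm_eq)
  also have "\<dots> = ennreal ((pn a)\<^sup>2)"
    unfolding pn_eq by (rule nn_integral_eq_l2norm_sq[OF prof_nrm_sqint[OF assms]])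
  finally show ?thesis .
qed

lemma prof_sections_sqint:
  assumes "a \<in> prof"
  shows "AE p in Q. (\<lambda>y. pr (a y) p) \<in> sqint \<nu>"
proof -
  note j = joint_measurable[OF prof_joint[OF assms]]
  note [measurable] = j
  have "AE p in Q. (\<integral>\<^sup>+y. ennreal ((pr (a y) p)\<^sup>2) \<partial>\<nu>) \<noteq> \<infinity>"
    using prof_nn_integral[OF assms] by (intro nn_integral_noteq_infinite) simp_all
  then show ?thesis
    using AE_space
  proof eventually_elim
    case (elim p)
    then show ?case
      using measurable_Pair1[OF j, of p] by (simp add: sqint_nn_integral less_top[symmetric])
  qed
qed

text \<open>Cauchy-Schwarz in the player for almost every \<open>p\<close>, followed by Tonelli: the
  squared norms of the sections integrate to the squared profile norm.\<close>

lemma integral_profile_sqint: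
  assumes k: "k \<in> sqint \<nu>" and a: "a \<in> prof"
  shows "(\<lambda>p. LINT y|\<nu>. k y * pr (a y) p) \<in> sqint Q" (is "?Z \<in> _")
    and "l2norm Q (\<lambda>p. LINT y|\<nu>. k y * pr (a y) p) \<le> l2norm \<nu> k * pn a"
proof -
  have [measurable]: "k \<in> borel_measurable \<nu>" using k by (rule sqint_measurable)
  note j[measurable] = joint_measurable[OF prof_joint[OF a]]
  have j'[measurable]: "(\<lambda>(p, y). pr (a y) p) \<in> borel_measurable (Q \<Otimes>\<^sub>M \<nu>)"
    using measurable_pair_swap[OF j] by simp
  have Zm: "?Z \<in> borel_measurable Q" by measurable
  have "(\<integral>\<^sup>+p. ennreal ((?Z p)\<^sup>2) \<partial>Q)
      \<le> (\<integral>\<^sup>+p. ennreal ((l2norm \<nu> k)\<^sup>2) * (\<integral>\<^sup>+y. ennreal ((pr (a y) p)\<^sup>2) \<partial>\<nu>) \<partial>Q)"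
    using prof_sections_sqint[OF a]
  proof (intro nn_integral_mono_AE, eventually_elim)
    case (elim p)
    have "\<bar>?Z p\<bar>\<^sup>2 \<le> (l2norm \<nu> k * l2norm \<nu> (\<lambda>y. pr (a y) p))\<^sup>2"
      using l2_Cauchy_Schwarz[OF k elim(2)] by (intro power_mono) (auto simp: l2inner_def)
    then show ?case
      unfolding nn_integral_eq_l2norm_sq[OF elim(2)]
      by (simp add: power_mult_distrib ennreal_mult[symmetric])
  qed
  also have "\<dots> = ennreal ((l2norm \<nu> k)\<^sup>2) * ennreal ((pn a)\<^sup>2)"
    unfolding prof_nn_integral[OF a, symmetric] by (rule nn_integral_cmult) measurable
  also have "\<dots> = ennreal ((l2norm \<nu> k * pn a)\<^sup>2)"
    by (simp add: power_mult_distrib ennreal_mult)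
  finally have le: "(\<integral>\<^sup>+p. ennreal ((?Z p)\<^sup>2) \<partial>Q) \<le> ennreal ((l2norm \<nu> k * pn a)\<^sup>2)" .
  show "?Z \<in> sqint Q" "l2norm Q ?Z \<le> l2norm \<nu> k * pn a"
    by (rule l2norm_le_nn_integral[OF Zm le], simp)+
qed

lemma integral_profile_diff:
  assumes k: "k \<in> sqint \<nu>" and a: "a \<in> prof" and b: "b \<in> prof"
  shows "AE p in Q. (LINT y|\<nu>. k y * pr ((a - b) y) p)
    = (LINT y|\<nu>. k y * pr (a y) p) - (LINT y|\<nu>. k y * pr (b y) p)"
  using prof_sections_sqint[OF a] prof_sections_sqint[OF b]
proof eventually_elim
  case (elim p)
  from sqint_mult_integrable[OF k elim(1)] sqint_mult_integrable[OF k elim(2)]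
  show ?case by (simp add: pr_minus right_diff_distrib)
qed

text \<open>Cutting off a countably-valued approximation after \<open>m\<close> values leaves the
  norm of \<open>a\<close> on a shrinking set of players. The integral of a finite-valued profile is
  a finite combination of processes, hence visibly progressive.\<close>

lemma finite_valued_approximation:
  assumes a: "a \<in> prof" and e: "0 < e"
  shows "\<exists>k m c. k \<in> measurable \<nu> (count_space UNIV) \<and> (\<forall>n::nat. c n \<in> V) \<and>
    (\<lambda>y. if k y < m then c (k y) else 0) \<in> prof \<and> pn (a - (\<lambda>y. if k y < m then c (k y) else 0)) < e"
proof -
  have "approximable V a" using a by (intro joint_approximable) (auto simp: prof_joint prof_V)
  then obtain k and c :: "nat \<Rightarrow> 'w process" where k: "k \<in> measurable \<nu> (count_space UNIV)"
    and c: "\<And>n. c n \<in> V" and near: "\<And>x. x \<in> {0..1} \<Longrightarrow> nrm (a x - c (k x)) < e / 2"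
    using approximableD[of V a "e / 2"] e by (metis half_gt_zero)
  note k[measurable]
  let ?b = "\<lambda>m y. if k y < m then c (k y) else 0"
  let ?r = "\<lambda>m y. (if k y < m then 0 else nrm (a y))"
  have [measurable]: "(\<lambda>y. nrm (a y)) \<in> borel_measurable \<nu>"
    using prof_nrm_sqint[OF a] by (rule sqint_measurable)
  have [measurable]: "Measurable.pred \<nu> (\<lambda>y. k y < m)" for m
    using measurable_compose[OF k, of "\<lambda>n. n < m"] by simp
  have rm: "?r m \<in> borel_measurable \<nu>" for m by measurable
  have r: "?r m \<in> sqint \<nu>" for m
    by (rule l2norm_mono(1)[OF prof_nrm_sqint[OF a] rm]) auto
  have jb: "joint (?b m)" for m
    using joint_countable_valued[OF k, of "\<lambda>n. if n < m then c n else 0"] c zero_V by (simp split: if_splits)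
  have aV: "a x \<in> V" if "x \<in> {0..1}" for x using a that by (rule prof_V)
  have bp: "?b m \<in> prof" for m
  proof (rule profI[OF jb])
    show "(\<lambda>x. e / 2 + nrm (a x)) \<in> sqint \<nu>" by (intro sqint_add sqint_const prof_nrm_sqint a)
    fix x :: real assume x: "x \<in> {0..1}"
    show "?b m x \<in> V" using c zero_V by simp
    show "nrm (?b m x) \<le> e / 2 + nrm (a x)"
      using nrm_le_add_diff[OF c[of "k x"] aV[OF x]] near[OF x] nrm_minus_commute[of "a x" "c (k x)"] e by simp
  qed
  have le: "pn (a - ?b m) \<le> e / 2 + l2norm \<nu> (?r m)" for m
  proof -
    have "pn (a - ?b m) \<le> l2norm \<nu> (\<lambda>x. e / 2 + ?r m x)"
    proof (rule pn_le)
      fix x :: real assume "x \<in> {0..1}"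
      from near[OF this] show "nrm ((a - ?b m) x) \<le> e / 2 + ?r m x" using e by simp
    qed (intro prof_diff a bp sqint_add sqint_const r)+
    also have "\<dots> \<le> e / 2 + l2norm \<nu> (?r m)"
      using l2norm_triangle[OF sqint_const[of "e / 2"] r[of m]] e by (simp add: l2norm_const)
    finally show ?thesis .
  qed
  have "(\<lambda>m. LINT y|\<nu>. (?r m y)\<^sup>2) \<longlonglongrightarrow> (LINT y|\<nu>. 0)"
  proof (rule integral_dominated_convergence[where w = "\<lambda>y. (nrm (a y))\<^sup>2"])
    show "AE y in \<nu>. (\<lambda>m. (?r m y)\<^sup>2) \<longlonglongrightarrow> 0"
    proof (rule AE_I2)
      fix y
      have "\<forall>\<^sub>F m in sequentially. (?r m y)\<^sup>2 = 0"
        using eventually_gt_at_top[of "k y"] by eventually_elim simp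
      then show "(\<lambda>m. (?r m y)\<^sup>2) \<longlonglongrightarrow> 0" by (rule tendsto_eventually)
    qed
    show "integrable \<nu> (\<lambda>y. (nrm (a y))\<^sup>2)" using prof_nrm_sqint[OF a] by (rule sqint_integrable_sq)
    show "(\<lambda>y. (?r m y)\<^sup>2) \<in> borel_measurable \<nu>" for m
      using rm[of m] by (rule borel_measurable_power)
  qed auto
  then have "(\<lambda>m. l2norm \<nu> (?r m)) \<longlonglongrightarrow> 0"
    unfolding l2norm_def using tendsto_real_sqrt by fastforce
  then have "\<forall>\<^sub>F m in sequentially. l2norm \<nu> (?r m) < e / 2"
    using e by (intro order_tendstoD(2)) auto
  then obtain m where "l2norm \<nu> (?r m) < e / 2"
    using eventually_happens'[OF sequentially_bot] by blast
  with le[of m] have "pn (a - ?b m) < e" by simp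
  then show ?thesis using k c bp by blast
qed

text \<open>\<open>w\<close> is the Hilbert-space integral of \<open>k y\<close> times
  \<open>a y\<close>, expressed through scalar integrals at almost every time and scenario; this
  determines \<open>w\<close> up to norm zero.\<close>

definition represents :: "(real \<Rightarrow> real) \<Rightarrow> 'w profile \<Rightarrow> 'w process \<Rightarrow> bool" where
  "represents k a w \<longleftrightarrow> w \<in> V \<and> (AE p in Q. pr w p = (LINT y|\<nu>. k y * pr (a y) p))"

text \<open>The scalar integrals need not form a progressive process. Integrals of finite-valued
  profiles are progressive and approximate them in L2, so \<open>progressive_version\<close>
  applies.\<close>

lemma represents_exists:
  assumes k: "k \<in> sqint \<nu>" and a: "a \<in> prof"
  shows "\<exists>w. represents k a w"
proof -
  have "\<exists>z'\<in>V. AE p in Q. pr z' p = (LINT y|\<nu>. k y * pr (a y) p)"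
  proof (rule progressive_version[OF integral_profile_sqint(1)[OF k a]])
    fix e :: real assume e: "0 < e"
    \<comment> \<open>The summand 1 keeps the tolerance meaningful when \<open>k\<close> has norm
      zero.\<close>
    have pos: "0 < l2norm \<nu> k + 1" using l2norm_nonneg[of \<nu> k] by linarith
    obtain q m c where q: "q \<in> measurable \<nu> (count_space UNIV)" and c: "\<And>n::nat. c n \<in> V"
      and bp: "(\<lambda>y. if q y < m then c (q y) else 0) \<in> prof" (is "?b \<in> _")
      and near: "pn (a - (\<lambda>y. if q y < m then c (q y) else 0)) < e / (l2norm \<nu> k + 1)"
      using finite_valued_approximation[OF a, of "e / (l2norm \<nu> k + 1)"] e pos by auto
    note q[measurable]
    have [measurable]: "k \<in> borel_measurable \<nu>" using k by (rule sqint_measurable)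
    define w where "w j = (LINT y|\<nu>. k y * indicator (q -` {j} \<inter> space \<nu>) y)" for j
    let ?v = "\<lambda>\<omega> t. \<Sum>j<m. w j * c j \<omega> t"
    have v: "?v \<in> V" using c by (intro V_sum) auto
    have qi: "(indicator (q -` {j} \<inter> space \<nu>) :: real \<Rightarrow> real) \<in> sqint \<nu>" for j
    proof (rule sqint_bounded[where B = 1])
      have "q -` {j} \<inter> space \<nu> \<in> sets \<nu>" using q by (rule measurable_sets) simp
      then show "(indicator (q -` {j} \<inter> space \<nu>) :: real \<Rightarrow> real) \<in> borel_measurable \<nu>" by simp
    qed (auto simp: indicator_def)
    have eq: "pr ?v p = (LINT y|\<nu>. k y * pr (?b y) p)" for p
    proof -
      have "(LINT y|\<nu>. k y * pr (?b y) p)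
          = (LINT y|\<nu>. (\<Sum>j<m. (k y * indicator (q -` {j} \<inter> space \<nu>) y) * pr (c j) p))"
      proof (rule Bochner_Integration.integral_cong)
        fix y assume y: "y \<in> space \<nu>"
        have "(\<Sum>j<m. (k y * indicator (q -` {j} \<inter> space \<nu>) y) * pr (c j) p)
            = (\<Sum>j<m. if q y = j then k y * pr (c j) p else 0)"
          using y by (intro sum.cong) (auto simp: indicator_def)
        also have "\<dots> = k y * pr (?b y) p"
          by (cases p) (simp add: pr_def)
        finally show "k y * pr (?b y) p
            = (\<Sum>j<m. (k y * indicator (q -` {j} \<inter> space \<nu>) y) * pr (c j) p)" by simp
      qed simp
      also have "\<dots> = (\<Sum>j<m. w j * pr (c j) p)"
        using sqint_mult_integrable[OF k qi] unfolding w_def by (subst Bochner_Integration.integral_sum) auto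
      finally show ?thesis by (cases p) (simp add: pr_def)
    qed
    have "l2norm Q (\<lambda>p. pr ?v p - (LINT y|\<nu>. k y * pr (a y) p))
        = l2norm Q (\<lambda>p. LINT y|\<nu>. k y * pr ((?b - a) y) p)"
      using integral_profile_diff[OF k bp a]
        integral_profile_sqint(1)[OF k prof_diff[OF bp a]] integral_profile_sqint(1)[OF k a] V_sqint[OF v]
      unfolding eq[symmetric]
      by (intro l2norm_cong_AE) (auto intro: sqint_measurable borel_measurable_diff simp: eq[symmetric])
    also have "\<dots> \<le> l2norm \<nu> k * pn (?b - a)"
      by (rule integral_profile_sqint(2)[OF k prof_diff[OF bp a]])
    also have "\<dots> \<le> (l2norm \<nu> k + 1) * pn (a - ?b)"
      unfolding pn_minus_commute[of a] by (intro mult_right_mono) auto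
    also have "\<dots> < e" using near pos by (simp add: pos_less_divide_eq mult.commute)
    finally show "\<exists>b\<in>V. l2norm Q (\<lambda>p. pr b p - (LINT y|\<nu>. k y * pr (a y) p)) < e"
      using v by (intro bexI[of _ ?v])
  qed
  then show ?thesis unfolding represents_def by blast
qed

lemma represents_V: "represents k a w \<Longrightarrow> w \<in> V"
  by (simp add: represents_def)

lemma represents_bound:
  assumes "represents k a w" "k \<in> sqint \<nu>" "a \<in> prof"
  shows "nrm w \<le> l2norm \<nu> k * pn a"
proof -
  have "nrm w = l2norm Q (pr w)" using assms(1) by (simp add: represents_def nrm_eq V_sqint)
  also have "\<dots> = l2norm Q (\<lambda>p. LINT y|\<nu>. k y * pr (a y) p)"
    using assms(1) integral_profile_sqint(1)[OF assms(2,3)] V_sqint[of w]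
    by (intro l2norm_cong_AE) (auto simp: represents_def sqint_measurable)
  also have "\<dots> \<le> l2norm \<nu> k * pn a" by (rule integral_profile_sqint(2)[OF assms(2,3)])
  finally show ?thesis .
qed

lemma represents_diff_profile:
  assumes "represents k a w" "represents k b v" "k \<in> sqint \<nu>" "a \<in> prof" "b \<in> prof"
  shows "represents k (a - b) (w - v)"
proof -
  have "AE p in Q. pr (w - v) p = (LINT y|\<nu>. k y * pr ((a - b) y) p)"
    using integral_profile_diff[OF assms(3-5)] assms(1)[unfolded represents_def, THEN conjunct2]
      assms(2)[unfolded represents_def, THEN conjunct2]
    by eventually_elim (simp add: pr_minus)
  then show ?thesis using assms(1,2) by (simp add: represents_def V_diff)
qed

lemma represents_diff_kernel:
  assumes "represents k a w" "represents l a v" "k \<in> sqint \<nu>" "l \<in> sqint \<nu>" "a \<in> prof"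
  shows "represents (\<lambda>y. k y - l y) a (w - v)"
proof -
  have "AE p in Q. pr (w - v) p = (LINT y|\<nu>. (k y - l y) * pr (a y) p)"
    using prof_sections_sqint[OF assms(5)] assms(1)[unfolded represents_def, THEN conjunct2]
      assms(2)[unfolded represents_def, THEN conjunct2]
  proof eventually_elim
    case (elim p)
    from sqint_mult_integrable[OF assms(3) elim(1)] sqint_mult_integrable[OF assms(4) elim(1)] elim(2,3)
    show ?case by (simp add: pr_minus left_diff_distrib)
  qed
  then show ?thesis using assms(1,2) by (simp add: represents_def V_diff)
qed

lemma represents_unique:
  assumes "represents k a w" "represents k a v"
  shows "nrm (w - v) = 0"
proof -
  have V: "w \<in> V" "v \<in> V" using assms by (auto simp: represents_def)
  have "AE p in Q. pr w p - pr v p = 0"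
    using assms(1)[unfolded represents_def, THEN conjunct2] assms(2)[unfolded represents_def, THEN conjunct2]
    by eventually_elim simp
  then show ?thesis
    using l2norm_eq_0_iff[OF sqint_diff[OF V_sqint[OF V(1)] V_sqint[OF V(2)]]] V by (simp add: nrm_diff)
qed

text \<open>A bound for the scalar operator lifts to process-valued functions with the same
  constant: it is applied at almost every \<open>p\<close> and integrated by Fubini. The norms of
  the \<open>w x\<close> are measurable in \<open>x\<close> although the \<open>w x\<close> are
  arbitrary representatives, because they equal the norms of the scalar integrals.\<close>

lemma represents_family_bound:
  assumes k: "sym_kernel \<nu> k"
    and bound: "\<And>f. f \<in> sqint \<nu> \<Longrightarrow> l2norm \<nu> (\<lambda>x. LINT y|\<nu>. k x y * f y) \<le> \<rho> * l2norm \<nu> f"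
    and \<rho>: "0 \<le> \<rho>" and a: "a \<in> prof"
    and w: "\<And>x. x \<in> {0..1} \<Longrightarrow> represents (k x) a (w x)"
  shows "(\<lambda>x. nrm (w x)) \<in> sqint \<nu>" and "l2norm \<nu> (\<lambda>x. nrm (w x)) \<le> \<rho> * pn a"
proof -
  interpret k: sym_kernel \<nu> k by (rule k)
  note j = joint_measurable[OF prof_joint[OF a]]
  have j'[measurable]: "(\<lambda>q. pr (a (snd q)) (snd (fst q))) \<in> borel_measurable ((\<nu> \<Otimes>\<^sub>M Q) \<Otimes>\<^sub>M \<nu>)"
    using measurable_compose[OF _ j, of "\<lambda>q. (snd q, snd (fst q))" "(\<nu> \<Otimes>\<^sub>M Q) \<Otimes>\<^sub>M \<nu>"] by simp
  have k'[measurable]: "(\<lambda>q. k (fst (fst q)) (snd q)) \<in> borel_measurable ((\<nu> \<Otimes>\<^sub>M Q) \<Otimes>\<^sub>M \<nu>)"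
    using measurable_compose[OF _ k.K_measurable, of "\<lambda>q. (fst (fst q), snd q)" "(\<nu> \<Otimes>\<^sub>M Q) \<Otimes>\<^sub>M \<nu>"] by simp
  let ?Z = "\<lambda>x p. LINT y|\<nu>. k x y * pr (a y) p"
  have Z[measurable]: "(\<lambda>(x, p). ?Z x p) \<in> borel_measurable (\<nu> \<Otimes>\<^sub>M Q)"
    unfolding case_prod_beta by measurable
  have nw: "nrm (w x) = l2norm Q (?Z x)" and Zs: "?Z x \<in> sqint Q" if x: "x \<in> {0..1}" for x
  proof -
    show s: "?Z x \<in> sqint Q"
      using integral_profile_sqint(1)[OF k.section_sqint a] x by simp
    have "w x \<in> V" using w[OF x] by (rule represents_V)
    then show "nrm (w x) = l2norm Q (?Z x)"
      using w[OF x] s by (simp add: nrm_eq V_sqint)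
        (intro l2norm_cong_AE, auto simp: represents_def sqint_measurable V_sqint)
  qed
  have "(\<lambda>x. l2norm Q (?Z x)) \<in> borel_measurable \<nu>"
    unfolding l2norm_def by measurable
  then have m: "(\<lambda>x. nrm (w x)) \<in> borel_measurable \<nu>"
    by (subst measurable_cong[where g = "\<lambda>x. l2norm Q (?Z x)"]) (auto simp: nw)
  have "(\<integral>\<^sup>+x. ennreal ((nrm (w x))\<^sup>2) \<partial>\<nu>) = (\<integral>\<^sup>+x. (\<integral>\<^sup>+p. ennreal ((?Z x p)\<^sup>2) \<partial>Q) \<partial>\<nu>)"
    using Zs by (intro nn_integral_cong) (auto simp: nw nn_integral_eq_l2norm_sq)
  also have "\<dots> = (\<integral>\<^sup>+p. (\<integral>\<^sup>+x. ennreal ((?Z x p)\<^sup>2) \<partial>\<nu>) \<partial>Q)"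
    by (rule NQ.Fubini'[symmetric]) measurable
  also have "\<dots> \<le> (\<integral>\<^sup>+p. ennreal (\<rho>\<^sup>2) * (\<integral>\<^sup>+y. ennreal ((pr (a y) p)\<^sup>2) \<partial>\<nu>) \<partial>Q)"
    using prof_sections_sqint[OF a]
  proof (intro nn_integral_mono_AE, eventually_elim)
    case (elim p)
    have "(l2norm \<nu> (\<lambda>x. ?Z x p))\<^sup>2 \<le> (\<rho> * l2norm \<nu> (\<lambda>y. pr (a y) p))\<^sup>2"
      using bound[OF elim(2)] by (intro power_mono) auto
    then show ?case
      unfolding nn_integral_eq_l2norm_sq[OF elim(2)] nn_integral_eq_l2norm_sq[OF k.op_sqint[OF elim(2)]]
      by (simp add: power_mult_distrib ennreal_mult[symmetric])
  qed
  also have "\<dots> = ennreal (\<rho>\<^sup>2) * ennreal ((pn a)\<^sup>2)"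
    unfolding prof_nn_integral[OF a, symmetric]
  proof (rule nn_integral_cmult)
    have [measurable]: "(\<lambda>(p, y). pr (a y) p) \<in> borel_measurable (Q \<Otimes>\<^sub>M \<nu>)"
      using measurable_pair_swap[OF j] by simp
    show "(\<lambda>p. \<integral>\<^sup>+y. ennreal ((pr (a y) p)\<^sup>2) \<partial>\<nu>) \<in> borel_measurable Q" by measurable
  qed
  also have "\<dots> = ennreal ((\<rho> * pn a)\<^sup>2)"
    by (simp add: power_mult_distrib ennreal_mult)
  finally have le: "(\<integral>\<^sup>+x. ennreal ((nrm (w x))\<^sup>2) \<partial>\<nu>) \<le> ennreal ((\<rho> * pn a)\<^sup>2)" .
  show "(\<lambda>x. nrm (w x)) \<in> sqint \<nu>" "l2norm \<nu> (\<lambda>x. nrm (w x)) \<le> \<rho> * pn a"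
    by (rule l2norm_le_nn_integral[OF m le], use \<rho> in simp)+
qed

section \<open>Aggregates\<close>

abbreviation agg :: "(real \<Rightarrow> real \<Rightarrow> real) \<Rightarrow> 'w profile \<Rightarrow> 'w profile" where
  "agg \<equiv> graphon_aggregate P \<FF> Tm \<nu>"

lemma AE_swap_Q:
  assumes [measurable]: "f \<in> borel_measurable Q" "g \<in> borel_measurable Q"
  shows "(AE (\<omega>, t) in P \<Otimes>\<^sub>M TT. f (t, \<omega>) = (g (t, \<omega>) :: real)) \<longleftrightarrow> (AE p in Q. f p = g p)"
proof -
  interpret TP: pair_sigma_finite TT P ..
  have m: "(\<lambda>(x, y). (y, x)) \<in> measurable (P \<Otimes>\<^sub>M TT) Q"
    unfolding Q_def by (rule measurable_pair_swap')
  have Q: "Q = distr (P \<Otimes>\<^sub>M TT) Q (\<lambda>(x, y). (y, x))"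
    using TP.distr_pair_swap unfolding Q_def .
  have "(AE p in Q. f p = g p) \<longleftrightarrow> (AE p in distr (P \<Otimes>\<^sub>M TT) Q (\<lambda>(x, y). (y, x)). f p = g p)"
    by (simp only: Q[symmetric])
  also have "\<dots> \<longleftrightarrow> (AE q in P \<Otimes>\<^sub>M TT. f (case q of (x, y) \<Rightarrow> (y, x)) = g (case q of (x, y) \<Rightarrow> (y, x)))"
    by (rule AE_distr_iff[OF m]) measurable
  finally show ?thesis by (simp add: case_prod_beta)
qed

lemma represents_iff_AE:
  assumes "k \<in> sqint \<nu>" "a \<in> prof"
  shows "z \<in> V \<and> (AE (\<omega>, t) in P \<Otimes>\<^sub>M restrict_space lborel {0..Tm}.
      z \<omega> t = (LINT y|\<nu>. k y * a y \<omega> t)) \<longleftrightarrow> represents k a z"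
proof (cases "z \<in> V")
  case True
  have "(AE (\<omega>, t) in P \<Otimes>\<^sub>M TT. pr z (t, \<omega>) = (LINT y|\<nu>. k y * pr (a y) (t, \<omega>)))
      \<longleftrightarrow> (AE p in Q. pr z p = (LINT y|\<nu>. k y * pr (a y) p))"
    by (rule AE_swap_Q[OF sqint_measurable[OF V_sqint[OF True]]
        sqint_measurable[OF integral_profile_sqint(1)[OF assms]]])
  then show ?thesis
    unfolding TT_def[symmetric] represents_def by (simp add: pr_def)
qed (simp add: represents_def)

lemma agg_represents:
  assumes "K x \<in> sqint \<nu>" "a \<in> prof"
  shows "represents (K x) a (agg K a x)"
  unfolding graphon_aggregate_def graphon_op_def represents_iff_AE[OF assms]
  by (rule someI_ex[OF represents_exists[OF assms]])

lemma agg_V: "sym_kernel \<nu> K \<Longrightarrow> a \<in> prof \<Longrightarrow> x \<in> {0..1} \<Longrightarrow> agg K a x \<in> V"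
  using agg_represents[of K x a] sym_kernel.section_sqint[of \<nu> K x] by (simp add: represents_V)

text \<open>Rows of the kernel have L2 norm at most 1, so convergence of profiles in norm gives
  convergence of the aggregate for every single player.\<close>

lemma agg_diff_le:
  assumes K: "sym_kernel \<nu> K" and a: "a \<in> prof" "b \<in> prof" and x: "x \<in> {0..1}"
  shows "nrm (agg K a x - agg K b x) \<le> pn (a - b)"
proof -
  interpret K: sym_kernel \<nu> K by (rule K)
  have s: "K x \<in> sqint \<nu>" using x by (simp add: K.section_sqint)
  have "nrm (agg K a x - agg K b x) \<le> l2norm \<nu> (K x) * pn (a - b)"
    by (intro represents_bound represents_diff_profile agg_represents s a prof_diff)
  also have "\<dots> \<le> 1 * pn (a - b)"
    using x by (intro mult_right_mono K.section_l2norm) auto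
  finally show ?thesis by simp
qed

text \<open>The rows of the kernel are approximated by countably many of them, and the aggregate is
  Lipschitz in the row with constant \<open>pn a\<close>.\<close>

lemma agg_approximable:
  assumes K: "sym_kernel \<nu> K" and a: "a \<in> prof"
  shows "approximable V (agg K a)"
  unfolding approximable_def
proof (intro conjI allI impI)
  interpret K: sym_kernel \<nu> K by (rule K)
  fix e :: real assume e: "0 < e"
  have pos: "0 < pn a + 1" using pn_nonneg[of a] by linarith
  have s: "K x \<in> sqint \<nu>" if "x \<in> {0..1}" for x using that by (simp add: K.section_sqint)
  have "\<exists>k c. k \<in> measurable \<nu> (count_space UNIV) \<and> (\<forall>n::nat. c n \<in> space \<nu>) \<and>
    (\<forall>x\<in>space \<nu>. l2norm \<nu> (\<lambda>y. K x y - K (c (k x)) y) < e / (pn a + 1))"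
    using s e pos by (intro countable_valued_approximation K.K_measurable) auto
  then obtain k c where kc: "k \<in> measurable \<nu> (count_space UNIV)" "\<And>n::nat. c n \<in> {0..1}"
    "\<And>x. x \<in> {0..1} \<Longrightarrow> l2norm \<nu> (\<lambda>y. K x y - K (c (k x)) y) < e / (pn a + 1)"
    unfolding space_eq by blast
  have "nrm (agg K a x - agg K a (c (k x))) < e" if x: "x \<in> {0..1}" for x
  proof -
    have "nrm (agg K a x - agg K a (c (k x))) \<le> l2norm \<nu> (\<lambda>y. K x y - K (c (k x)) y) * pn a"
      using x kc(2) by (intro represents_bound represents_diff_kernel agg_represents s a sqint_diff)
    also have "\<dots> \<le> l2norm \<nu> (\<lambda>y. K x y - K (c (k x)) y) * (pn a + 1)"
      by (intro mult_left_mono) auto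
    also have "\<dots> < e" using kc(3)[OF x] pos by (simp add: pos_less_divide_eq)
    finally show ?thesis .
  qed
  then show "\<exists>k c. k \<in> measurable \<nu> (count_space UNIV) \<and> (\<forall>n::nat. c n \<in> V) \<and>
      (\<forall>x\<in>{0..1}. nrm (agg K a x - c (k x)) < e)"
    using kc agg_V[OF K a] by (intro exI[of _ k] exI[of _ "\<lambda>n. agg K a (c n)"]) auto
qed (use agg_V[OF K a] in auto)

lemma agg_diff_l2norm:
  assumes K: "sym_kernel \<nu> K" and a: "a \<in> prof" "b \<in> prof" and \<rho>: "0 \<le> \<rho>"
    and bound: "\<And>f. f \<in> sqint \<nu> \<Longrightarrow> l2norm \<nu> (\<lambda>x. LINT y|\<nu>. K x y * f y) \<le> \<rho> * l2norm \<nu> f"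
  shows "(\<lambda>x. nrm (agg K a x - agg K b x)) \<in> sqint \<nu>"
    and "l2norm \<nu> (\<lambda>x. nrm (agg K a x - agg K b x)) \<le> \<rho> * pn (a - b)"
proof -
  interpret K: sym_kernel \<nu> K by (rule K)
  have "represents (K x) (a - b) (agg K a x - agg K b x)" if "x \<in> {0..1}" for x
    using that by (intro represents_diff_profile agg_represents a K.section_sqint) auto
  from represents_family_bound[OF K bound \<rho> prof_diff[OF a] this]
  show "(\<lambda>x. nrm (agg K a x - agg K b x)) \<in> sqint \<nu>"
    "l2norm \<nu> (\<lambda>x. nrm (agg K a x - agg K b x)) \<le> \<rho> * pn (a - b)" by auto
qed

lemma agg_kernel_diff_l2norm:
  assumes K: "sym_kernel \<nu> K" "sym_kernel \<nu> L" "sym_kernel \<nu> (\<lambda>x y. K x y - L x y)"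
    and a: "a \<in> prof" and \<sigma>: "0 \<le> \<sigma>"
    and bound: "\<And>f. f \<in> sqint \<nu> \<Longrightarrow> l2norm \<nu> (\<lambda>x. LINT y|\<nu>. (K x y - L x y) * f y) \<le> \<sigma> * l2norm \<nu> f"
  shows "(\<lambda>x. nrm (agg K a x - agg L a x)) \<in> sqint \<nu>"
    and "l2norm \<nu> (\<lambda>x. nrm (agg K a x - agg L a x)) \<le> \<sigma> * pn a"
proof -
  interpret K: sym_kernel \<nu> K by (rule K)
  interpret L: sym_kernel \<nu> L by (rule K)
  have "represents (\<lambda>y. K x y - L x y) a (agg K a x - agg L a x)" if "x \<in> {0..1}" for x
    using that by (intro represents_diff_kernel agg_represents a K.section_sqint L.section_sqint) auto
  from represents_family_bound[OF K(3) bound \<sigma> a this]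
  show "(\<lambda>x. nrm (agg K a x - agg L a x)) \<in> sqint \<nu>"
    "l2norm \<nu> (\<lambda>x. nrm (agg K a x - agg L a x)) \<le> \<sigma> * pn a" by auto
qed

end


section \<open>Equilibria of graphon games\<close>

locale graphon_game =
  best_response P \<FF> Tm U A D \<alpha> l\<^sub>U l\<^sub>\<theta> M \<Lambda> + profile_space P \<FF> Tm \<nu>
  for P :: "'w measure" and \<FF> Tm U A D \<alpha> l\<^sub>U l\<^sub>\<theta> M \<Lambda> and \<nu> :: "real measure"
begin

abbreviation nash :: "(real \<Rightarrow> real \<Rightarrow> real) \<Rightarrow> 'w profile \<Rightarrow> 'w profile \<Rightarrow> bool" where
  "nash K \<theta> a \<equiv> graphon_nash P \<FF> Tm \<nu> (\<lambda>_. A) U \<theta> K a"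

lemma nash_iff: "nash K \<theta> a \<longleftrightarrow> a \<in> prof \<and> (\<forall>x\<in>{0..1}. best (agg K a x) (\<theta> x) (a x))"
  by (simp add: graphon_nash_def best_def)

lemma pn_nash_le: "nash K \<theta> a \<Longrightarrow> pn a \<le> M"
  by (rule pn_bounded) (auto simp: nash_iff M_nonneg intro!: A_bounded intro: best_A)

text \<open>Best responses picked by choice carry no measurability in the player. Being Lipschitz in
  aggregate and heterogeneity, they are approximable, so they have a jointly measurable version;
  optimality survives because it does not distinguish representatives.\<close>

lemma best_response_profile:
  assumes K: "sym_kernel \<nu> K" and \<theta>: "\<theta> \<in> prof" and a: "a \<in> prof"
  shows "\<exists>b\<in>prof. \<forall>x\<in>{0..1}. best (agg K a x) (\<theta> x) (b x)"
proof -
  define G where "G z \<eta> = (SOME b. best z \<eta> b)" for z \<eta>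
  have G: "best z \<eta> (G z \<eta>)" if "z \<in> V" "\<eta> \<in> V" for z \<eta>
    unfolding G_def by (rule someI_ex[OF best_exists[OF that]])
  have \<theta>approximable: "approximable V \<theta>" using \<theta> by (intro joint_approximable) (auto simp: prof_joint prof_V)
  \<comment> \<open>The summand 1 makes the constant positive, as \<open>approximable_map2\<close>
    requires.\<close>
  let ?C = "(l\<^sub>U + l\<^sub>\<theta> + 1) / \<alpha>"
  have "approximable V (\<lambda>x. G (agg K a x) (\<theta> x))"
  proof (rule approximable_map2[OF agg_approximable[OF K a] \<theta>approximable])
    show "G u v \<in> V" if "u \<in> V" "v \<in> V" for u v
      using best_V[OF G[OF that]] .
    show "nrm (G u v - G u' v') \<le> ?C * (nrm (u - u') + nrm (v - v'))"
      if V: "u \<in> V" "v \<in> V" "u' \<in> V" "v' \<in> V" for u v u' v'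
    proof -
      have "\<alpha> * nrm (G u v - G u' v') \<le> l\<^sub>U * nrm (u - u') + l\<^sub>\<theta> * nrm (v - v')"
        by (rule best_lipschitz[OF G G]) (use V in auto)
      also have "\<dots> \<le> (l\<^sub>U + l\<^sub>\<theta> + 1) * nrm (u - u') + (l\<^sub>U + l\<^sub>\<theta> + 1) * nrm (v - v')"
        using l\<^sub>U_nonneg l\<^sub>\<theta>_nonneg by (intro add_mono mult_right_mono) auto
      finally have "nrm (G u v - G u' v') * \<alpha> \<le> (l\<^sub>U + l\<^sub>\<theta> + 1) * (nrm (u - u') + nrm (v - v'))"
        by (simp only: distrib_left mult.commute)
      then show ?thesis
        unfolding times_divide_eq_left using \<alpha>_pos by (simp only: pos_le_divide_eq)
    qed
    show "0 < ?C" using l\<^sub>U_nonneg l\<^sub>\<theta>_nonneg \<alpha>_pos by simp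
  qed
  from approximable_joint_version[OF this] obtain b where b: "joint b"
    "\<And>x. x \<in> {0..1} \<Longrightarrow> b x \<in> V" "\<And>x. x \<in> {0..1} \<Longrightarrow> nrm (G (agg K a x) (\<theta> x) - b x) = 0"
    by blast
  have best: "best (agg K a x) (\<theta> x) (b x)" if x: "x \<in> {0..1}" for x
  proof -
    have V: "agg K a x \<in> V" "\<theta> x \<in> V" using agg_V[OF K a x] prof_V[OF \<theta> x] .
    show ?thesis
      by (rule best_equiv[OF G[OF V] b(2)[OF x] V(1,1) V(2,2) b(3)[OF x]]) auto
  qed
  moreover have "b \<in> prof"
    using b best by (intro profI_bounded[where B = M] A_bounded) (auto intro: best_A)
  ultimately show ?thesis by blast
qed

text \<open>
  Aggregates of a Cauchy sequence of profiles converge for every player, not just for almost every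
  one, and so do the best responses to them; hence the limit is optimal for every single player.
\<close>

theorem graphon_equilibrium_exists:
  assumes K: "sym_kernel \<nu> K" and \<theta>: "\<theta> \<in> prof" and \<rho>: "0 \<le> \<rho>" "l\<^sub>U * \<rho> < \<alpha>"
    and bound: "\<And>f. f \<in> sqint \<nu> \<Longrightarrow> l2norm \<nu> (\<lambda>x. LINT y|\<nu>. K x y * f y) \<le> \<rho> * l2norm \<nu> f"
  shows "\<exists>a. nash K \<theta> a"
proof -
  define nx where "nx a = (SOME b. b \<in> prof \<and> (\<forall>x\<in>{0..1}. best (agg K a x) (\<theta> x) (b x)))" for a
  have "nx a \<in> prof \<and> (\<forall>x\<in>{0..1}. best (agg K a x) (\<theta> x) (nx a x))" if "a \<in> prof" for a
  proof -
    have "\<exists>b. b \<in> prof \<and> (\<forall>x\<in>{0..1}. best (agg K a x) (\<theta> x) (b x))"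
      using best_response_profile[OF K \<theta> that] by blast
    from someI_ex[OF this] show ?thesis unfolding nx_def .
  qed
  then have nx: "nx a \<in> prof" "\<And>x. x \<in> {0..1} \<Longrightarrow> best (agg K a x) (\<theta> x) (nx a x)"
    if "a \<in> prof" for a using that by blast+
  obtain a0 where a0: "a0 \<in> A" using A_ne by blast
  define a where "a n = (nx ^^ n) (\<lambda>_. a0)" for n
  have ap: "a n \<in> prof" for n
  proof (induction n)
    case 0
    have "joint (\<lambda>_. a0)"
      using joint_countable_valued[of "\<lambda>_. 0" "\<lambda>_. a0"] A_V[OF a0] by simp
    then have "(\<lambda>_. a0) \<in> prof"
      using A_V[OF a0] A_bounded[OF a0] by (intro profI_bounded[where B = M]) auto
    then show ?case by (simp add: a_def)
  qed (simp add: a_def nx)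
  have ab: "best (agg K (a n) x) (\<theta> x) (a (Suc n) x)" if "x \<in> {0..1}" for n x
    using nx(2)[OF ap that, of n] by (simp add: a_def)
  have zV: "agg K (a n) x \<in> V" "\<theta> x \<in> V" if "x \<in> {0..1}" for n x
    using agg_V[OF K ap that] prof_V[OF \<theta> that] .
  have pt: "nrm (a (Suc (Suc n)) x - a (Suc n) x)
      \<le> l\<^sub>U / \<alpha> * nrm (agg K (a (Suc n)) x - agg K (a n) x)" if x: "x \<in> {0..1}" for n x
    using best_lipschitz[OF ab[OF x] ab[OF x] zV[OF x] zV[OF x], of "Suc n" n] \<alpha>_pos
    by (simp add: pos_le_divide_eq mult.commute)
  define q where "q = l\<^sub>U * \<rho> / \<alpha>"
  have q: "0 \<le> q" "q < 1"
    using \<rho> \<alpha>_pos l\<^sub>U_nonneg unfolding q_def by auto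
  define c0 where "c0 = pn (a 1 - a 0)"
  have geo: "pn (a (Suc n) - a n) \<le> c0 * q ^ n" for n
  proof (induction n)
    case 0
    show ?case unfolding c0_def One_nat_def power_0 mult_1_right by (rule order_refl)
  next
    case (Suc n)
    note z = agg_diff_l2norm[OF K ap[of "Suc n"] ap[of n] \<rho>(1) bound]
    have "pn (a (Suc (Suc n)) - a (Suc n))
        \<le> l2norm \<nu> (\<lambda>x. l\<^sub>U / \<alpha> * nrm (agg K (a (Suc n)) x - agg K (a n) x))"
      using pt by (intro pn_le prof_diff ap sqint_scale z(1)) auto
    also have "\<dots> \<le> l\<^sub>U / \<alpha> * (\<rho> * pn (a (Suc n) - a n))"
      unfolding l2norm_scale using z(2) \<alpha>_pos l\<^sub>U_nonneg by (simp add: mult_left_mono divide_right_mono)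
    also have "\<dots> = q * pn (a (Suc n) - a n)" by (simp add: q_def)
    also have "\<dots> \<le> q * (c0 * q ^ n)" by (intro mult_left_mono Suc.IH q(1))
    finally show ?case by (simp only: power_Suc mult.left_commute)
  qed
  define c where "c n = l\<^sub>U / \<alpha> * (c0 * q ^ n)" for n
  have cs: "summable c"
    unfolding c_def using q by (intro summable_mult summable_geometric) auto
  have step: "nrm (a (Suc (Suc n)) x - a (Suc n) x) \<le> c n" if x: "x \<in> {0..1}" for n x
  proof -
    have "nrm (agg K (a (Suc n)) x - agg K (a n) x) \<le> c0 * q ^ n"
      by (rule order_trans[OF agg_diff_le[OF K ap ap x] geo])
    then have "l\<^sub>U / \<alpha> * nrm (agg K (a (Suc n)) x - agg K (a n) x) \<le> c n"
      unfolding c_def using \<alpha>_pos l\<^sub>U_nonneg by (intro mult_left_mono) auto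
    with pt[OF x, of n] show ?thesis by linarith
  qed
  \<comment> \<open>The pointwise step estimate compares two best responses, so the sequence is
    taken from index 1 on, without the arbitrary starting profile.\<close>
  define b where "b x = plim (\<lambda>n. a (Suc n) x)" for x
  note lim = V_fast_limit[where b = "\<lambda>n. a (Suc n) x" and c = c for x, OF prof_V[OF ap] step cs, folded b_def]
  have bA: "b x \<in> A" if x: "x \<in> {0..1}" for x
    by (rule A_limit[OF best_A[OF ab[OF x]] lim(1)[OF x x] lim(3)[OF x x]])
  have bp: "b \<in> prof"
  proof (rule profI_bounded[where B = M])
    show "joint b"
      unfolding b_def by (intro joint_plim prof_joint ap)
  qed (use bA A_V A_bounded in auto)
  have "pn (a (Suc n) - b) \<le> (\<Sum>i. c (i + n))" for n
  proof (rule pn_bounded)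
    show "nrm ((a (Suc n) - b) x) \<le> (\<Sum>i. c (i + n))" if "x \<in> {0..1}" for x
      using lim(2)[OF that that, of n] by simp
    from order_trans[OF nrm_nonneg this[of 0]] show "0 \<le> (\<Sum>i. c (i + n))" by simp
  qed (intro prof_diff ap bp)
  then have pl: "(\<lambda>n. pn (a (Suc n) - b)) \<longlonglongrightarrow> 0"
    by (intro tendsto_sandwich[OF _ _ tendsto_const tendsto_tail_suminf[OF cs]]) auto
  have "best (agg K b x) (\<theta> x) (b x)" if x: "x \<in> {0..1}" for x
  proof (rule best_limit[where z = "\<lambda>n. agg K (a (Suc n)) x" and \<eta> = "\<lambda>n. \<theta> x"
        and b = "\<lambda>n. a (Suc (Suc n)) x"])
    show "(\<lambda>n. nrm (agg K (a (Suc n)) x - agg K b x)) \<longlonglongrightarrow> 0"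
      using agg_diff_le[OF K ap bp x]
      by (intro tendsto_sandwich[OF _ _ tendsto_const pl]) auto
    show "(\<lambda>n. nrm (a (Suc (Suc n)) x - b x)) \<longlonglongrightarrow> 0"
      using LIMSEQ_Suc[OF lim(3)[OF x x]] .
  qed (use ab zV agg_V[OF K bp] bp prof_V x in auto)
  then show ?thesis using bp nash_iff by blast
qed

section \<open>Stability of equilibria and of the welfare\<close>

definition welfare :: "(real \<Rightarrow> real \<Rightarrow> real) \<Rightarrow> 'w profile \<Rightarrow> 'w profile \<Rightarrow> real" where
  "welfare K \<theta> a = (LINT x|\<nu>. U (a x) (agg K a x) (\<theta> x))"

lemma utility_integrable:
  assumes K: "sym_kernel \<nu> K" and \<theta>: "\<theta> \<in> prof" and a: "nash K \<theta> a"
  shows "integrable \<nu> (\<lambda>x. U (a x) (agg K a x) (\<theta> x))"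
proof -
  have ap: "a \<in> prof" and aA: "\<And>x. x \<in> {0..1} \<Longrightarrow> a x \<in> A"
    using a by (auto simp: nash_iff intro: best_A)
  have asm: "approximable A a" using ap aA A_sub by (intro joint_approximable prof_joint)
  have \<theta>approximable: "approximable V \<theta>" using \<theta> by (intro joint_approximable) (auto simp: prof_joint prof_V)
  have m: "(\<lambda>x. U (a x) (agg K a x) (\<theta> x)) \<in> borel_measurable \<nu>"
    by (rule approximable_map3_measurable[OF asm agg_approximable[OF K ap] \<theta>approximable U_lipschitz \<Lambda>_nonneg])
  obtain a0 where a0: "a0 \<in> A" using A_ne by blast
  let ?B = "\<lambda>x. \<bar>U a0 0 0\<bar> + \<Lambda> * (2 * M + pn a + nrm (\<theta> x))"
  have le: "\<bar>U (a x) (agg K a x) (\<theta> x)\<bar> \<le> ?B x" if x: "x \<in> {0..1}" for x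
  proof -
    have "nrm (agg K a x) \<le> pn a"
    proof -
      interpret K: sym_kernel \<nu> K by (rule K)
      have "nrm (agg K a x) \<le> l2norm \<nu> (K x) * pn a"
        using x by (intro represents_bound[OF agg_represents[OF _ ap] _ ap] K.section_sqint) auto
      also have "\<dots> \<le> 1 * pn a" using x by (intro mult_right_mono K.section_l2norm) auto
      finally show ?thesis by simp
    qed
    have "\<bar>U (a x) (agg K a x) (\<theta> x) - U a0 0 0\<bar>
        \<le> \<Lambda> * (nrm (a x - a0) + nrm (agg K a x - 0) + nrm (\<theta> x - 0))"
      using x by (intro U_lipschitz aA a0 zero_V agg_V[OF K ap] prof_V[OF \<theta>])
    also have "\<dots> \<le> \<Lambda> * (2 * M + pn a + nrm (\<theta> x))"
      using nrm_diff_A[OF aA[OF x] a0] \<open>nrm (agg K a x) \<le> pn a\<close> \<Lambda>_nonneg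
      by (intro mult_left_mono add_mono) auto
    finally show ?thesis by linarith
  qed
  have "integrable \<nu> ?B"
    using sqint_integrable[OF prof_nrm_sqint[OF \<theta>]] by simp
  then show ?thesis
  proof (rule Bochner_Integration.integrable_bound[OF _ m])
    show "AE x in \<nu>. norm (U (a x) (agg K a x) (\<theta> x)) \<le> norm (?B x)"
    proof (rule AE_I2)
      fix x assume "x \<in> space \<nu>"
      then have "\<bar>U (a x) (agg K a x) (\<theta> x)\<bar> \<le> ?B x" by (intro le) simp
      then show "norm (U (a x) (agg K a x) (\<theta> x)) \<le> norm (?B x)" by simp
    qed
  qed
qed

section \<open>Comparison of two games\<close>

context
  fixes K\<^sub>1 K\<^sub>2 :: "real \<Rightarrow> real \<Rightarrow> real" and \<theta>\<^sub>1 \<theta>\<^sub>2 a\<^sub>1 a\<^sub>2 :: "'w profile" and \<rho> \<sigma> :: real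
  assumes K: "sym_kernel \<nu> K\<^sub>1" "sym_kernel \<nu> K\<^sub>2" "sym_kernel \<nu> (\<lambda>x y. K\<^sub>1 x y - K\<^sub>2 x y)"
    and \<rho>: "0 \<le> \<rho>" "l\<^sub>U * \<rho> < \<alpha>" and \<sigma>: "0 \<le> \<sigma>"
    and \<rho>_bound: "\<And>f. f \<in> sqint \<nu> \<Longrightarrow> l2norm \<nu> (\<lambda>x. LINT y|\<nu>. K\<^sub>1 x y * f y) \<le> \<rho> * l2norm \<nu> f"
    and \<sigma>_bound: "\<And>f. f \<in> sqint \<nu> \<Longrightarrow> l2norm \<nu> (\<lambda>x. LINT y|\<nu>. (K\<^sub>1 x y - K\<^sub>2 x y) * f y) \<le> \<sigma> * l2norm \<nu> f"
    and \<theta>: "\<theta>\<^sub>1 \<in> prof" "\<theta>\<^sub>2 \<in> prof"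
    and a: "nash K\<^sub>1 \<theta>\<^sub>1 a\<^sub>1" "nash K\<^sub>2 \<theta>\<^sub>2 a\<^sub>2"
begin

text \<open>The difference of aggregates split into a change of profile under
  \<open>K\<^sub>1\<close>, where the bound \<open>\<rho>\<close> applies, and a change of kernel at
  \<open>a\<^sub>2\<close>, where \<open>\<sigma>\<close> applies. Thus no operator bound on
  \<open>K\<^sub>2\<close> enters.\<close>

definition zdiff :: "real \<Rightarrow> real" where
  "zdiff x = nrm (agg K\<^sub>1 a\<^sub>1 x - agg K\<^sub>1 a\<^sub>2 x) + nrm (agg K\<^sub>1 a\<^sub>2 x - agg K\<^sub>2 a\<^sub>2 x)"

lemma nash_prof: "a\<^sub>1 \<in> prof" "a\<^sub>2 \<in> prof"
  using a by (auto simp: nash_iff)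

lemma zdiff_sqint: "zdiff \<in> sqint \<nu>"
  and zdiff_l2norm: "l2norm \<nu> zdiff \<le> \<rho> * pn (a\<^sub>1 - a\<^sub>2) + \<sigma> * M"
proof -
  note u = agg_diff_l2norm[OF K(1) nash_prof \<rho>(1) \<rho>_bound]
  note v = agg_kernel_diff_l2norm[OF K nash_prof(2) \<sigma> \<sigma>_bound]
  show "zdiff \<in> sqint \<nu>" unfolding zdiff_def[abs_def] by (rule sqint_add[OF u(1) v(1)])
  have "l2norm \<nu> zdiff \<le> \<rho> * pn (a\<^sub>1 - a\<^sub>2) + \<sigma> * pn a\<^sub>2"
    unfolding zdiff_def[abs_def] using l2norm_triangle[OF u(1) v(1)] u(2) v(2) by linarith
  also have "\<dots> \<le> \<rho> * pn (a\<^sub>1 - a\<^sub>2) + \<sigma> * M"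
    using pn_nash_le[OF a(2)] \<sigma> by (intro add_left_mono mult_left_mono)
  finally show "l2norm \<nu> zdiff \<le> \<rho> * pn (a\<^sub>1 - a\<^sub>2) + \<sigma> * M" .
qed

lemma agg_zdiff:
  assumes x: "x \<in> {0..1}"
  shows "nrm (agg K\<^sub>1 a\<^sub>1 x - agg K\<^sub>2 a\<^sub>2 x) \<le> zdiff x"
  unfolding zdiff_def
  by (intro nrm_triangle agg_V[OF K(1) _ x] agg_V[OF K(2) _ x] nash_prof)

text \<open>The Lipschitz estimate for best responses, taken in L2 over the players, bounds the
  distance of the equilibria by a multiple of itself plus the errors. The contraction condition
  allows the multiple to be absorbed on the left.\<close>

theorem equilibrium_stability:
  "(\<alpha> - l\<^sub>U * \<rho>) * pn (a\<^sub>1 - a\<^sub>2) \<le> l\<^sub>U * M * \<sigma> + l\<^sub>\<theta> * pn (\<theta>\<^sub>1 - \<theta>\<^sub>2)"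
proof -
  have ts: "(\<lambda>x. nrm ((\<theta>\<^sub>1 - \<theta>\<^sub>2) x)) \<in> sqint \<nu>" by (intro prof_nrm_sqint prof_diff \<theta>)
  let ?f = "\<lambda>x. l\<^sub>U / \<alpha> * zdiff x + l\<^sub>\<theta> / \<alpha> * nrm ((\<theta>\<^sub>1 - \<theta>\<^sub>2) x)"
  have "pn (a\<^sub>1 - a\<^sub>2) \<le> l2norm \<nu> ?f"
  proof (rule pn_le)
    show "a\<^sub>1 - a\<^sub>2 \<in> prof" by (intro prof_diff nash_prof)
    show "?f \<in> sqint \<nu>" by (rule sqint_lincomb[OF zdiff_sqint ts])
    fix x :: real assume x: "x \<in> {0..1}"
    have "\<alpha> * nrm (a\<^sub>1 x - a\<^sub>2 x) \<le> l\<^sub>U * nrm (agg K\<^sub>1 a\<^sub>1 x - agg K\<^sub>2 a\<^sub>2 x) + l\<^sub>\<theta> * nrm (\<theta>\<^sub>1 x - \<theta>\<^sub>2 x)"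
      using a x by (intro best_lipschitz agg_V[OF K(1) _ x] agg_V[OF K(2) _ x] nash_prof prof_V[OF \<theta>(1) x] prof_V[OF \<theta>(2) x])
        (auto simp: nash_iff)
    also have "\<dots> \<le> l\<^sub>U * zdiff x + l\<^sub>\<theta> * nrm (\<theta>\<^sub>1 x - \<theta>\<^sub>2 x)"
      using agg_zdiff[OF x] l\<^sub>U_nonneg by (intro add_right_mono mult_left_mono)
    finally show "nrm ((a\<^sub>1 - a\<^sub>2) x) \<le> ?f x"
      using \<alpha>_pos by (simp add: add_divide_distrib[symmetric] pos_le_divide_eq mult.commute)
  qed
  also have "\<dots> \<le> l\<^sub>U / \<alpha> * l2norm \<nu> zdiff + l\<^sub>\<theta> / \<alpha> * pn (\<theta>\<^sub>1 - \<theta>\<^sub>2)"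
    using l2norm_triangle[OF sqint_scale[OF zdiff_sqint] sqint_scale[OF ts], of "l\<^sub>U / \<alpha>" "l\<^sub>\<theta> / \<alpha>"]
      \<alpha>_pos l\<^sub>U_nonneg l\<^sub>\<theta>_nonneg
    unfolding l2norm_scale pn_eq by simp
  also have "\<dots> \<le> l\<^sub>U / \<alpha> * (\<rho> * pn (a\<^sub>1 - a\<^sub>2) + \<sigma> * M) + l\<^sub>\<theta> / \<alpha> * pn (\<theta>\<^sub>1 - \<theta>\<^sub>2)"
    using zdiff_l2norm \<alpha>_pos l\<^sub>U_nonneg by (intro add_right_mono mult_left_mono) auto
  finally have "\<alpha> * pn (a\<^sub>1 - a\<^sub>2)
      \<le> \<alpha> * (l\<^sub>U / \<alpha> * (\<rho> * pn (a\<^sub>1 - a\<^sub>2) + \<sigma> * M) + l\<^sub>\<theta> / \<alpha> * pn (\<theta>\<^sub>1 - \<theta>\<^sub>2))"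
    using \<alpha>_pos by (intro mult_left_mono) auto
  also have "\<dots> = l\<^sub>U * (\<rho> * pn (a\<^sub>1 - a\<^sub>2) + \<sigma> * M) + l\<^sub>\<theta> * pn (\<theta>\<^sub>1 - \<theta>\<^sub>2)"
    using \<alpha>_pos by (simp add: distrib_left)
  finally show ?thesis by (simp add: algebra_simps)
qed

text \<open>The Lipschitz bound for \<open>U\<close> is integrated over the players. The quotient is
  the bound for the distance of the equilibria; \<open>1 + \<rho>\<close> counts its effect on
  actions and aggregates, \<open>M\<close> stems from the change of kernel acting on an equilibrium,
  and 1 from the heterogeneities.\<close>

theorem welfare_stability:
  "\<bar>welfare K\<^sub>1 \<theta>\<^sub>1 a\<^sub>1 - welfare K\<^sub>2 \<theta>\<^sub>2 a\<^sub>2\<bar>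
    \<le> \<Lambda> * ((1 + \<rho>) * ((l\<^sub>U * M + l\<^sub>\<theta>) / (\<alpha> - l\<^sub>U * \<rho>)) + M + 1) * max \<sigma> (pn (\<theta>\<^sub>1 - \<theta>\<^sub>2))"
proof -
  let ?m = "max \<sigma> (pn (\<theta>\<^sub>1 - \<theta>\<^sub>2))" and ?d = "\<alpha> - l\<^sub>U * \<rho>"
  have d: "0 < ?d" using \<rho> by simp
  have m: "\<sigma> \<le> ?m" "pn (\<theta>\<^sub>1 - \<theta>\<^sub>2) \<le> ?m" "0 \<le> ?m" using \<sigma> by auto
  have "?d * pn (a\<^sub>1 - a\<^sub>2) \<le> l\<^sub>U * M * ?m + l\<^sub>\<theta> * ?m"
    using equilibrium_stability m l\<^sub>U_nonneg l\<^sub>\<theta>_nonneg M_nonneg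
      mult_left_mono[OF m(1), of "l\<^sub>U * M"] mult_left_mono[OF m(2), of l\<^sub>\<theta>] by simp
  then have e: "pn (a\<^sub>1 - a\<^sub>2) \<le> (l\<^sub>U * M + l\<^sub>\<theta>) / ?d * ?m"
    using d by (simp add: pos_le_divide_eq distrib_right mult.commute)
  have ts: "(\<lambda>x. nrm ((\<theta>\<^sub>1 - \<theta>\<^sub>2) x)) \<in> sqint \<nu>" by (intro prof_nrm_sqint prof_diff \<theta>)
  have as: "(\<lambda>x. nrm ((a\<^sub>1 - a\<^sub>2) x)) \<in> sqint \<nu>" by (intro prof_nrm_sqint prof_diff nash_prof)
  let ?f = "\<lambda>x. nrm ((a\<^sub>1 - a\<^sub>2) x) + zdiff x + nrm ((\<theta>\<^sub>1 - \<theta>\<^sub>2) x)"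
  have fs: "?f \<in> sqint \<nu>" by (intro sqint_add as zdiff_sqint ts)
  note i = utility_integrable[OF K(1) \<theta>(1) a(1)] utility_integrable[OF K(2) \<theta>(2) a(2)]
  let ?u = "\<lambda>x. U (a\<^sub>1 x) (agg K\<^sub>1 a\<^sub>1 x) (\<theta>\<^sub>1 x) - U (a\<^sub>2 x) (agg K\<^sub>2 a\<^sub>2 x) (\<theta>\<^sub>2 x)"
  have "\<bar>welfare K\<^sub>1 \<theta>\<^sub>1 a\<^sub>1 - welfare K\<^sub>2 \<theta>\<^sub>2 a\<^sub>2\<bar> = \<bar>LINT x|\<nu>. ?u x\<bar>"
    unfolding welfare_def using i by simp
  also have "\<dots> \<le> (LINT x|\<nu>. \<bar>?u x\<bar>)" by (rule integral_abs_bound)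
  also have "\<dots> \<le> (LINT x|\<nu>. \<Lambda> * ?f x)"
  proof (rule integral_mono)
    show "integrable \<nu> (\<lambda>x. \<bar>?u x\<bar>)" using i by simp
    show "integrable \<nu> (\<lambda>x. \<Lambda> * ?f x)" using sqint_integrable[OF fs] by simp
    fix x assume "x \<in> space \<nu>"
    then have x: "x \<in> {0..1}" by simp
    have "\<bar>?u x\<bar> \<le> \<Lambda> * (nrm (a\<^sub>1 x - a\<^sub>2 x) + nrm (agg K\<^sub>1 a\<^sub>1 x - agg K\<^sub>2 a\<^sub>2 x) + nrm (\<theta>\<^sub>1 x - \<theta>\<^sub>2 x))"
      using a x by (intro U_lipschitz agg_V[OF K(1) _ x] agg_V[OF K(2) _ x] nash_prof prof_V[OF \<theta>(1) x] prof_V[OF \<theta>(2) x])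
        (auto simp: nash_iff intro: best_A)
    also have "\<dots> \<le> \<Lambda> * ?f x"
      using agg_zdiff[OF x] \<Lambda>_nonneg by (intro mult_left_mono) auto
    finally show "\<bar>?u x\<bar> \<le> \<Lambda> * ?f x" .
  qed
  also have "\<dots> = \<Lambda> * (LINT x|\<nu>. ?f x)" by simp
  also have "(LINT x|\<nu>. ?f x) \<le> (LINT x|\<nu>. \<bar>?f x\<bar>)"
    using sqint_integrable[OF fs] by (intro integral_mono) auto
  also have "\<dots> \<le> l2norm \<nu> ?f"
    using integral_abs_le_l2norm[OF fs] by simp
  also have "\<dots> \<le> pn (a\<^sub>1 - a\<^sub>2) + l2norm \<nu> zdiff + pn (\<theta>\<^sub>1 - \<theta>\<^sub>2)"
    using l2norm_triangle[OF sqint_add[OF as zdiff_sqint] ts] l2norm_triangle[OF as zdiff_sqint]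
    unfolding pn_eq by linarith
  also have "\<dots> \<le> (1 + \<rho>) * pn (a\<^sub>1 - a\<^sub>2) + \<sigma> * M + pn (\<theta>\<^sub>1 - \<theta>\<^sub>2)"
    using zdiff_l2norm by (simp add: distrib_right)
  also have "\<dots> \<le> (1 + \<rho>) * ((l\<^sub>U * M + l\<^sub>\<theta>) / ?d * ?m) + ?m * M + ?m"
    using e m \<rho> M_nonneg by (intro add_mono mult_left_mono mult_right_mono) auto
  also have "\<dots> = ((1 + \<rho>) * ((l\<^sub>U * M + l\<^sub>\<theta>) / ?d) + M + 1) * ?m"
    by (simp only: distrib_right mult.assoc mult_1 mult.commute[of M])
  finally show ?thesis
    using \<Lambda>_nonneg by (simp add: mult_left_mono mult.assoc)
qed

end

end


section \<open>Step objects\<close>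

lemma cell_exists:
  assumes N: "1 \<le> N" and x: "x \<in> {0..1}"
  shows "\<exists>i\<in>{1..N}. x \<in> cell N i"
proof (cases "x < (real N - 1) / real N")
  case True
  have pos: "0 < real N" using N by simp
  have "0 \<le> x * real N" using x by simp
  then have "real (nat \<lfloor>x * real N\<rfloor>) \<le> x * real N" "x * real N < real (nat \<lfloor>x * real N\<rfloor>) + 1"
    by linarith+
  then obtain n :: nat where fl: "real n \<le> x * real N" "x * real N < real n + 1" by blast
  \<comment> \<open>\<open>n\<close> is the integer part of \<open>x * real N\<close>; the shift by
    one is due to labels starting at 1.\<close>
  let ?i = "Suc n"
  have "x * real N < real N - 1" using True pos by (simp add: pos_less_divide_eq)
  with fl have "?i < N" by linarith
  moreover have "x \<in> cell N ?i"
    using \<open>?i < N\<close> fl pos by (simp add: cell_def pos_divide_le_eq pos_less_divide_eq)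
  ultimately show ?thesis by (intro bexI[of _ ?i]) auto
next
  case False
  then have "x \<in> cell N N" using x by (simp add: cell_def)
  then show ?thesis using N by (intro bexI[of _ N]) auto
qed

lemma cell_bounds:
  assumes "i \<in> {1..N}" "x \<in> cell N i"
  shows "(real i - 1) / real N \<le> x" "x \<le> real i / real N" "i < N \<Longrightarrow> x < real i / real N"
  using assms by (auto simp: cell_def split: if_splits)

lemma cell_unique:
  assumes i: "i \<in> {1..N}" "x \<in> cell N i" and j: "j \<in> {1..N}" "x \<in> cell N j"
  shows "i = j"
proof -
  have False if "a < b" "a \<in> {1..N}" "b \<in> {1..N}" "x \<in> cell N a" "x \<in> cell N b" for a b
  proof -
    have "x < real a / real N" using cell_bounds(3)[OF that(2,4)] that by simp
    also have "\<dots> \<le> (real b - 1) / real N" using that(1) by (intro divide_right_mono) auto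
    also have "\<dots> \<le> x" by (rule cell_bounds(1)[OF that(3,5)])
    finally show False by simp
  qed
  then have "\<not> i < j" "\<not> j < i" using i j by blast+
  then show ?thesis by simp
qed

lemma cell_index:
  assumes "1 \<le> N" "x \<in> {0..1}"
  shows "cell_index N x \<in> {1..N}" "x \<in> cell N (cell_index N x)"
proof -
  obtain i where i: "i \<in> {1..N}" "x \<in> cell N i" using cell_exists[OF assms] by blast
  have "\<exists>!i. i \<in> {1..N} \<and> x \<in> cell N i"
  proof (rule ex1I[of _ i])
    fix j assume "j \<in> {1..N} \<and> x \<in> cell N j"
    then show "j = i" using cell_unique[OF _ _ i] by blast
  qed (use i in blast)
  from theI'[OF this] show "cell_index N x \<in> {1..N}" "x \<in> cell N (cell_index N x)"
    unfolding cell_index_def by blast+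
qed

lemma cell_index_eq:
  assumes "i \<in> {1..N}" "x \<in> cell N i"
  shows "cell_index N x = i"
  unfolding cell_index_def
proof (rule the_equality)
  fix j assume "j \<in> {1..N} \<and> x \<in> cell N j"
  then show "j = i" using cell_unique[OF _ _ assms] by blast
qed (use assms in simp)

lemma cell_subset: "i \<in> {1..N} \<Longrightarrow> cell N i \<subseteq> {0..1}"
proof
  fix x assume i: "i \<in> {1..N}" and x: "x \<in> cell N i"
  have "0 \<le> (real i - 1) / real N" "real i / real N \<le> 1" using i by auto
  then show "x \<in> {0..1}" using cell_bounds(1,2)[OF i x] by auto
qed

lemma left_end_cell: "i \<in> {1..N} \<Longrightarrow> (real i - 1) / real N \<in> cell N i"
  by (auto simp: cell_def divide_strict_right_mono divide_right_mono)

lemma cell_sets_borel: "cell N i \<in> sets borel"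
  by (simp add: cell_def)

lemma cell_sets_leb: "i \<in> {1..N} \<Longrightarrow> cell N i \<in> sets (lebesgue_on {0..1})"
  using cell_subset[of i N] cell_sets_borel[of N i] by (simp add: sets_restrict_space_iff)

lemma cell_index_measurable:
  assumes N: "1 \<le> N"
  shows "cell_index N \<in> measurable (lebesgue_on {0..1}) (count_space UNIV)"
  unfolding measurable_count_space_eq2_countable
proof (intro conjI ballI)
  fix i :: nat
  have "cell_index N -` {i} \<inter> {0..1} = (if i \<in> {1..N} then cell N i else {})"
  proof (intro set_eqI iffI)
    fix x assume "x \<in> cell_index N -` {i} \<inter> {0..1}"
    then have "x \<in> {0..1}" "cell_index N x = i" by auto
    with cell_index[OF N this(1)] show "x \<in> (if i \<in> {1..N} then cell N i else {})" by simp
  next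
    fix x assume "x \<in> (if i \<in> {1..N} then cell N i else {})"
    then have "i \<in> {1..N}" "x \<in> cell N i" by (auto split: if_splits)
    then show "x \<in> cell_index N -` {i} \<inter> {0..1}"
      using cell_index_eq[of i N x] cell_subset[of i N] by auto
  qed
  then show "cell_index N -` {i} \<inter> space (lebesgue_on {0..1}) \<in> sets (lebesgue_on {0..1})"
    using cell_sets_leb[of i N] by simp
qed simp

section \<open>Integrals and kernels that are constant on cells\<close>

context lebesgue_extension
begin

lemma cell_index_measurable': "1 \<le> N \<Longrightarrow> cell_index N \<in> measurable \<nu> (count_space UNIV)"
  by (rule leb_measurable[OF cell_index_measurable])

lemma leb_interval_measure:
  assumes "S \<in> sets borel" "S \<subseteq> {0..1}"
  shows "S \<in> sets \<nu>" and "measure \<nu> S = measure lborel S"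
proof -
  have S: "S \<in> sets leb01" using assms by (simp add: sets_restrict_space_iff)
  then show "S \<in> sets \<nu>" using leb_subalgebra by (auto simp: subalgebra_def)
  have "emeasure \<nu> S = emeasure leb01 S" using ext S by (simp add: extends_lebesgue_01_def)
  also have "\<dots> = emeasure lborel S"
    using assms by (simp add: emeasure_restrict_space)
  finally show "measure \<nu> S = measure lborel S" by (simp add: measure_def)
qed

lemma measure_cell: "i \<in> {1..N} \<Longrightarrow> measure \<nu> (cell N i) = 1 / real N"
proof -
  assume i: "i \<in> {1..N}"
  then have "measure lborel (cell N i) = 1 / real N"
    by (auto simp: cell_def diff_divide_distrib divide_right_mono split: if_splits)
  then show ?thesis
    using leb_interval_measure(2)[OF cell_sets_borel cell_subset[OF i]] by simp
qed

lemma integral_step: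
  fixes f :: "nat \<Rightarrow> real"
  assumes N: "1 \<le> N"
  shows "(LINT x|\<nu>. f (cell_index N x)) = (1 / real N) * (\<Sum>i\<in>{1..N}. f i)"
proof -
  have c: "cell N i \<in> sets \<nu>" if "i \<in> {1..N}" for i
    using leb_interval_measure(1)[OF cell_sets_borel cell_subset[OF that]] .
  have "(LINT x|\<nu>. f (cell_index N x)) = (LINT x|\<nu>. (\<Sum>i\<in>{1..N}. f i * indicator (cell N i) x))"
  proof (rule Bochner_Integration.integral_cong)
    fix x assume "x \<in> space \<nu>"
    then have x: "x \<in> {0..1}" by simp
    have "(\<Sum>i\<in>{1..N}. f i * indicator (cell N i) x) = (\<Sum>i\<in>{1..N}. if cell_index N x = i then f i else 0)"
      using cell_index_eq[of _ N x] cell_index(2)[OF N x] by (intro sum.cong) (auto simp: indicator_def)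
    also have "\<dots> = f (cell_index N x)" using cell_index(1)[OF N x] by simp
    finally show "f (cell_index N x) = (\<Sum>i\<in>{1..N}. f i * indicator (cell N i) x)" by simp
  qed simp
  also have "\<dots> = (\<Sum>i\<in>{1..N}. f i * measure \<nu> (cell N i))"
    using c cell_subset
    by (subst Bochner_Integration.integral_sum) (auto simp: emeasure_eq_measure Int_absorb2 intro!: sum.cong)
  also have "\<dots> = (\<Sum>i\<in>{1..N}. f i * (1 / real N))"
    by (intro sum.cong) (auto simp: measure_cell)
  finally show ?thesis by (simp add: sum_distrib_left[symmetric] sum_divide_distrib)
qed

lemma step_graphon_kernel:
  assumes N: "1 \<le> N"
    and G: "\<And>i j. i \<in> {1..N} \<Longrightarrow> j \<in> {1..N} \<Longrightarrow> 0 \<le> G i j \<and> G i j \<le> 1 \<and> G i j = (G j i :: real)"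
  shows "lebesgue_kernel \<nu> (step_graphon N G)"
proof
  note cell_index_measurable[OF N, measurable]
  let ?g = "\<lambda>i. G (fst (prod_decode i)) (snd (prod_decode i))"
  have "(\<lambda>p. ?g (prod_encode (cell_index N (fst p), cell_index N (snd p)))) \<in> borel_measurable (leb01 \<Otimes>\<^sub>M leb01)"
    by measurable
  then show "(\<lambda>(x, y). step_graphon N G x y) \<in> borel_measurable (leb01 \<Otimes>\<^sub>M leb01)"
    by (simp add: step_graphon_def case_prod_beta)
  show "step_graphon N G x y = step_graphon N G y x" "\<bar>step_graphon N G x y\<bar> \<le> 1"
    if "x \<in> {0..1}" "y \<in> {0..1}" for x y
    using G[OF cell_index(1)[OF N that(1)] cell_index(1)[OF N that(2)]] by (auto simp: step_graphon_def)
qed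

end

section \<open>Step profiles and their aggregates\<close>

context profile_space
begin

lemma joint_cong:
  assumes "joint a" "\<And>x. x \<in> {0..1} \<Longrightarrow> a x = b x"
  shows "joint b"
  using assms unfolding joint_def
  by (subst (asm) measurable_cong[where g = "\<lambda>(x, p). pr (b x) p"]) (auto simp: space_pair_measure)

lemma step_profile_prof:
  assumes N: "1 \<le> N" and a: "\<And>i. i \<in> {1..N} \<Longrightarrow> a i \<in> V"
  shows "step_profile N a \<in> prof"
proof (rule profI_bounded)
  \<comment> \<open>Nothing is known about \<open>a\<close> outside the labels, so the value 0 there
    keeps all values in \<open>V\<close>.\<close>
  let ?c = "\<lambda>i. if i \<in> {1..N} then a i else 0"
  have "?c n \<in> V" for n
  proof (cases "n \<in> {1..N}")
    case True
    then show ?thesis using a by simp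
  qed (simp only: if_False zero_V)
  then have "joint (\<lambda>x. ?c (cell_index N x))"
    by (intro joint_countable_valued cell_index_measurable' N)
  then show "joint (step_profile N a)"
    by (rule joint_cong) (use cell_index(1)[OF N] in \<open>simp add: step_profile_def\<close>)
  fix x :: real assume x: "x \<in> {0..1}"
  show "step_profile N a x \<in> V" using a cell_index(1)[OF N x] by (simp add: step_profile_def)
  show "nrm (step_profile N a x) \<le> (\<Sum>i\<in>{1..N}. nrm (a i))"
    unfolding step_profile_def using cell_index(1)[OF N x]
    by (intro member_le_sum) auto
qed

lemma pn_step_sq:
  assumes N: "1 \<le> N"
  shows "(pn (step_profile N a))\<^sup>2 = (1 / real N) * (fin_prof_norm P Tm N a)\<^sup>2"
proof -
  have "(pn (step_profile N a))\<^sup>2 = (LINT x|\<nu>. (nrm (a (cell_index N x)))\<^sup>2)"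
    unfolding pn_eq l2norm_sq by (simp add: step_profile_def)
  also have "\<dots> = (1 / real N) * (\<Sum>i\<in>{1..N}. (nrm (a i))\<^sup>2)"
    by (rule integral_step[OF N, of "\<lambda>i. (nrm (a i))\<^sup>2"])
  also have "(\<Sum>i\<in>{1..N}. (nrm (a i))\<^sup>2) = (fin_prof_norm P Tm N a)\<^sup>2"
    unfolding fin_prof_norm_def by (intro real_sqrt_pow2[symmetric] sum_nonneg) simp
  finally show ?thesis .
qed

lemma step_profile_add: "step_profile N (a + b) = step_profile N a + step_profile N b"
  by (simp add: step_profile_def fun_eq_iff)

lemma step_profile_diff: "step_profile N (a - b) = step_profile N a - step_profile N b"
  by (simp add: step_profile_def fun_eq_iff)

text \<open>Cells have measure \<open>1 / N\<close>, so the integral of a step function is exactly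
  the network average and the embedding into graphon games causes no error.\<close>

lemma network_aggregate_represents:
  assumes N: "1 \<le> N" and a: "\<And>i. i \<in> {1..N} \<Longrightarrow> a i \<in> V"
  shows "represents (step_graphon N G x) (step_profile N a) (network_aggregate N G a (cell_index N x))"
proof -
  let ?i = "cell_index N x"
  have "(\<lambda>\<omega> t. \<Sum>j\<in>{1..N}. G ?i j * a j \<omega> t) \<in> V"
    using a by (intro V_sum) auto
  from V_lincomb[OF this zero_V, of "1 / real N" 0]
  have "network_aggregate N G a ?i \<in> V" by (simp add: network_aggregate_def)
  moreover have "pr (network_aggregate N G a ?i) p = (LINT y|\<nu>. step_graphon N G x y * pr (step_profile N a y) p)" for p
    using integral_step[OF N, of "\<lambda>j. G ?i j * pr (a j) p"]
    by (cases p) (simp add: step_graphon_def step_profile_def network_aggregate_def pr_def)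
  ultimately show ?thesis by (simp add: represents_def)
qed

lemma network_aggregate_agg:
  assumes N: "1 \<le> N" and a: "\<And>i. i \<in> {1..N} \<Longrightarrow> a i \<in> V"
    and K: "sym_kernel \<nu> (step_graphon N G)" and x: "x \<in> {0..1}"
  shows "nrm (network_aggregate N G a (cell_index N x) - agg (step_graphon N G) (step_profile N a) x) = 0"
proof -
  interpret K: sym_kernel \<nu> "step_graphon N G" by (rule K)
  show ?thesis
    using x by (intro represents_unique[OF network_aggregate_represents[OF N a] agg_represents] K.section_sqint step_profile_prof N a) auto
qed

end

section \<open>Network games as graphon games\<close>

context graphon_game
begin

lemma network_nash_iff:
  "network_nash A U N \<theta> G a \<longleftrightarrow> (\<forall>i\<in>{1..N}. best (network_aggregate N G a i) (\<theta> i) (a i))"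
  by (simp add: network_nash_def best_def)

lemma network_nash_imp_nash:
  assumes N: "1 \<le> N" and \<theta>: "\<And>i. i \<in> {1..N} \<Longrightarrow> \<theta> i \<in> V"
    and K: "sym_kernel \<nu> (step_graphon N G)" and a: "network_nash A U N \<theta> G a"
  shows "nash (step_graphon N G) (step_profile N \<theta>) (step_profile N a)"
proof -
  have b: "best (network_aggregate N G a i) (\<theta> i) (a i)" if "i \<in> {1..N}" for i
    using a that by (simp add: network_nash_iff)
  have aV: "a i \<in> V" if "i \<in> {1..N}" for i using best_V[OF b[OF that]] .
  have p: "step_profile N a \<in> prof" by (rule step_profile_prof[OF N aV])
  have "best (agg (step_graphon N G) (step_profile N a) x) (step_profile N \<theta> x) (step_profile N a x)"
    if x: "x \<in> {0..1}" for x
  proof -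
    note i = cell_index(1)[OF N x]
    show ?thesis
      unfolding step_profile_def[of N \<theta>] step_profile_def[of N a x]
      using network_aggregate_agg[OF N aV K x] represents_V[OF network_aggregate_represents[OF N aV]]
      by (intro best_equiv[OF b[OF i]] agg_V[OF K p x] aV[OF i] \<theta>[OF i]) auto
  qed
  then show ?thesis using p by (simp add: nash_iff)
qed

text \<open>Players of one cell face the same aggregate and heterogeneity, so by uniqueness of best
  responses their equilibrium actions agree up to norm zero. The left end represents a cell because
  it belongs to it; right ends of all but the last cell do not.\<close>

lemma nash_imp_network_nash:
  assumes N: "1 \<le> N" and \<theta>: "\<And>i. i \<in> {1..N} \<Longrightarrow> \<theta> i \<in> V"
    and K: "sym_kernel \<nu> (step_graphon N G)"
    and a: "nash (step_graphon N G) (step_profile N \<theta>) a"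
  shows "network_nash A U N \<theta> G (\<lambda>i. a ((real i - 1) / real N))"
proof -
  let ?K = "step_graphon N G" and ?l = "\<lambda>i. (real i - 1) / real N"
  let ?b = "\<lambda>i. a (?l i)"
  have l: "?l i \<in> {0..1}" "cell_index N (?l i) = i" if "i \<in> {1..N}" for i
    using cell_subset[OF that] left_end_cell[OF that] cell_index_eq[OF that left_end_cell[OF that]] by auto
  have ap: "a \<in> prof" and ab: "\<And>x. x \<in> {0..1} \<Longrightarrow> best (agg ?K a x) (step_profile N \<theta> x) (a x)"
    using a by (auto simp: nash_iff)
  have bV: "?b i \<in> V" if "i \<in> {1..N}" for i using prof_V[OF ap l(1)[OF that]] .
  have bp: "step_profile N ?b \<in> prof" by (rule step_profile_prof[OF N bV])
  \<comment> \<open>This is literal equality: on one cell the predicates under \<open>SOME\<close>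
    coincide, since the player enters only through the cell index.\<close>
  have agg_cell: "agg ?K c x = agg ?K c y" if "cell_index N x = cell_index N y" for c x y
    using that by (simp add: graphon_aggregate_def graphon_op_def step_graphon_def)
  have const: "nrm (a x - step_profile N ?b x) = 0" if x: "x \<in> {0..1}" for x
  proof -
    let ?i = "cell_index N x"
    note i = cell_index(1)[OF N x]
    have "best (agg ?K a x) (step_profile N \<theta> x) (?b ?i)"
      using ab[OF l(1)[OF i]] agg_cell[of "?l ?i" x a] l(2)[OF i] by (simp add: step_profile_def)
    moreover have "agg ?K a x \<in> V" "step_profile N \<theta> x \<in> V"
      using agg_V[OF K ap x] \<theta>[OF i] by (auto simp: step_profile_def)
    ultimately have "\<alpha> * nrm (a x - ?b ?i) \<le> 0"
      using best_lipschitz[OF ab[OF x], of "agg ?K a x" "step_profile N \<theta> x" "?b ?i"] by simp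
    then show ?thesis
      using \<alpha>_pos nrm_nonneg[of "a x - ?b ?i"] by (simp add: step_profile_def mult_le_0_iff)
  qed
  have "pn (a - step_profile N ?b) \<le> 0"
    by (rule pn_bounded) (use const ap bp in \<open>auto intro: prof_diff\<close>)
  then have agg0: "nrm (agg ?K a x - agg ?K (step_profile N ?b) x) = 0" if "x \<in> {0..1}" for x
    using agg_diff_le[OF K ap bp that] by (simp add: order_antisym)
  have "best (network_aggregate N G ?b i) (\<theta> i) (?b i)" if i: "i \<in> {1..N}" for i
  proof (rule best_equiv[OF ab[OF l(1)[OF i]]])
    let ?x = "?l i"
    have V: "agg ?K a ?x \<in> V" "agg ?K (step_profile N ?b) ?x \<in> V" "network_aggregate N G ?b i \<in> V"
      using agg_V[OF K ap l(1)[OF i]] agg_V[OF K bp l(1)[OF i]]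
        represents_V[OF network_aggregate_represents[OF N bV, where x = ?x]] l(2)[OF i] by auto
    have "nrm (agg ?K a ?x - network_aggregate N G ?b i)
        \<le> nrm (agg ?K a ?x - agg ?K (step_profile N ?b) ?x) + nrm (agg ?K (step_profile N ?b) ?x - network_aggregate N G ?b i)"
      by (intro nrm_triangle V)
    also have "\<dots> = 0"
      using agg0[OF l(1)[OF i]] network_aggregate_agg[OF N bV K l(1)[OF i]] l(2)[OF i]
        nrm_minus_commute[of "agg ?K (step_profile N ?b) ?x"] by simp
    finally show "nrm (agg ?K a ?x - network_aggregate N G ?b i) = 0" by (simp add: order_antisym)
    show "?b i \<in> V" "agg ?K a ?x \<in> V" "network_aggregate N G ?b i \<in> V" "nrm (?b i - ?b i) = 0"
      using bV[OF i] V by auto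
    show "step_profile N \<theta> ?x \<in> V" "\<theta> i \<in> V" "nrm (step_profile N \<theta> ?x - \<theta> i) = 0"
      using \<theta>[OF i] l(2)[OF i] by (auto simp: step_profile_def)
  qed
  then show ?thesis by (simp add: network_nash_iff)
qed

text \<open>Existence is inherited from the step game. Uniqueness is
  \<open>equilibrium_stability\<close> with equal kernels and heterogeneities, where both errors
  vanish; it concerns every player because each cell has positive measure.\<close>

lemma network_equilibrium:
  assumes N: "1 \<le> N" and \<theta>: "\<And>i. i \<in> {1..N} \<Longrightarrow> \<theta> i \<in> V"
    and K: "sym_kernel \<nu> (step_graphon N G)" and \<rho>: "0 \<le> \<rho>" "l\<^sub>U * \<rho> < \<alpha>"
    and bound: "\<And>f. f \<in> sqint \<nu> \<Longrightarrow> l2norm \<nu> (\<lambda>x. LINT y|\<nu>. step_graphon N G x y * f y) \<le> \<rho> * l2norm \<nu> f"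
  shows "unique_network_nash P Tm A U N \<theta> G"
proof -
  have \<theta>p: "step_profile N \<theta> \<in> prof" by (rule step_profile_prof[OF N \<theta>])
  obtain c where "nash (step_graphon N G) (step_profile N \<theta>) c"
    using graphon_equilibrium_exists[OF K \<theta>p \<rho> bound] by blast
  from nash_imp_network_nash[OF N \<theta> K this]
  obtain a where a: "network_nash A U N \<theta> G a" by blast
  have "nrm (b i - a i) = 0" if b: "network_nash A U N \<theta> G b" and i: "i \<in> {1..N}" for b i
  proof -
    note na = network_nash_imp_nash[OF N \<theta> K a] and nb = network_nash_imp_nash[OF N \<theta> K b]
    have K0: "sym_kernel \<nu> (\<lambda>x y. step_graphon N G x y - step_graphon N G x y)"
      by unfold_locales auto
    have z: "l2norm \<nu> (\<lambda>x. LINT y|\<nu>. (step_graphon N G x y - step_graphon N G x y) * f y) \<le> 0 * l2norm \<nu> f" for f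
      by simp
    have "(\<alpha> - l\<^sub>U * \<rho>) * pn (step_profile N b - step_profile N a)
        \<le> l\<^sub>U * M * 0 + l\<^sub>\<theta> * pn (step_profile N \<theta> - step_profile N \<theta>)"
      by (rule equilibrium_stability[OF K K K0 \<rho> order_refl bound z \<theta>p \<theta>p nb na])
    also have "\<dots> = 0" by (simp add: pn_eq l2norm_def)
    finally have "pn (step_profile N b - step_profile N a) = 0"
      using \<rho>(2) pn_nonneg[of "step_profile N b - step_profile N a"] by (simp add: mult_le_0_iff)
    then have "(1 / real N) * (fin_prof_norm P Tm N (b - a))\<^sup>2 = 0"
      using pn_step_sq[OF N, of "b - a"] by (simp add: step_profile_diff)
    then have "(\<Sum>i\<in>{1..N}. (nrm (b i - a i))\<^sup>2) = 0"
      using N by (simp add: fin_prof_norm_def)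
    then show ?thesis using i by (subst (asm) sum_nonneg_eq_0_iff) auto
  qed
  then show ?thesis using a unfolding unique_network_nash_def by blast
qed

lemma network_value_eq_welfare:
  assumes N: "1 \<le> N" and \<theta>: "\<And>i. i \<in> {1..N} \<Longrightarrow> \<theta> i \<in> V"
    and K: "sym_kernel \<nu> (step_graphon N G)" and a: "network_nash A U N \<theta> G a"
  shows "(1 / real N) * (\<Sum>i\<in>{1..N}. U (a i) (network_aggregate N G a i) (\<theta> i))
    = welfare (step_graphon N G) (step_profile N \<theta>) (step_profile N a)"
proof -
  have aV: "a i \<in> V" if "i \<in> {1..N}" for i
    using a that best_V unfolding network_nash_iff by blast
  have p: "step_profile N a \<in> prof" by (rule step_profile_prof[OF N aV])
  have "welfare (step_graphon N G) (step_profile N \<theta>) (step_profile N a)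
      = (LINT x|\<nu>. U (a (cell_index N x)) (network_aggregate N G a (cell_index N x)) (\<theta> (cell_index N x)))"
    unfolding welfare_def
  proof (rule Bochner_Integration.integral_cong)
    fix x assume "x \<in> space \<nu>"
    then have x: "x \<in> {0..1}" by simp
    note i = cell_index(1)[OF N x]
    let ?z = "network_aggregate N G a (cell_index N x)" and ?w = "agg (step_graphon N G) (step_profile N a) x"
    have zV: "?z \<in> V" by (rule represents_V[OF network_aggregate_represents[OF N aV]])
    have "nrm (?z - ?w) = 0" by (rule network_aggregate_agg[OF N aV K x])
    then have z: "nrm (?w - ?z) = 0" by (subst nrm_minus_commute)
    show "U (step_profile N a x) (agg (step_graphon N G) (step_profile N a) x) (step_profile N \<theta> x)
        = U (a (cell_index N x)) (network_aggregate N G a (cell_index N x)) (\<theta> (cell_index N x))"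
      unfolding step_profile_def[of N \<theta>] step_profile_def[of N a x]
      by (intro U_equiv agg_V[OF K p x] aV[OF i] \<theta>[OF i] zV z) simp_all
  qed simp
  then show ?thesis
    using integral_step[OF N, of "\<lambda>i. U (a i) (network_aggregate N G a i) (\<theta> i)"] by simp
qed

end

section \<open>Sampling a piecewise Lipschitz profile\<close>

context profile_space
begin

text \<open>Samples are taken at right ends of cells. Away from \<open>Z\<close> the Lipschitz
  condition gives an error of at most \<open>\<bar>L\<bar> / N\<close>; on \<open>Z\<close>, whose
  measure is at most \<open>card \<I> / N\<close>, the crude bound \<open>2 * B\<close> is used.
  Squaring and integrating produces both terms of the constant, and the order
  \<open>1 / sqrt N\<close> comes from \<open>Z\<close>.\<close>

lemma sampling_error:
  assumes a: "a \<in> prof" and bound: "\<And>x. x \<in> {0..1} \<Longrightarrow> nrm (a x) \<le> B"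
    and \<I>: "finite \<I>" "partition_on {0..1} \<I>" "\<And>I. I \<in> \<I> \<Longrightarrow> is_interval I"
    and lip: "\<And>I x x'. I \<in> \<I> \<Longrightarrow> x \<in> I \<Longrightarrow> x' \<in> I \<Longrightarrow> nrm (a x - a x') \<le> L * \<bar>x - x'\<bar>"
    and N: "1 \<le> N"
  shows "pn (a - step_profile N (\<lambda>i. a (real i / real N))) \<le> sqrt (L\<^sup>2 + 4 * B\<^sup>2 * real (card \<I>)) / sqrt (real N)"
proof -
  define s where "s i = a (real i / real N)" for i
  have Np: "0 < real N" using N by simp
  have B0: "0 \<le> B" using order_trans[OF nrm_nonneg bound[of 0]] by simp
  have iN: "real i / real N \<in> {0..1}" if "i \<in> {1..N}" for i using that by auto
  have sp: "step_profile N s \<in> prof"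
    unfolding s_def by (rule step_profile_prof[OF N]) (rule prof_V[OF a iN])
  \<comment> \<open>If \<open>x\<close> and the right end of its cell lie in different pieces, the supremum of the piece
    containing \<open>x\<close> lies between them.\<close>
  define Z where "Z = (\<Union>I\<in>\<I>. {Sup I - 1 / real N..Sup I} \<inter> {0..1})"
  have Zs: "Z \<in> sets borel" "Z \<subseteq> {0..1}" unfolding Z_def using \<I>(1) by auto
  note Zm = leb_interval_measure[OF Zs]
  have Zle: "measure \<nu> Z \<le> real (card \<I>) / real N"
  proof -
    have "measure \<nu> ({c - 1 / real N..c} \<inter> {0..1}) \<le> 1 / real N" for c
    proof -
      have "measure \<nu> ({c - 1 / real N..c} \<inter> {0..1}) = measure lborel ({c - 1 / real N..c} \<inter> {0..1})"
        by (rule leb_interval_measure) auto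
      also have "\<dots> \<le> measure lborel {c - 1 / real N..c}"
        by (intro measure_mono_fmeasurable) (auto simp: fmeasurable_def)
      also have "\<dots> = 1 / real N" by simp
      finally show ?thesis .
    qed
    then have "(\<Sum>I\<in>\<I>. measure \<nu> ({Sup I - 1 / real N..Sup I} \<inter> {0..1})) \<le> (\<Sum>I\<in>\<I>. 1 / real N)"
      by (intro sum_mono)
    moreover have "measure \<nu> Z \<le> (\<Sum>I\<in>\<I>. measure \<nu> ({Sup I - 1 / real N..Sup I} \<inter> {0..1}))"
      unfolding Z_def using \<I>(1) leb_interval_measure(1)
      by (intro finite_measure_subadditive_finite) auto
    ultimately have "measure \<nu> Z \<le> (\<Sum>I\<in>\<I>. 1 / real N)"
      by linarith
    then show ?thesis by simp
  qed
  let ?g = "\<lambda>x. if x \<in> Z then 2 * B else \<bar>L\<bar> / real N"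
  have gm: "?g \<in> borel_measurable \<nu>"
    by (rule measurable_If_set) (simp_all add: Int_absorb2 Zs(2) Zm(1))
  have gs: "?g \<in> sqint \<nu>"
    by (rule sqint_bounded[where B = "2 * B + \<bar>L\<bar> / real N", OF gm]) (use B0 in auto)
  have "nrm ((a - step_profile N s) x) \<le> ?g x" if x: "x \<in> {0..1}" for x
  proof -
    let ?i = "cell_index N x"
    let ?r = "real ?i / real N"
    note i = cell_index[OF N x]
    have r01: "?r \<in> {0..1}" by (rule iN[OF i(1)])
    have xr: "x \<le> ?r" "?r \<le> x + 1 / real N"
      using cell_bounds[OF i] by (auto simp: diff_divide_distrib)
    have eq: "(a - step_profile N s) x = a x - a ?r" by (simp add: step_profile_def s_def)
    have "x \<in> \<Union>\<I>" using \<I>(2) x by (simp add: partition_on_def)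
    then obtain I where I: "I \<in> \<I>" "x \<in> I" by blast
    show ?thesis
    proof (cases "x \<in> Z")
      case True
      have "nrm (a x - a ?r) \<le> nrm (a x - 0) + nrm (0 - a ?r)"
        using prof_V[OF a x] prof_V[OF a r01] zero_V by (intro nrm_triangle)
      also have "\<dots> \<le> 2 * B"
        using bound[OF x] bound[OF r01] nrm_minus_commute[of 0 "a ?r"] by simp
      finally show ?thesis using True eq by simp
    next
      case False
      have "?r \<in> I"
      proof (rule ccontr)
        assume nr: "?r \<notin> I"
        have up: "y \<le> ?r" if "y \<in> I" for y
        proof (rule ccontr)
          assume "\<not> y \<le> ?r"
          then have "?r \<in> I"
            using mem_is_interval_1_I[OF \<I>(3)[OF I(1)] I(2) that, of ?r] xr by auto
          then show False using nr by simp
        qed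
        have bdd: "bdd_above I" by (rule bdd_aboveI[OF up])
        have "Sup I \<le> ?r" using I(2) up by (intro cSup_least) auto
        moreover have "x \<le> Sup I" using I(2) bdd by (rule cSup_upper)
        ultimately have "x \<in> Z" unfolding Z_def using I(1) x xr by force
        then show False using False by simp
      qed
      then have "nrm (a x - a ?r) \<le> L * \<bar>x - ?r\<bar>" by (rule lip[OF I])
      also have "\<dots> \<le> \<bar>L\<bar> * (1 / real N)"
        using xr by (intro mult_mono) auto
      finally show ?thesis using False eq by simp
    qed
  qed
  then have "pn (a - step_profile N s) \<le> l2norm \<nu> ?g"
    by (intro pn_le prof_diff a sp gs)
  also have "\<dots> \<le> sqrt ((L\<^sup>2 + 4 * B\<^sup>2 * real (card \<I>)) / real N)"
    unfolding l2norm_def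
  proof (rule real_sqrt_le_mono)
    have "(LINT x|\<nu>. (?g x)\<^sup>2) \<le> (LINT x|\<nu>. (\<bar>L\<bar> / real N)\<^sup>2 + 4 * B\<^sup>2 * indicator Z x)"
    proof (rule integral_mono)
      show "integrable \<nu> (\<lambda>x. (?g x)\<^sup>2)" by (rule sqint_integrable_sq[OF gs])
      show "integrable \<nu> (\<lambda>x. (\<bar>L\<bar> / real N)\<^sup>2 + 4 * B\<^sup>2 * indicator Z x)"
        using Zm(1) by (auto simp: emeasure_eq_measure)
    qed (auto simp: power_mult_distrib)
    also have "\<dots> = L\<^sup>2 / (real N)\<^sup>2 + 4 * B\<^sup>2 * measure \<nu> Z"
      using Zm(1) by (simp add: emeasure_eq_measure power_divide Int_absorb2 Zs(2))
    also have "\<dots> \<le> L\<^sup>2 / real N + 4 * B\<^sup>2 * (real (card \<I>) / real N)"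
    proof (intro add_mono mult_left_mono Zle)
      have "real N \<le> (real N)\<^sup>2" using N by (simp add: power2_eq_square)
      then show "L\<^sup>2 / (real N)\<^sup>2 \<le> L\<^sup>2 / real N"
        using Np by (intro divide_left_mono) auto
    qed simp
    finally show "(LINT x|\<nu>. (?g x)\<^sup>2) \<le> (L\<^sup>2 + 4 * B\<^sup>2 * real (card \<I>)) / real N"
      by (simp add: add_divide_distrib)
  qed
  finally show ?thesis unfolding s_def by (simp add: real_sqrt_divide)
qed

text \<open>The intervention rescales the sampled step profile to the norm of \<open>a\<close>.
  Rescaling moves it by at most the difference of the two norms, hence by at most the sampling
  error, which is thereby doubled.\<close>

lemma approx_intervention:
  assumes a: "a \<in> prof" and N: "1 \<le> N"
  shows "\<And>i. i \<in> {1..N} \<Longrightarrow> approx_intervention P Tm \<nu> a N i \<in> V"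
    and "pn (step_profile N (approx_intervention P Tm \<nu> a N)) \<le> pn a"
    and "pn (a - step_profile N (approx_intervention P Tm \<nu> a N))
      \<le> 2 * pn (a - step_profile N (\<lambda>i. a (real i / real N)))"
proof -
  define s where "s i = a (real i / real N)" for i
  define g where "g = 1 / normalizing_const P Tm \<nu> a N"
  let ?t = "approx_intervention P Tm \<nu> a N"
  have iN: "real i / real N \<in> {0..1}" if "i \<in> {1..N}" for i using that by auto
  have sV: "s i \<in> V" if "i \<in> {1..N}" for i
    unfolding s_def using prof_V[OF a iN[OF that]] .
  have t: "?t i = (\<lambda>\<omega> t. g * s i \<omega> t)" for i
    by (simp add: approx_intervention_def g_def s_def)
  have tV: "?t i \<in> V" if "i \<in> {1..N}" for i
    using V_lincomb[OF sV[OF that] zero_V, of g 0] by (simp add: t)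
  show "\<And>i. i \<in> {1..N} \<Longrightarrow> ?t i \<in> V" by (rule tV)
  have sp: "step_profile N s \<in> prof" and tp: "step_profile N ?t \<in> prof"
    by (rule step_profile_prof[OF N sV], simp) (rule step_profile_prof[OF N tV], simp)
  have ps: "pn (step_profile N s) = sqrt ((1 / real N) * (fin_prof_norm P Tm N s)\<^sup>2)"
    unfolding pn_step_sq[OF N, symmetric] by simp
  then have g: "g = 1 / (pn (step_profile N s) / pn a)"
    unfolding g_def normalizing_const_def s_def[abs_def] by simp
  have g0: "0 \<le> g" unfolding g by simp
  have "nrm (step_profile N ?t x) = g * nrm (step_profile N s x)" for x
    using g0 by (simp add: step_profile_def t nrm_scale)
  then have pt: "pn (step_profile N ?t) = g * pn (step_profile N s)"
    using g0 l2norm_scale[of \<nu> g "\<lambda>x. nrm (step_profile N s x)"] by (simp add: pn_eq)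
  show "pn (step_profile N ?t) \<le> pn a"
    unfolding pt g by simp
  have "nrm ((step_profile N s - step_profile N ?t) x) = \<bar>1 - g\<bar> * nrm (step_profile N s x)" for x
  proof -
    have "(step_profile N s - step_profile N ?t) x = (\<lambda>\<omega> t. (1 - g) * step_profile N s x \<omega> t)"
      by (simp add: step_profile_def t fun_eq_iff left_diff_distrib)
    then show ?thesis by (simp only: nrm_scale)
  qed
  then have d: "pn (step_profile N s - step_profile N ?t) = \<bar>1 - g\<bar> * pn (step_profile N s)"
    using l2norm_scale[of \<nu> "\<bar>1 - g\<bar>" "\<lambda>x. nrm (step_profile N s x)"] by (simp add: pn_eq)
  have tri: "\<bar>pn (step_profile N s) - pn a\<bar> \<le> pn (a - step_profile N s)"
    using pn_le_add_diff[OF a sp] pn_le_add_diff[OF sp a] pn_minus_commute[of a "step_profile N s"] by linarith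
  have "\<bar>1 - g\<bar> * pn (step_profile N s) \<le> \<bar>pn (step_profile N s) - pn a\<bar>"
  proof (cases "pn (step_profile N s) = 0 \<or> pn a = 0")
    \<comment> \<open>Division by zero makes \<open>g\<close> zero here. The left side is then 0 or,
      if \<open>pn a\<close> vanishes, equal to the right side.\<close>
    case True
    then show ?thesis by (auto simp: g)
  next
    case False
    then have "0 < pn (step_profile N s)" using pn_nonneg[of "step_profile N s"] by linarith
    then have "\<bar>1 - g\<bar> * pn (step_profile N s) = \<bar>(1 - g) * pn (step_profile N s)\<bar>" by (simp add: abs_mult)
    also have "(1 - g) * pn (step_profile N s) = pn (step_profile N s) - pn a"
      using False by (simp add: g left_diff_distrib)
    finally show ?thesis by simp
  qed
  then have "pn (step_profile N s - step_profile N ?t) \<le> pn (a - step_profile N s)"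
    using d tri by linarith
  then show "pn (a - step_profile N ?t) \<le> 2 * pn (a - step_profile N (\<lambda>i. a (real i / real N)))"
    using pn_triangle[OF a sp tp] unfolding s_def[abs_def] by simp
qed

end


section \<open>Network interventions versus graphon interventions\<close>

text \<open>Two values in [0,1] differ by at most 1; nonnegativity of both kernels is what preserves
  the bound in \<open>lebesgue_kernel\<close>.\<close>

lemma (in lebesgue_extension) difference_kernel:
  assumes K: "lebesgue_kernel \<nu> K" "lebesgue_kernel \<nu> L"
    and K01: "\<And>x y. x \<in> {0..1} \<Longrightarrow> y \<in> {0..1} \<Longrightarrow> 0 \<le> K x y"
    and L01: "\<And>x y. x \<in> {0..1} \<Longrightarrow> y \<in> {0..1} \<Longrightarrow> 0 \<le> L x y"
  shows "lebesgue_kernel \<nu> (\<lambda>x y. K x y - L x y)"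
proof -
  interpret K: lebesgue_kernel \<nu> K by (rule K)
  interpret L: lebesgue_kernel \<nu> L by (rule K)
  show ?thesis
  proof
    show "(\<lambda>(x, y). K x y - L x y) \<in> borel_measurable (leb01 \<Otimes>\<^sub>M leb01)"
      using K.leb_K L.leb_K unfolding case_prod_beta by (rule borel_measurable_diff)
    fix x y :: real assume xy: "x \<in> {0..1}" "y \<in> {0..1}"
    show "K x y - L x y = K y x - L y x"
      using K.leb_K_sym[OF xy] L.leb_K_sym[OF xy] by simp
    show "\<bar>K x y - L x y\<bar> \<le> 1"
      using K.leb_K_abs[OF xy] L.leb_K_abs[OF xy] K01[OF xy] L01[OF xy] by linarith
  qed
qed

section \<open>Comparison of the network game with the limiting graphon game\<close>

context graphon_game
begin

definition stability_const :: "real \<Rightarrow> real" where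
  "stability_const \<rho> = \<Lambda> * ((1 + \<rho>) * ((l\<^sub>U * M + l\<^sub>\<theta>) / (\<alpha> - l\<^sub>U * \<rho>)) + M + 1)"

lemma stability_const_nonneg: "0 \<le> \<rho> \<Longrightarrow> l\<^sub>U * \<rho> < \<alpha> \<Longrightarrow> 0 \<le> stability_const \<rho>"
  unfolding stability_const_def
  using \<Lambda>_nonneg M_nonneg l\<^sub>U_nonneg l\<^sub>\<theta>_nonneg
  by (intro mult_nonneg_nonneg add_nonneg_nonneg divide_nonneg_nonneg) auto

lemma graphon_welfare_eq:
  assumes "\<exists>a. nash K (\<theta> + \<eta>) a"
  shows "\<exists>a. nash K (\<theta> + \<eta>) a \<and> graphon_welfare P \<FF> Tm \<nu> (\<lambda>_. A) U \<theta> K \<eta> = welfare K (\<theta> + \<eta>) a"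
  using someI_ex[OF assms] unfolding graphon_welfare_def welfare_def Let_def
  by (intro exI[of _ "SOME a. nash K (\<theta> + \<eta>) a"]) simp

context
  fixes W :: "real \<Rightarrow> real \<Rightarrow> real" and N :: nat and G :: "nat \<Rightarrow> nat \<Rightarrow> real" and \<rho> :: real
    and \<theta> :: "'w profile" and \<theta>N :: "nat \<Rightarrow> 'w process"
  assumes W: "lebesgue_kernel \<nu> W" and W0: "\<And>x y. x \<in> {0..1} \<Longrightarrow> y \<in> {0..1} \<Longrightarrow> 0 \<le> W x y"
    and N: "1 \<le> N"
    and G: "\<And>i j. i \<in> {1..N} \<Longrightarrow> j \<in> {1..N} \<Longrightarrow> 0 \<le> G i j \<and> G i j \<le> 1 \<and> G i j = G j i"
    and \<rho>: "0 \<le> \<rho>" "l\<^sub>U * (\<rho> + sqrt (4 * cut_norm (\<lambda>x y. W x y - step_graphon N G x y))) < \<alpha>"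
    and \<rho>_bound: "\<And>f. f \<in> sqint \<nu> \<Longrightarrow> l2norm \<nu> (\<lambda>x. LINT y|\<nu>. W x y * f y) \<le> \<rho> * l2norm \<nu> f"
    and \<theta>: "\<theta> \<in> prof" and \<theta>N: "\<And>i. i \<in> {1..N} \<Longrightarrow> \<theta>N i \<in> V"
begin

abbreviation "S \<equiv> step_graphon N G"
abbreviation "\<sigma> \<equiv> sqrt (4 * cut_norm (\<lambda>x y. W x y - S x y))"

lemma S_kernel: "lebesgue_kernel \<nu> S"
  by (rule step_graphon_kernel[OF N G])

lemma diff_kernel: "lebesgue_kernel \<nu> (\<lambda>x y. W x y - S x y)"
proof (rule difference_kernel[OF W S_kernel W0])
  fix x y :: real assume "x \<in> {0..1}" "y \<in> {0..1}"
  then show "0 \<le> S x y"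
    using G[OF cell_index(1)[OF N] cell_index(1)[OF N], of x y] by (simp add: step_graphon_def)
qed

interpretation W: lebesgue_kernel \<nu> W by (rule W)
interpretation S: lebesgue_kernel \<nu> S by (rule S_kernel)
interpretation D: lebesgue_kernel \<nu> "\<lambda>x y. W x y - S x y" by (rule diff_kernel)

lemma sym_kernels: "sym_kernel \<nu> W" "sym_kernel \<nu> S" "sym_kernel \<nu> (\<lambda>x y. W x y - S x y)"
  by unfold_locales

lemma \<sigma>_nonneg: "0 \<le> \<sigma>"
  using D.cut_norm_nonneg by simp

lemma \<rho>_less: "l\<^sub>U * \<rho> < \<alpha>"
proof -
  have "l\<^sub>U * \<rho> \<le> l\<^sub>U * (\<rho> + \<sigma>)" using l\<^sub>U_nonneg \<sigma>_nonneg by (intro mult_left_mono) auto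
  then show ?thesis using \<rho>(2) by linarith
qed

text \<open>Perturbation: the spectral condition concerns only \<open>W\<close>, and the step kernel
  inherits a contraction bound because its distance to \<open>W\<close> in operator norm is at most
  \<open>\<sigma>\<close>.\<close>

lemma S_bound:
  assumes f: "f \<in> sqint \<nu>"
  shows "l2norm \<nu> (\<lambda>x. LINT y|\<nu>. S x y * f y) \<le> (\<rho> + \<sigma>) * l2norm \<nu> f"
proof -
  have "l2norm \<nu> (S.op f) \<le> l2norm \<nu> (W.op f) + l2norm \<nu> (\<lambda>x. S.op f x - W.op f x)"
    by (intro l2norm_le_add_diff S.op_sqint W.op_sqint f)
  also have "l2norm \<nu> (\<lambda>x. S.op f x - W.op f x) = l2norm \<nu> (\<lambda>x. W.op f x - S.op f x)"
    by (rule l2norm_minus_commute)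
  also have "\<dots> = l2norm \<nu> (D.op f)"
  proof -
    have "D.op f x = W.op f x - S.op f x" if "x \<in> space \<nu>" for x
      using W.op_integrable[OF f that] S.op_integrable[OF f that] by (simp add: left_diff_distrib)
    then show ?thesis
      unfolding l2norm_def by (intro arg_cong[where f = sqrt] Bochner_Integration.integral_cong) auto
  qed
  finally show ?thesis
    using \<rho>_bound[OF f] D.op_cut_norm[OF f] by (simp add: distrib_right)
qed

lemma network_unique_nash:
  assumes "\<And>i. i \<in> {1..N} \<Longrightarrow> \<eta> i \<in> V"
  shows "unique_network_nash P Tm A U N (\<theta>N + \<eta>) G"
  using assms \<theta>N \<rho> \<sigma>_nonneg
  by (intro network_equilibrium[OF N _ sym_kernels(2) _ _ S_bound]) (auto intro: V_add)

text \<open>\<open>W\<close> takes the role of the first kernel in \<open>welfare_stability\<close>,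
  so the constant contains \<open>\<rho>\<close> alone and is the same for all
  \<open>N\<close>.\<close>

lemma network_graphon_welfare_diff:
  assumes \<eta>: "\<And>i. i \<in> {1..N} \<Longrightarrow> \<eta> i \<in> V" and \<eta>': "\<eta>' \<in> prof"
  shows "\<bar>network_welfare A U N \<theta>N G \<eta> - graphon_welfare P \<FF> Tm \<nu> (\<lambda>_. A) U \<theta> W \<eta>'\<bar>
    \<le> stability_const \<rho> * max \<sigma> (pn (\<theta> - step_profile N \<theta>N) + pn (\<eta>' - step_profile N \<eta>))"
proof -
  have \<theta>\<eta>: "(\<theta>N + \<eta>) i \<in> V" if "i \<in> {1..N}" for i
    using \<theta>N[OF that] \<eta>[OF that] by (simp add: V_add)
  define a where "a = (SOME a. network_nash A U N (\<theta>N + \<eta>) G a)"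
  have "\<exists>a. network_nash A U N (\<theta>N + \<eta>) G a"
    using network_unique_nash[of \<eta>] \<eta> unfolding unique_network_nash_def by blast
  then have a: "network_nash A U N (\<theta>N + \<eta>) G a"
    unfolding a_def by (rule someI_ex)
  have w: "network_welfare A U N \<theta>N G \<eta> = welfare S (step_profile N (\<theta>N + \<eta>)) (step_profile N a)"
    using network_value_eq_welfare[OF N \<theta>\<eta> sym_kernels(2) a]
    by (simp add: network_welfare_def a_def[symmetric])
  have p: "\<theta> + \<eta>' \<in> prof" by (rule prof_add[OF \<theta> \<eta>'])
  have sp: "step_profile N (\<theta>N + \<eta>) \<in> prof" by (rule step_profile_prof[OF N \<theta>\<eta>])
  obtain b where b: "nash W (\<theta> + \<eta>') b"
    "graphon_welfare P \<FF> Tm \<nu> (\<lambda>_. A) U \<theta> W \<eta>' = welfare W (\<theta> + \<eta>') b"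
    using graphon_welfare_eq[OF graphon_equilibrium_exists[OF sym_kernels(1) p \<rho>(1) \<rho>_less \<rho>_bound]] by blast
  have "\<bar>network_welfare A U N \<theta>N G \<eta> - graphon_welfare P \<FF> Tm \<nu> (\<lambda>_. A) U \<theta> W \<eta>'\<bar>
      \<le> stability_const \<rho> * max \<sigma> (pn ((\<theta> + \<eta>') - step_profile N (\<theta>N + \<eta>)))"
    unfolding w b(2) stability_const_def abs_minus_commute[of "welfare S _ _"]
    by (rule welfare_stability[OF sym_kernels \<rho>(1) \<rho>_less \<sigma>_nonneg \<rho>_bound D.op_cut_norm p sp b(1)
        network_nash_imp_nash[OF N \<theta>\<eta> sym_kernels(2) a]])
  also have "\<dots> \<le> stability_const \<rho> * max \<sigma> (pn (\<theta> - step_profile N \<theta>N) + pn (\<eta>' - step_profile N \<eta>))"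
  proof (intro mult_left_mono max.mono order_refl stability_const_nonneg \<rho>(1) \<rho>_less)
    have tp: "step_profile N \<theta>N \<in> prof" "step_profile N \<eta> \<in> prof"
      using step_profile_prof[OF N, of \<theta>N] \<theta>N step_profile_prof[OF N, of \<eta>] \<eta> by blast+
    have "pn ((\<theta> + \<eta>') - step_profile N (\<theta>N + \<eta>))
        \<le> pn ((\<theta> + \<eta>') - (step_profile N \<theta>N + \<eta>')) + pn ((step_profile N \<theta>N + \<eta>') - step_profile N (\<theta>N + \<eta>))"
      by (intro pn_triangle prof_add p sp tp \<eta>')
    then show "pn ((\<theta> + \<eta>') - step_profile N (\<theta>N + \<eta>))
        \<le> pn (\<theta> - step_profile N \<theta>N) + pn (\<eta>' - step_profile N \<eta>)"
      by (simp add: step_profile_add)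
  qed
  finally show ?thesis .
qed

end

end

text \<open>Members of \<open>null_sets P\<close> are themselves measurable, so the augmentation
  does not leave the sigma-algebra of \<open>P\<close>.\<close>

lemma aug_filtration_subalgebra:
  assumes X: "\<And>i s. i \<in> J \<Longrightarrow> s \<in> {0..t} \<Longrightarrow> (\<lambda>\<omega>. X i \<omega> s) \<in> borel_measurable P"
  shows "space (aug_filtration P J X t) = space P" "sets (aug_filtration P J X t) \<subseteq> sets P"
proof -
  let ?G = "{(\<lambda>\<omega>. X i \<omega> s) -` B \<inter> space P | i s B. i \<in> J \<and> s \<in> {0..t} \<and> B \<in> sets borel} \<union> null_sets P"
  have G: "?G \<subseteq> sets P" using X by (auto intro: measurable_sets)
  then have "?G \<subseteq> Pow (space P)" using sets.space_closed by blast
  then show "space (aug_filtration P J X t) = space P" "sets (aug_filtration P J X t) \<subseteq> sets P"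
    unfolding aug_filtration_def using sets.sigma_sets_subset[OF G]
    by (simp_all only: space_measure_of sets_measure_of)
qed

theorem theorem3p4:
  fixes P :: "'w measure" and \<nu> :: "real measure" and E :: "(real \<times> 'w) measure"
    and Tm :: real and \<FF> :: "real \<Rightarrow> 'w measure"
    and \<theta> :: "'w profile" and \<theta>N :: "nat \<Rightarrow> nat \<Rightarrow> 'w process"
    and W :: "real \<Rightarrow> real \<Rightarrow> real" and G :: "nat \<Rightarrow> nat \<Rightarrow> nat \<Rightarrow> real"
    and U :: "'w utility" and A\<^sub>0 :: "'w process set"
    and \<theta>bar :: "'w profile" and \<I> :: "real set set"
    and \<alpha>\<^sub>U l\<^sub>U l\<^sub>\<theta> M C\<^sub>B \<theta>max L :: real
  \<comment> \<open>probabilistic setting\<close>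
  assumes "Tm > 0" and "prob_space P" and "extends_lebesgue_01 \<nu>"
    and "rich_fubini_extension \<nu> P E"
    and "\<FF> = aug_filtration P {0..1} \<theta>"
  \<comment> \<open>graphon game and intervention budget\<close>
    and "\<theta> \<in> prof_space P \<FF> Tm \<nu>" and "graphon W"
    and "utility_functional P \<FF> Tm U" and "A\<^sub>0 \<subseteq> proc_space P \<FF> Tm" and "C\<^sub>B > 0"
  \<comment> \<open>(A1)\<close>
    and "regular_utility P \<FF> Tm U \<alpha>\<^sub>U l\<^sub>U l\<^sub>\<theta>"
  \<comment> \<open>(A2)\<close>
    and "A\<^sub>0 \<noteq> {}" and "proc_convex A\<^sub>0" and "proc_closed P \<FF> Tm A\<^sub>0"
    and "\<exists>z\<^sub>0\<in>proc_space P \<FF> Tm. \<exists>\<theta>\<^sub>0\<in>proc_space P \<FF> Tm. \<exists>b\<in>prof_space P \<FF> Tm \<nu>.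
           \<forall>x\<in>{0..1}. is_arg_max (\<lambda>a. U a z\<^sub>0 \<theta>\<^sub>0) (\<lambda>a. a \<in> A\<^sub>0) (b x)"
  \<comment> \<open>(A3)\<close>
    and "\<forall>a\<in>A\<^sub>0. proc_norm P Tm a \<le> M"
  \<comment> \<open>(A4)\<close>
    and "l\<^sub>U * largest_eigenvalue W < \<alpha>\<^sub>U"
  \<comment> \<open>(A5)\<close>
    and "jointly_lipschitz P \<FF> Tm A\<^sub>0 U"
  \<comment> \<open>(A6)\<close>
    and "is_arg_max (graphon_welfare P \<FF> Tm \<nu> (\<lambda>_. A\<^sub>0) U \<theta> W)
           (\<lambda>\<eta>. \<eta> \<in> graphon_feasible P \<FF> Tm \<nu> C\<^sub>B) \<theta>bar"
    and "\<forall>x\<in>{0..1}. proc_norm P Tm (\<theta>bar x) \<le> \<theta>max"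
    and "finite \<I>" and "partition_on {0..1} \<I>" and "\<forall>I\<in>\<I>. is_interval I"
    and "\<forall>I\<in>\<I>. \<forall>x\<in>I. \<forall>x'\<in>I. proc_norm P Tm (\<theta>bar x - \<theta>bar x') \<le> L * \<bar>x - x'\<bar>"
  \<comment> \<open>network games\<close>
    and "\<forall>N\<ge>1. \<forall>i\<in>{1..N}. \<forall>j\<in>{1..N}. 0 \<le> G N i j \<and> G N i j \<le> 1 \<and> G N i j = G N j i"
    and "(\<lambda>N. cut_norm (\<lambda>x y. W x y - step_graphon N (G N) x y)) \<longlonglongrightarrow> 0"
    and "\<forall>N\<ge>1. \<theta>N N \<in> fin_prof_space P \<FF> Tm N"
    and "\<forall>N\<ge>1. \<forall>t\<in>{0..Tm}. sets (aug_filtration P {1..N} (\<theta>N N) t) \<subseteq> sets (\<FF> t)"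
    and "(\<lambda>N. prof_norm P Tm \<nu> (\<theta> - step_profile N (\<theta>N N))) \<longlonglongrightarrow> 0"
  shows "\<exists>N\<^sub>0\<ge>1.
     (\<forall>N\<ge>N\<^sub>0. \<forall>\<eta>\<in>fin_prof_space P \<FF> Tm N.
        unique_network_nash P Tm A\<^sub>0 U N (\<theta>N N + \<eta>) (G N)) \<and>
     (\<exists>C. \<forall>N\<ge>N\<^sub>0.
        \<bar>network_opt P \<FF> Tm C\<^sub>B A\<^sub>0 U N (\<theta>N N) (G N)
           - network_welfare A\<^sub>0 U N (\<theta>N N) (G N) (approx_intervention P Tm \<nu> \<theta>bar N)\<bar>
        \<le> C * max (max (sqrt (cut_norm (\<lambda>x y. W x y - step_graphon N (G N) x y)))
                        (prof_norm P Tm \<nu> (\<theta> - step_profile N (\<theta>N N))))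
                   (1 / sqrt (real N))) \<and>
     (\<lambda>N. network_opt P \<FF> Tm C\<^sub>B A\<^sub>0 U N (\<theta>N N) (G N)
           - network_welfare A\<^sub>0 U N (\<theta>N N) (G N) (approx_intervention P Tm \<nu> \<theta>bar N))
       \<longlonglongrightarrow> 0"
proof -
  note Tm = assms(1) and P = assms(2) and ext = assms(3) and FF = assms(5) and \<theta> = assms(6)
    and W = assms(7) and A0 = assms(9) and reg = assms(11)
    and A4 = assms(17) and lip = assms(18) and \<theta>bar = assms(19) and \<theta>max = assms(20)
    and \<I> = assms(21,22,23,24) and G = assms(25) and cut = assms(26) and \<theta>N = assms(27)
    and \<theta>lim = assms(29)
  from reg obtain D where
    D1: "\<forall>z\<in>proc_space P \<FF> Tm. \<forall>\<eta>\<in>proc_space P \<FF> Tm.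
      cont_gateaux_with_gradient P \<FF> Tm (\<lambda>a. U a z \<eta>) (\<lambda>a. D a z \<eta>)"
    and D2: "\<forall>a\<in>proc_space P \<FF> Tm.
      \<forall>z\<in>proc_space P \<FF> Tm. \<forall>\<eta>\<in>proc_space P \<FF> Tm.
      \<forall>z'\<in>proc_space P \<FF> Tm. \<forall>\<eta>'\<in>proc_space P \<FF> Tm.
        proc_norm P Tm (D a z \<eta> - D a z' \<eta>')
          \<le> l\<^sub>U * proc_norm P Tm (z - z') + l\<^sub>\<theta> * proc_norm P Tm (\<eta> - \<eta>')"
    unfolding regular_utility_def by auto
  have \<alpha>: "0 < \<alpha>\<^sub>U"
    and conc: "\<And>z \<eta>. z \<in> proc_space P \<FF> Tm \<Longrightarrow> \<eta> \<in> proc_space P \<FF> Tm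
      \<Longrightarrow> proc_concave P \<FF> Tm (\<lambda>a. U a z \<eta> + \<alpha>\<^sub>U / 2 * (proc_norm P Tm a)\<^sup>2)"
    using reg unfolding regular_utility_def by auto
  have D: "gateaux_gradient P \<FF> Tm (\<lambda>a. U a z \<eta>) a (D a z \<eta>)"
    if "a \<in> proc_space P \<FF> Tm" "z \<in> proc_space P \<FF> Tm" "\<eta> \<in> proc_space P \<FF> Tm" for a z \<eta>
    using bspec[OF bspec[OF D1 that(2)] that(3)] that(1) unfolding cont_gateaux_with_gradient_def by blast
  obtain \<Lambda> where \<Lambda>: "\<And>a a' z z' \<eta> \<eta>'. a \<in> A\<^sub>0 \<Longrightarrow> a' \<in> A\<^sub>0 \<Longrightarrow> z \<in> proc_space P \<FF> Tm \<Longrightarrow> z' \<in> proc_space P \<FF> Tm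
      \<Longrightarrow> \<eta> \<in> proc_space P \<FF> Tm \<Longrightarrow> \<eta>' \<in> proc_space P \<FF> Tm
      \<Longrightarrow> \<bar>U a z \<eta> - U a' z' \<eta>'\<bar>
          \<le> \<Lambda> * (proc_norm P Tm (a - a') + proc_norm P Tm (z - z') + proc_norm P Tm (\<eta> - \<eta>'))"
    using lip unfolding jointly_lipschitz_def by blast
  \<comment> \<open>Joint measurability of \<open>\<theta>\<close> makes
    \<open>\<omega> \<mapsto> \<theta> x \<omega> s\<close> measurable for every player and time, so
    the generated filtration stays inside \<open>P\<close>.\<close>
  have filt: "space (\<FF> t) = space P" "sets (\<FF> t) \<subseteq> sets P" if t: "t \<in> {0..Tm}" for t
  proof -
    have "(\<lambda>\<omega>. \<theta> x \<omega> s) \<in> borel_measurable P" if x: "x \<in> {0..1}" and s: "s \<in> {0..t}" for x s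
    proof -
      have "x \<in> space \<nu>" using ext x by (simp add: extends_lebesgue_01_def)
      moreover have "(\<lambda>(x, t, \<omega>). \<theta> x \<omega> t) \<in> borel_measurable (\<nu> \<Otimes>\<^sub>M (restrict_space borel {0..Tm} \<Otimes>\<^sub>M P))"
        using \<theta> by (simp add: prof_space_def)
      ultimately have "(\<lambda>(t, \<omega>). \<theta> x \<omega> t) \<in> borel_measurable (restrict_space borel {0..Tm} \<Otimes>\<^sub>M P)"
        using measurable_Pair2 by fastforce
      moreover have "s \<in> space (restrict_space borel {0..Tm})" using s t by (simp add: space_restrict_space)
      ultimately show ?thesis using measurable_Pair2 by fastforce
    qed
    then show "space (\<FF> t) = space P" "sets (\<FF> t) \<subseteq> sets P"
      unfolding FF by (intro aug_filtration_subalgebra; blast)+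
  qed
  \<comment> \<open>The Lipschitz constant comes without a sign; its absolute value serves as a
    nonnegative one.\<close>
  have \<Lambda>': "\<bar>U a z \<eta> - U a' z' \<eta>'\<bar>
      \<le> \<bar>\<Lambda>\<bar> * (proc_norm P Tm (a - a') + proc_norm P Tm (z - z') + proc_norm P Tm (\<eta> - \<eta>'))"
    if "a \<in> A\<^sub>0" "a' \<in> A\<^sub>0" "z \<in> proc_space P \<FF> Tm" "z' \<in> proc_space P \<FF> Tm"
      "\<eta> \<in> proc_space P \<FF> Tm" "\<eta>' \<in> proc_space P \<FF> Tm" for a a' z z' \<eta> \<eta>'
  proof (rule order_trans[OF \<Lambda>[OF that] mult_right_mono])
    have "0 \<le> proc_norm P Tm b" for b
      unfolding proc_norm_def set_lebesgue_integral_def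
      by (intro real_sqrt_ge_zero Bochner_Integration.integral_nonneg) simp
    then show "0 \<le> proc_norm P Tm (a - a') + proc_norm P Tm (z - z') + proc_norm P Tm (\<eta> - \<eta>')"
      by (intro add_nonneg_nonneg)
  qed simp
  interpret P: prob_space P by (rule P)
  interpret g: graphon_game P \<FF> Tm U A\<^sub>0 D \<alpha>\<^sub>U l\<^sub>U l\<^sub>\<theta> M "\<bar>\<Lambda>\<bar>" \<nu>
    by unfold_locales (fact Tm filt assms(8) A0 assms(12,13,14) assms(16)[rule_format] D D2[rule_format]
        \<alpha> conc abs_ge_zero \<Lambda>' ext)+
  have W01: "\<And>x y. x \<in> {0..1} \<Longrightarrow> y \<in> {0..1} \<Longrightarrow> 0 \<le> W x y"
    using W by (simp add: graphon_def)
  have Wk: "lebesgue_kernel \<nu> W"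
    using W by unfold_locales (auto simp: graphon_def)
  interpret W: lebesgue_kernel \<nu> W by (rule Wk)
  define \<rho> where "\<rho> = W.opnorm"
  have \<rho>0: "0 \<le> \<rho>" and \<rho>A: "l\<^sub>U * \<rho> < \<alpha>\<^sub>U"
    and \<rho>b: "\<And>f. f \<in> sqint \<nu> \<Longrightarrow> l2norm \<nu> (\<lambda>x. LINT y|\<nu>. W x y * f y) \<le> \<rho> * l2norm \<nu> f"
    unfolding \<rho>_def using W.opnorm_nonneg W.op_le_opnorm A4 W.largest_eigenvalue_eq_opnorm[OF W01] by auto
  define c where "c N = cut_norm (\<lambda>x y. W x y - step_graphon N (G N) x y)" for N
  define \<sigma> where "\<sigma> N = sqrt (4 * c N)" for N
  define d where "d N = g.pn (\<theta> - step_profile N (\<theta>N N))" for N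
  have c0: "c \<longlonglongrightarrow> 0" and d0: "d \<longlonglongrightarrow> 0"
    using cut \<theta>lim unfolding c_def d_def by auto
  \<comment> \<open>The spectral inequality is strict, so it survives the vanishing perturbation of
    the kernel from some index on; this determines \<open>N0\<close>.\<close>
  have "(\<lambda>N. l\<^sub>U * (\<rho> + \<sigma> N)) \<longlonglongrightarrow> l\<^sub>U * (\<rho> + sqrt (4 * 0))"
    unfolding \<sigma>_def by (intro tendsto_intros c0)
  then have "\<forall>\<^sub>F N in sequentially. l\<^sub>U * (\<rho> + \<sigma> N) < \<alpha>\<^sub>U"
    using \<rho>A by (intro order_tendstoD(2)) auto
  then obtain N1 where N1: "\<And>N. N \<ge> N1 \<Longrightarrow> l\<^sub>U * (\<rho> + \<sigma> N) < \<alpha>\<^sub>U"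
    unfolding eventually_sequentially by blast
  define N0 where "N0 = max 1 N1"
  have GN: "\<And>i j. i \<in> {1..N} \<Longrightarrow> j \<in> {1..N} \<Longrightarrow> 0 \<le> G N i j \<and> G N i j \<le> 1 \<and> G N i j = G N j i"
    if "1 \<le> N" for N using G that by blast
  have \<theta>NV: "\<And>i. i \<in> {1..N} \<Longrightarrow> \<theta>N N i \<in> g.V" if "1 \<le> N" for N
    using \<theta>N that by (simp add: fin_prof_space_def)
  have \<theta>barF: "\<theta>bar \<in> g.prof" "(g.pn \<theta>bar)\<^sup>2 \<le> C\<^sub>B"
    using \<theta>bar by (auto simp: is_arg_max_linorder graphon_feasible_def)
  let ?gw = "graphon_welfare P \<FF> Tm \<nu> (\<lambda>_. A\<^sub>0) U \<theta> W"
  let ?nw = "\<lambda>N. network_welfare A\<^sub>0 U N (\<theta>N N) (G N)"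
  let ?F = "network_feasible P \<FF> Tm C\<^sub>B"
  let ?t = "approx_intervention P Tm \<nu> \<theta>bar"
  let ?C = "g.stability_const \<rho>"
  define R where "R N = max (max (sqrt (c N)) (d N)) (1 / sqrt (real N))" for N
  \<comment> \<open>Twice the sampling constant, because normalizing the samples at most doubles the
    sampling error.\<close>
  define E where "E = 2 * sqrt (L\<^sup>2 + 4 * \<theta>max\<^sup>2 * real (card \<I>))"
  have C0: "0 \<le> ?C" by (rule g.stability_const_nonneg[OF \<rho>0 \<rho>A])
  have E0: "0 \<le> E" unfolding E_def by simp
  have unique: "unique_network_nash P Tm A\<^sub>0 U N (\<theta>N N + \<eta>) (G N)"
    if N: "N \<ge> N0" and \<eta>: "\<eta> \<in> fin_prof_space P \<FF> Tm N" for N \<eta>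
  proof -
    have N': "1 \<le> N" "l\<^sub>U * (\<rho> + \<sigma> N) < \<alpha>\<^sub>U" using N N1 by (auto simp: N0_def)
    show ?thesis
      by (rule g.network_unique_nash[OF Wk W01 N'(1) GN[OF N'(1)] \<rho>0 N'(2)[unfolded \<sigma>_def c_def] \<rho>b \<theta> \<theta>NV[OF N'(1)]])
        (use \<eta> in \<open>auto simp: fin_prof_space_def\<close>)
  qed
  have close: "\<bar>?nw N \<eta> - ?gw \<eta>'\<bar> \<le> ?C * max (\<sigma> N) (d N + g.pn (\<eta>' - step_profile N \<eta>))"
    if N: "N \<ge> N0" and \<eta>: "\<And>i. i \<in> {1..N} \<Longrightarrow> \<eta> i \<in> g.V" and \<eta>': "\<eta>' \<in> g.prof" for N \<eta> \<eta>'
  proof -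
    have N': "1 \<le> N" "l\<^sub>U * (\<rho> + \<sigma> N) < \<alpha>\<^sub>U" using N N1 by (auto simp: N0_def)
    show ?thesis
      unfolding \<sigma>_def c_def d_def
      by (rule g.network_graphon_welfare_diff[OF Wk W01 N'(1) GN[OF N'(1)] \<rho>0 N'(2)[unfolded \<sigma>_def c_def] \<rho>b \<theta> \<theta>NV[OF N'(1)] \<eta> \<eta>'])
  qed
  have bound: "\<bar>network_opt P \<FF> Tm C\<^sub>B A\<^sub>0 U N (\<theta>N N) (G N) - ?nw N (?t N)\<bar> \<le> ?C * (4 + E) * R N"
    if N: "N \<ge> N0" for N
  proof -
    have N': "1 \<le> N" using N by (simp add: N0_def)
    \<comment> \<open>The step profile of a feasible network intervention obeys the same budget, so
      it cannot beat \<open>\<theta>bar\<close> in the graphon problem. Measured against its own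
      step profile, an intervention contributes no distance: only the errors of kernel and
      heterogeneity remain.\<close>
    have upper: "?nw N \<eta> \<le> ?gw \<theta>bar + ?C * max (\<sigma> N) (d N)" if \<eta>: "\<eta> \<in> ?F N" for \<eta>
    proof -
      have \<eta>V: "\<eta> i \<in> g.V" if "i \<in> {1..N}" for i
        using \<eta> that by (simp add: network_feasible_def fin_prof_space_def)
      have sp: "step_profile N \<eta> \<in> g.prof" by (rule g.step_profile_prof[OF N' \<eta>V])
      have "step_profile N \<eta> \<in> graphon_feasible P \<FF> Tm \<nu> C\<^sub>B"
        using sp \<eta> g.pn_step_sq[OF N', of \<eta>] by (simp add: graphon_feasible_def network_feasible_def)
      then have "?gw (step_profile N \<eta>) \<le> ?gw \<theta>bar"
        using \<theta>bar by (simp add: is_arg_max_linorder)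
      moreover have "\<bar>?nw N \<eta> - ?gw (step_profile N \<eta>)\<bar>
          \<le> ?C * max (\<sigma> N) (d N + g.pn (step_profile N \<eta> - step_profile N \<eta>))"
        by (rule close[OF N _ sp]) (rule \<eta>V)
      moreover have "g.pn (step_profile N \<eta> - step_profile N \<eta>) = 0"
        by (simp add: g.pn_eq)
      ultimately show ?thesis by simp
    qed
    note t = g.approx_intervention[OF \<theta>barF(1) N']
    have tF: "?t N \<in> ?F N"
    proof -
      have "(g.pn (step_profile N (?t N)))\<^sup>2 \<le> (g.pn \<theta>bar)\<^sup>2"
        using t(2) by (intro power_mono) auto
      then show ?thesis
        using t(1) g.pn_step_sq[OF N', of "?t N"] \<theta>barF(2)
        by (simp add: network_feasible_def fin_prof_space_def)
    qed
    have err: "g.pn (\<theta>bar - step_profile N (?t N)) \<le> E * (1 / sqrt (real N))"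
    proof -
      have "g.pn (\<theta>bar - step_profile N (\<lambda>i. \<theta>bar (real i / real N)))
          \<le> sqrt (L\<^sup>2 + 4 * \<theta>max\<^sup>2 * real (card \<I>)) / sqrt (real N)"
        by (rule g.sampling_error[OF \<theta>barF(1) _ \<I>(1,2) _ _ N']) (use \<theta>max \<I>(3,4) in auto)
      then show ?thesis using t(3) unfolding E_def by simp
    qed
    have R: "\<sigma> N \<le> 2 * R N" "d N \<le> R N" "E * (1 / sqrt (real N)) \<le> E * R N" "0 \<le> R N"
    proof -
      have "\<sigma> N = 2 * sqrt (c N)" by (simp add: \<sigma>_def real_sqrt_mult)
      then show "\<sigma> N \<le> 2 * R N" by (simp add: R_def)
      show "d N \<le> R N" by (simp add: R_def)
      show "E * (1 / sqrt (real N)) \<le> E * R N" using E0 by (intro mult_left_mono) (auto simp: R_def)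
      have "0 \<le> 1 / sqrt (real N)" by simp
      then show "0 \<le> R N" unfolding R_def by (rule order_trans) simp
    qed
    have m1: "?C * max (\<sigma> N) (d N) \<le> ?C * (2 * R N)"
      using R C0 by (intro mult_left_mono) auto
    have "max (\<sigma> N) (d N + g.pn (\<theta>bar - step_profile N (?t N))) \<le> (2 + E) * R N"
    proof (rule max.boundedI)
      have ER: "0 \<le> E * R N" by (rule mult_nonneg_nonneg[OF E0 R(4)])
      show "\<sigma> N \<le> (2 + E) * R N"
        unfolding distrib_right using R(1) ER by linarith
      show "d N + g.pn (\<theta>bar - step_profile N (?t N)) \<le> (2 + E) * R N"
        unfolding distrib_right using R(2,3,4) err by linarith
    qed
    then have m2: "?C * max (\<sigma> N) (d N + g.pn (\<theta>bar - step_profile N (?t N))) \<le> ?C * ((2 + E) * R N)"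
      using C0 by (rule mult_left_mono)
    have "\<bar>?nw N (?t N) - ?gw \<theta>bar\<bar>
        \<le> ?C * max (\<sigma> N) (d N + g.pn (\<theta>bar - step_profile N (?t N)))"
      by (rule close[OF N _ \<theta>barF(1)]) (rule t(1))
    with m2 have lower: "?gw \<theta>bar \<le> ?nw N (?t N) + ?C * ((2 + E) * R N)"
      by linarith
    have up: "?nw N \<eta> \<le> ?gw \<theta>bar + ?C * (2 * R N)" if "\<eta> \<in> ?F N" for \<eta>
      using upper[OF that] m1 by linarith
    have "network_opt P \<FF> Tm C\<^sub>B A\<^sub>0 U N (\<theta>N N) (G N) \<le> ?gw \<theta>bar + ?C * (2 * R N)"
      unfolding network_opt_def using tF up by (intro cSUP_least) auto
    \<comment> \<open>The uniform bound \<open>up\<close> also shows that the supremum in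
      \<open>network_opt\<close> is taken over a bounded set.\<close>
    moreover have "?nw N (?t N) \<le> network_opt P \<FF> Tm C\<^sub>B A\<^sub>0 U N (\<theta>N N) (G N)"
      unfolding network_opt_def by (rule cSUP_upper[OF tF bdd_aboveI2[OF up]])
    \<comment> \<open>The detour through the graphon optimum costs \<open>2 * R N\<close> for the
      upper estimate and \<open>(2 + E) * R N\<close> for the lower one, each times the stability
      constant.\<close>
    ultimately have "\<bar>network_opt P \<FF> Tm C\<^sub>B A\<^sub>0 U N (\<theta>N N) (G N) - ?nw N (?t N)\<bar>
        \<le> ?C * (2 * R N) + ?C * ((2 + E) * R N)"
      using lower by linarith
    also have "\<dots> = ?C * (4 + E) * R N" by (simp add: algebra_simps)
    finally show ?thesis .
  qed
  have R0: "R \<longlonglongrightarrow> 0"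
  proof -
    have "(\<lambda>N. 1 / sqrt (real N)) \<longlonglongrightarrow> 0"
      by (intro tendsto_divide_0[OF tendsto_const] filterlim_at_top_imp_at_infinity
          filterlim_compose[OF sqrt_at_top filterlim_real_sequentially])
    then have "R \<longlonglongrightarrow> max (max (sqrt 0) 0) 0"
      unfolding R_def[abs_def] by (intro tendsto_max tendsto_real_sqrt c0 d0)
    then show ?thesis by simp
  qed
  have "(\<lambda>N. network_opt P \<FF> Tm C\<^sub>B A\<^sub>0 U N (\<theta>N N) (G N) - ?nw N (?t N)) \<longlonglongrightarrow> 0"
  proof (rule Lim_null_comparison)
    show "\<forall>\<^sub>F N in sequentially. norm (network_opt P \<FF> Tm C\<^sub>B A\<^sub>0 U N (\<theta>N N) (G N) - ?nw N (?t N)) \<le> ?C * (4 + E) * R N"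
      using eventually_ge_at_top[of N0] by eventually_elim (simp add: bound)
    show "(\<lambda>N. ?C * (4 + E) * R N) \<longlonglongrightarrow> 0"
      using tendsto_mult_left[OF R0, of "?C * (4 + E)"] by simp
  qed
  moreover have "\<exists>C. \<forall>N\<ge>N0. \<bar>network_opt P \<FF> Tm C\<^sub>B A\<^sub>0 U N (\<theta>N N) (G N) - ?nw N (?t N)\<bar> \<le> C * R N"
    using bound by blast
  moreover have "1 \<le> N0" by (simp add: N0_def)
  ultimately show ?thesis
    using unique unfolding R_def c_def d_def by (intro exI[of _ N0]) blast
qed

end
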